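(* Let $\Sigma=\{P_1,\dots,P_s\}$ be a differential system in the variables $X=\{x_1,\dots,x_n\}$, $s\le n$, and let $\eta$ be a point of the diffiety defined by $\Sigma$. (i) If $\Sigma$ is an $\bar o$-system which is regular at $\eta$, then $\Sigma$ admits a lazy flat parametrization at $\eta$. (ii) If $\Sigma$ admits a lazy flat parametrization at $\eta$ with flat output $Z\subset X$ and $\nabla_{X\setminus Z,\Sigma}(\eta)\ne0$, then $\Sigma$ is an $\bar o$-system which is regular at $\eta$. (iii) If $\Sigma$ is an $\bar o$-system which is regular at $\eta$, then it is flat at $\eta$.
   Context: All functions are analytic. $\mathbf J(\mathbb R,\mathbb R^n)$ is the infinite jet space with coordinates $t$ and $x_j^{(k)}$ ($1\le j\le n$, $k\in\mathbb N$), with the coarsest topology making the coordinates continuous, and with derivation $d_t=\partial_t+\sum_{j,k}x_j^{(k+1)}\partial/\partial x_j^{(k)}$. A differential function on an open set $V$ is an analytic function of finitely many coordinates; these form the ring $\mathcal O(V)$. A differential system $\Sigma=\{P_1,\dots,P_s\}$ in $X=\{x_1,\dots,x_n\}$ is a finite set of differential functions (equations $P_i=0$). The diffiety it defines near a point $\eta$ where all $d_t^kP_i$ vanish is the common zero set of all $d_t^kP_i$ with the derivation induced by $d_t$. Flatness. $\Sigma$ is flat at $\eta$ if $\eta$ has a neighborhood in the diffiety that is isomorphic to an open subset of $\mathbf J(\mathbb R,\mathbb R^m)$ for some $m$, by a smooth bijection with smooth inverse compatible with the derivations. Jacobi numbers. $\mathrm{ord}_{x_j}P$ is the largest $k$ such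 that $P$ depends on $x_j^{(k)}$, and $-\infty$ if $P$ depends on none of them. Put $a_{i,j}=\mathrm{ord}_{x_j}P_i$. For $Y\subset X$ with $\sharp Y=s$, $\mathcal O_{Y,\Sigma}=\max_\sigma\sum_{i=1}^s a_{i,\sigma(i)}$ over bijections $\sigma:\{1,\dots,s\}\to Y$ (variables are identified with their indices). $\hat{\mathcal O}_\Sigma=\min\{\mathcal O_{Y,\Sigma}:\sharp Y=s,\ \mathcal O_{Y,\Sigma}\neq-\infty\}$ ($-\infty$ if there is no such $Y$). $\Sigma$ is an $\bar o$-system if $\hat{\mathcal O}_\Sigma=0$. Truncated determinant. For $Y$ with $\mathcal O_{Y,\Sigma}\neq-\infty$, consider the square matrix $(a_{i,j})_{1\le i\le s,\,j\in Y}$. A canon is a vector $\ell\in\mathbb N^s$ for which there is a bijection $\sigma_0:\{1,\dots,s\}\to Y$ with $a_{i,\sigma_0(i)}+\ell_i=\max_{i'}(a_{i',\sigma_0(i)}+\ell_{i'})$ for all $i$. There is a unique componentwise minimal canon $\lambda$. Put $\alpha_i=\max_k\lambda_k-\lambda_i$, $\beta_j=\max_i(a_{i,j}-\alpha_i)$. Then $\nabla_{Y,\Sigma}$ is the determinant of the matrix whose $(i,j)$ entry ($j\in Y$) is $\partial P_i/\partial x_j^{(a_{i,j})}$ if $a_{i,j}=\alpha_i+\beta_j$ and $0$ otherwise. Writing $\nabla_{Y,\Sigma}(\eta)\neq0$ includes the requirements $\sharp Y=s$ and $\mathcal O_{Y,\Sigma}\ne-\infty$. An $\bar o$-system $\Sigma$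 is regular at $\eta$ if there is $Y\subset X$, $\sharp Y=s$, with $\mathcal O_{Y,\Sigma}=\hat{\mathcal O}_\Sigma=0$ and $\nabla_{Y,\Sigma}(\eta)\neq0$. Lazy flat parametrization. $\Sigma$ admits a lazy flat parametrization at $\eta$ with flat output $Z$ if there are a partition $X=\bigcup_{h=0}^r\Xi_h$ with $\Xi_0=Z$ and an open neighborhood $V$ of $\eta$ in $\mathbf J(\mathbb R,\mathbb R^n)$ such that for all $0<h\le r$ and all $x_{i_0}\in\Xi_h$ there is a differential function $H_{i_0}$ on $V$, depending only on $t$, the variables of $\Xi_0\cup\dots\cup\Xi_{h-1}$ and their derivatives, such that $x_{i_0}-H_{i_0}$ belongs to the algebraic (not differential) ideal generated by $\Sigma$ in $\mathcal O(V)$. *)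

theory Defs
  imports
    "HOL-Analysis.Derivative"
    "HOL-Analysis.Function_Topology"
    "HOL-Analysis.Infinite_Sum"
    "HOL-Library.Extended_Real"
    "Jordan_Normal_Form.Determinant"
begin

text \<open>
  Variables and equations are numbered from 0: the variables are x_j for j < n and the
  equations are P i = 0 for i < s.  Jet j k stands for the coordinate x_j^(k).
\<close>

datatype jet_coord = Time | Jet nat nat

type_synonym jet = "jet_coord \<Rightarrow> real"

definition jet_coords :: "nat \<Rightarrow> jet_coord set" where
  "jet_coords n = insert Time {Jet j k | j k. j < n}"

text \<open>
  Coordinates that do not exist in dimension n are fixed to 0.  The type \<^typ>\<open>jet\<close> carries the
  product topology, so the subspace topology on \<open>jet_space n\<close> is the coarsest one for which
  the coordinates are continuous.
\<close>

definition jet_space :: "nat \<Rightarrow> jet set" where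
  "jet_space n = {p. \<forall>c. c \<notin> jet_coords n \<longrightarrow> p c = 0}"

abbreviation jet_open :: "nat \<Rightarrow> jet set \<Rightarrow> bool" where
  "jet_open n V \<equiv> openin (top_of_set (jet_space n)) V"

definition multi_indices :: "jet_coord set \<Rightarrow> (jet_coord \<Rightarrow> nat) set" where
  "multi_indices C = {\<mu>. \<forall>c. c \<notin> C \<longrightarrow> \<mu> c = 0}"

text \<open>
  Around every point of V, f is the sum of a power series in the coordinates from a finite set C.
  In particular f takes the same value at points of V that agree on C (all terms other than that
  of the zero multi-index vanish), so f factors through the projection of V to these coordinates.
\<close>

definition differential_function :: "nat \<Rightarrow> jet set \<Rightarrow> (jet \<Rightarrow> real) \<Rightarrow> bool" where
  "differential_function n V f \<longleftrightarrow>
     (\<exists>C. finite C \<and> C \<subseteq> jet_coords n \<and>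
        (\<forall>p\<in>V. \<exists>a \<epsilon>. \<epsilon> > 0 \<and>
           (\<forall>q\<in>V. (\<forall>c\<in>C. \<bar>q c - p c\<bar> < \<epsilon>) \<longrightarrow>
              ((\<lambda>\<mu>. a \<mu> * (\<Prod>c\<in>C. (q c - p c) ^ \<mu> c)) has_sum f q) (multi_indices C))))"

definition jet_partial :: "jet_coord \<Rightarrow> (jet \<Rightarrow> real) \<Rightarrow> jet \<Rightarrow> real" where
  "jet_partial c f p = deriv (\<lambda>v. f (p(c := v))) (p c)"

text \<open>
  For a differential function only finitely many terms of the sum are nonzero.
\<close>

definition total_deriv :: "nat \<Rightarrow> (jet \<Rightarrow> real) \<Rightarrow> jet \<Rightarrow> real" where
  "total_deriv n f p =
     jet_partial Time f p +
     (\<Sum>\<^sub>\<infinity>(j, k)\<in>{..<n} \<times> UNIV. p (Jet j (Suc k)) * jet_partial (Jet j k) f p)"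

definition differential_system :: "nat \<Rightarrow> nat \<Rightarrow> jet set \<Rightarrow> (nat \<Rightarrow> jet \<Rightarrow> real) \<Rightarrow> bool" where
  "differential_system n s U P \<longleftrightarrow> jet_open n U \<and> (\<forall>i<s. differential_function n U (P i))"

definition diffiety :: "nat \<Rightarrow> nat \<Rightarrow> jet set \<Rightarrow> (nat \<Rightarrow> jet \<Rightarrow> real) \<Rightarrow> jet set" where
  "diffiety n s U P = {p\<in>U. \<forall>i<s. \<forall>k. (total_deriv n ^^ k) (P i) p = 0}"


text \<open>
  Functions, derivations and morphisms on subsets of jet spaces.  A function on a subset A is
  smooth if it is locally the restriction of a differential function, and the derivation induced
  on A sends the restriction of G to the restriction of \<open>total_deriv n G\<close>.
\<close>

definition smooth_on_subset :: "nat \<Rightarrow> jet set \<Rightarrow> (jet \<Rightarrow> real) \<Rightarrow> bool" where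
  "smooth_on_subset n A h \<longleftrightarrow>
     (\<forall>p\<in>A. \<exists>V G. jet_open n V \<and> p \<in> V \<and> differential_function n V G \<and>
        (\<forall>q\<in>V \<inter> A. h q = G q))"

definition has_induced_deriv ::
    "nat \<Rightarrow> jet set \<Rightarrow> (jet \<Rightarrow> real) \<Rightarrow> (jet \<Rightarrow> real) \<Rightarrow> bool" where
  "has_induced_deriv n A h h' \<longleftrightarrow>
     (\<forall>V G. jet_open n V \<and> differential_function n V G \<and> (\<forall>q\<in>V \<inter> A. h q = G q) \<longrightarrow>
        (\<forall>q\<in>V \<inter> A. h' q = total_deriv n G q))"

definition diffiety_morphism ::
    "nat \<Rightarrow> jet set \<Rightarrow> nat \<Rightarrow> jet set \<Rightarrow> (jet \<Rightarrow> jet) \<Rightarrow> bool" where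
  "diffiety_morphism n A m B \<phi> \<longleftrightarrow>
     \<phi> ` A \<subseteq> B \<and>
     (\<forall>c\<in>jet_coords m. smooth_on_subset n A (\<lambda>p. \<phi> p c)) \<and>
     (\<forall>W g. jet_open m W \<and> differential_function m W g \<longrightarrow>
        has_induced_deriv n (A \<inter> \<phi> -` W) (g \<circ> \<phi>) (total_deriv m g \<circ> \<phi>))"

definition flat_at :: "nat \<Rightarrow> nat \<Rightarrow> jet set \<Rightarrow> (nat \<Rightarrow> jet \<Rightarrow> real) \<Rightarrow> jet \<Rightarrow> bool" where
  "flat_at n s U P \<eta> \<longleftrightarrow>
     (\<exists>m A B \<phi>.
        openin (top_of_set (diffiety n s U P)) A \<and> \<eta> \<in> A \<and>
        jet_open m B \<and>
        bij_betw \<phi> A B \<and>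
        diffiety_morphism n A m B \<phi> \<and>
        diffiety_morphism m B n A (inv_into A \<phi>))"


definition depends_on :: "jet set \<Rightarrow> (jet \<Rightarrow> real) \<Rightarrow> jet_coord \<Rightarrow> bool" where
  "depends_on V f c \<longleftrightarrow> (\<exists>p v. p \<in> V \<and> p(c := v) \<in> V \<and> f (p(c := v)) \<noteq> f p)"

definition depends_only_on :: "jet set \<Rightarrow> (jet \<Rightarrow> real) \<Rightarrow> jet_coord set \<Rightarrow> bool" where
  "depends_only_on V f S \<longleftrightarrow> (\<forall>p\<in>V. \<forall>q\<in>V. (\<forall>c\<in>S. p c = q c) \<longrightarrow> f p = f q)"

text \<open>
  \<open>top_order\<close> is meaningful only if some derivative of x_j occurs; \<open>jet_ord\<close> covers the other
  case by the value \<open>-\<infinity>\<close>.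
\<close>

definition top_order :: "jet set \<Rightarrow> (jet \<Rightarrow> real) \<Rightarrow> nat \<Rightarrow> nat" where
  "top_order U f j = (GREATEST k. depends_on U f (Jet j k))"

definition jet_ord :: "jet set \<Rightarrow> (jet \<Rightarrow> real) \<Rightarrow> nat \<Rightarrow> ereal" where
  "jet_ord U f j =
     (if \<exists>k. depends_on U f (Jet j k) then ereal (real (top_order U f j)) else -\<infinity>)"

text \<open>
  The supremum is a maximum: only finitely many values occur, as a sum depends only on the
  restriction of \<open>\<sigma>\<close> to \<open>{..<s}\<close>.
\<close>

definition jacobi_number :: "nat \<Rightarrow> (nat \<Rightarrow> nat \<Rightarrow> ereal) \<Rightarrow> nat set \<Rightarrow> ereal" where
  "jacobi_number s a Y = (SUP \<sigma>\<in>{\<sigma>. bij_betw \<sigma> {..<s} Y}. \<Sum>i<s. a i (\<sigma> i))"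

definition admissible_vars :: "nat \<Rightarrow> nat \<Rightarrow> (nat \<Rightarrow> nat \<Rightarrow> ereal) \<Rightarrow> nat set set" where
  "admissible_vars n s a = {Y. Y \<subseteq> {..<n} \<and> card Y = s \<and> jacobi_number s a Y \<noteq> -\<infinity>}"

definition saddle_jacobi_number :: "nat \<Rightarrow> nat \<Rightarrow> (nat \<Rightarrow> nat \<Rightarrow> ereal) \<Rightarrow> ereal" where
  "saddle_jacobi_number n s a =
     (if admissible_vars n s a = {} then -\<infinity>
      else Min (jacobi_number s a ` admissible_vars n s a))"

text \<open>
  A vector of length s is a function that vanishes outside \<open>{..<s}\<close>.
\<close>

definition is_canon :: "nat \<Rightarrow> (nat \<Rightarrow> nat \<Rightarrow> ereal) \<Rightarrow> nat set \<Rightarrow> (nat \<Rightarrow> nat) \<Rightarrow> bool" where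
  "is_canon s a Y l \<longleftrightarrow>
     (\<forall>i\<ge>s. l i = 0) \<and>
     (\<exists>\<sigma>. bij_betw \<sigma> {..<s} Y \<and>
        (\<forall>i<s. a i (\<sigma> i) + ereal (real (l i)) =
                 (MAX i'\<in>{..<s}. a i' (\<sigma> i) + ereal (real (l i')))))"

definition minimal_canon :: "nat \<Rightarrow> (nat \<Rightarrow> nat \<Rightarrow> ereal) \<Rightarrow> nat set \<Rightarrow> nat \<Rightarrow> nat" where
  "minimal_canon s a Y =
     (THE l. is_canon s a Y l \<and> (\<forall>l'. is_canon s a Y l' \<longrightarrow> (\<forall>i<s. l i \<le> l' i)))"

definition canon_alpha :: "nat \<Rightarrow> (nat \<Rightarrow> nat \<Rightarrow> ereal) \<Rightarrow> nat set \<Rightarrow> nat \<Rightarrow> nat" where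
  "canon_alpha s a Y i = (MAX k\<in>{..<s}. minimal_canon s a Y k) - minimal_canon s a Y i"

definition canon_beta :: "nat \<Rightarrow> (nat \<Rightarrow> nat \<Rightarrow> ereal) \<Rightarrow> nat set \<Rightarrow> nat \<Rightarrow> ereal" where
  "canon_beta s a Y j = (MAX i\<in>{..<s}. a i j - ereal (real (canon_alpha s a Y i)))"

definition order_matrix :: "jet set \<Rightarrow> (nat \<Rightarrow> jet \<Rightarrow> real) \<Rightarrow> nat \<Rightarrow> nat \<Rightarrow> ereal" where
  "order_matrix U P = (\<lambda>i j. jet_ord U (P i) j)"

text \<open>
  The columns are indexed by Y in increasing order; another order would only change the sign.
\<close>

definition truncated_det ::
    "nat \<Rightarrow> jet set \<Rightarrow> (nat \<Rightarrow> jet \<Rightarrow> real) \<Rightarrow> nat set \<Rightarrow> jet \<Rightarrow> real" where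
  "truncated_det s U P Y p =
     (let a = order_matrix U P in
      det (mat s s (\<lambda>(i, k).
        let j = sorted_list_of_set Y ! k in
        if a i j = ereal (real (canon_alpha s a Y i)) + canon_beta s a Y j
        then jet_partial (Jet j (top_order U (P i) j)) (P i) p
        else 0)))"

definition truncated_det_nonzero_at ::
    "nat \<Rightarrow> nat \<Rightarrow> jet set \<Rightarrow> (nat \<Rightarrow> jet \<Rightarrow> real) \<Rightarrow> nat set \<Rightarrow> jet \<Rightarrow> bool" where
  "truncated_det_nonzero_at n s U P Y \<eta> \<longleftrightarrow>
     Y \<in> admissible_vars n s (order_matrix U P) \<and> truncated_det s U P Y \<eta> \<noteq> 0"

definition obar_system :: "nat \<Rightarrow> nat \<Rightarrow> jet set \<Rightarrow> (nat \<Rightarrow> jet \<Rightarrow> real) \<Rightarrow> bool" where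
  "obar_system n s U P \<longleftrightarrow> saddle_jacobi_number n s (order_matrix U P) = 0"

definition regular_obar_system_at ::
    "nat \<Rightarrow> nat \<Rightarrow> jet set \<Rightarrow> (nat \<Rightarrow> jet \<Rightarrow> real) \<Rightarrow> jet \<Rightarrow> bool" where
  "regular_obar_system_at n s U P \<eta> \<longleftrightarrow>
     obar_system n s U P \<and>
     (\<exists>Y. Y \<subseteq> {..<n} \<and> card Y = s \<and> jacobi_number s (order_matrix U P) Y = 0 \<and>
        truncated_det_nonzero_at n s U P Y \<eta>)"


definition algebraic_ideal ::
    "nat \<Rightarrow> nat \<Rightarrow> jet set \<Rightarrow> (nat \<Rightarrow> jet \<Rightarrow> real) \<Rightarrow> (jet \<Rightarrow> real) set" where
  "algebraic_ideal n s V P =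
     {f. \<exists>Q. (\<forall>i<s. differential_function n V (Q i)) \<and> (\<forall>p\<in>V. f p = (\<Sum>i<s. Q i p * P i p))}"

text \<open>
  The blocks \<open>\<Xi> h\<close> may be empty; in particular the flat output Z is empty when s = n.
\<close>

definition lazy_flat_parametrization ::
    "nat \<Rightarrow> nat \<Rightarrow> jet set \<Rightarrow> (nat \<Rightarrow> jet \<Rightarrow> real) \<Rightarrow> jet \<Rightarrow> nat set \<Rightarrow> bool" where
  "lazy_flat_parametrization n s U P \<eta> Z \<longleftrightarrow>
     (\<exists>(r :: nat) \<Xi> V.
        (\<Union>h\<le>r. \<Xi> h) = {..<n} \<and> disjoint_family_on \<Xi> {..r} \<and> \<Xi> 0 = Z \<and>
        jet_open n V \<and> V \<subseteq> U \<and> \<eta> \<in> V \<and>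
        (\<forall>h. 0 < h \<and> h \<le> r \<longrightarrow>
           (\<forall>i0\<in>\<Xi> h. \<exists>H.
              differential_function n V H \<and>
              depends_only_on V H (insert Time {Jet j k | j k. j \<in> (\<Union>h'<h. \<Xi> h')}) \<and>
              (\<lambda>p. p (Jet i0 0) - H p) \<in> algebraic_ideal n s V P)))"

end

theory Submission
  imports Defs
begin

text \<open>
  Let \<open>Y\<close> be a set of \<open>s\<close> variables with nonzero truncated determinant. The numbers
  \<open>\<alpha> i + \<beta> j\<close> bound the order of \<open>P_i\<close> in \<open>x_j\<close>, and a nonzero term of the determinant is a
  matching that attains these bounds (\<open>jacobi_number_cover\<close>). So the Jacobi number of \<open>Y\<close> is
  \<open>\<Sum> \<alpha> + \<Sum> \<beta>\<close>.

  If this number is zero, all orders along the matching are zero, since orders are natural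
  numbers. Hence \<open>\<beta>\<close> is \<open>- \<alpha>\<close> along the matching, and \<open>\<alpha>\<close> sorts the equations, together with
  their matched variables, into levels: an equation involves the variables of its own level
  without derivatives, and other variables in \<open>Y\<close> only if they have lower level. The truncated
  determinant is block triangular, and its diagonal blocks are ordinary Jacobian determinants
  (\<open>regular_obar_levels\<close>). Each level can therefore be solved for its variables by the
  implicit function theorem, with lower levels as parameters. This is the lazy flat
  parametrization.

  The parametrization is required modulo an algebraic ideal of analytic functions. For this
  reason the implicit function theorem appears as Weierstrass division by functions of order
  one (\<open>weierstrass_division\<close>), which rests on a Neumann series in a weighted \<open>\<ell>1\<close> algebra of
  power series. Eliminating one equation at a time by such divisions shows that the equations
  of a level and the differences \<open>x_j - H_j\<close> generate the same ideal
  (\<open>implicit_functions_germ_ideal\<close>).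

  Equal ideals define equal diffieties. So the diffiety is, near \<open>\<eta>\<close>, the graph
  \<open>x_j^(k) = d_t^k H_j\<close> over the jets of the remaining variables, and the projection to those
  is the isomorphism required for flatness (\<open>solved_form_imp_flat\<close>).

  Conversely, the identities of a lazy flat parametrization are linearized at \<open>\<eta>\<close>. They
  express that the polynomial matrix of the linearized system becomes unitriangular after
  multiplication by a constant matrix, so its determinant is constant. The truncated
  determinant is its coefficient in the degree given by the Jacobi number, which must then be
  zero (\<open>lazy_flat_imp_regular_obar\<close>).
\<close>

section \<open>Convergent power series in jet coordinates\<close>

definition monomial_at :: "jet_coord set \<Rightarrow> (jet_coord \<Rightarrow> real) \<Rightarrow> (jet_coord \<Rightarrow> nat) \<Rightarrow> real" where
  "monomial_at C v \<mu> = (\<Prod>c\<in>C. v c ^ \<mu> c)"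

definition in_box :: "jet_coord set \<Rightarrow> jet \<Rightarrow> (jet_coord \<Rightarrow> real) \<Rightarrow> jet \<Rightarrow> bool" where
  "in_box C p r q \<longleftrightarrow> (\<forall>c\<in>C. \<bar>q c - p c\<bar> \<le> r c)"

text \<open>
  \<open>M\<close> bounds the weighted \<open>\<ell>1\<close> norm of the coefficients for the polyradius \<open>r\<close>. With this norm
  the convergent power series form a Banach algebra, and all constructions below amount to
  norm estimates. Values are prescribed on \<open>D\<close> only, because a differential function means
  nothing outside its domain; different coordinates may have different radii, which
  Weierstrass division needs.
\<close>

definition power_series_on ::
    "jet set \<Rightarrow> jet_coord set \<Rightarrow> jet \<Rightarrow> (jet_coord \<Rightarrow> real) \<Rightarrow> (jet \<Rightarrow> real) \<Rightarrow> real \<Rightarrow> bool" where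
  "power_series_on D C p r f M \<longleftrightarrow>
     (\<exists>a. (\<lambda>\<mu>. \<bar>a \<mu>\<bar> * monomial_at C r \<mu>) summable_on multi_indices C \<and>
          (\<Sum>\<^sub>\<infinity>\<mu>\<in>multi_indices C. \<bar>a \<mu>\<bar> * monomial_at C r \<mu>) \<le> M \<and>
          (\<forall>q\<in>D. in_box C p r q \<longrightarrow>
             ((\<lambda>\<mu>. a \<mu> * monomial_at C (\<lambda>c. q c - p c) \<mu>) has_sum f q) (multi_indices C)))"

lemma monomial_at_nonneg: "(\<And>c. c \<in> C \<Longrightarrow> r c \<ge> 0) \<Longrightarrow> monomial_at C r \<mu> \<ge> 0"
  by (simp add: monomial_at_def prod_nonneg)

lemma monomial_at_pos: "(\<And>c. c \<in> C \<Longrightarrow> r c > 0) \<Longrightarrow> monomial_at C r \<mu> > 0"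
  by (simp add: monomial_at_def prod_pos)

lemma abs_monomial_at_le:
  assumes "in_box C p r q"
  shows "\<bar>monomial_at C (\<lambda>c. q c - p c) \<mu>\<bar> \<le> monomial_at C r \<mu>"
  using assms unfolding monomial_at_def in_box_def abs_prod power_abs
  by (intro prod_mono conjI power_mono) auto

lemma power_series_onE:
  assumes "power_series_on D C p r f M"
  obtains a where "(\<lambda>\<mu>. \<bar>a \<mu>\<bar> * monomial_at C r \<mu>) summable_on multi_indices C"
    "(\<Sum>\<^sub>\<infinity>\<mu>\<in>multi_indices C. \<bar>a \<mu>\<bar> * monomial_at C r \<mu>) \<le> M"
    "\<And>q. q \<in> D \<Longrightarrow> in_box C p r q \<Longrightarrow>
       ((\<lambda>\<mu>. a \<mu> * monomial_at C (\<lambda>c. q c - p c) \<mu>) has_sum f q) (multi_indices C)"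
  using assms unfolding power_series_on_def by blast

lemma power_series_on_cong:
  assumes "power_series_on D C p r f M" "M \<le> M'" "D' \<subseteq> D"
    and "\<And>q. q \<in> D' \<Longrightarrow> in_box C p r q \<Longrightarrow> f q = g q"
  shows "power_series_on D' C p r g M'"
proof -
  obtain a where a: "(\<lambda>\<mu>. \<bar>a \<mu>\<bar> * monomial_at C r \<mu>) summable_on multi_indices C"
    "(\<Sum>\<^sub>\<infinity>\<mu>\<in>multi_indices C. \<bar>a \<mu>\<bar> * monomial_at C r \<mu>) \<le> M"
    "\<And>q. q \<in> D \<Longrightarrow> in_box C p r q \<Longrightarrow>
       ((\<lambda>\<mu>. a \<mu> * monomial_at C (\<lambda>c. q c - p c) \<mu>) has_sum f q) (multi_indices C)"
    by (rule power_series_onE[OF assms(1)]) blast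
  have "((\<lambda>\<mu>. a \<mu> * monomial_at C (\<lambda>c. q c - p c) \<mu>) has_sum g q) (multi_indices C)"
    if "q \<in> D'" "in_box C p r q" for q
    using a(3)[of q] assms(3,4) that by auto
  then show ?thesis unfolding power_series_on_def
    using a(1,2) assms(2) by (intro exI[of _ a]) auto
qed

lemma summable_on_abs_comparison:
  fixes f g :: "'a \<Rightarrow> real"
  assumes "g summable_on A" "\<And>x. x \<in> A \<Longrightarrow> \<bar>f x\<bar> \<le> g x"
  shows "f summable_on A" "(\<lambda>x. \<bar>f x\<bar>) summable_on A"
    and "\<bar>infsum f A\<bar> \<le> infsum g A" "infsum (\<lambda>x. \<bar>f x\<bar>) A \<le> infsum g A"
proof -
  show 1: "(\<lambda>x. \<bar>f x\<bar>) summable_on A"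
    using assms by (intro summable_on_comparison_test[OF assms(1)]) auto
  then show 2: "f summable_on A"
    unfolding summable_on_iff_abs_summable_on_real[of f] real_norm_def .
  show 3: "infsum (\<lambda>x. \<bar>f x\<bar>) A \<le> infsum g A"
    by (rule infsum_mono[OF 1 assms])
  show "\<bar>infsum f A\<bar> \<le> infsum g A"
    using norm_infsum_bound[of f A] 1 3 by simp
qed

lemma power_series_on_nonneg:
  assumes "power_series_on D C p r f M" "\<And>c. c \<in> C \<Longrightarrow> r c > 0"
  shows "M \<ge> 0"
proof -
  obtain a where "(\<Sum>\<^sub>\<infinity>\<mu>\<in>multi_indices C. \<bar>a \<mu>\<bar> * monomial_at C r \<mu>) \<le> M"
    using assms(1) unfolding power_series_on_def by blast
  moreover have "0 \<le> (\<Sum>\<^sub>\<infinity>\<mu>\<in>multi_indices C. \<bar>a \<mu>\<bar> * monomial_at C r \<mu>)"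
    using assms(2) by (intro infsum_nonneg mult_nonneg_nonneg monomial_at_nonneg) (auto intro: less_imp_le)
  ultimately show ?thesis by linarith
qed

lemma power_series_on_bound:
  assumes "power_series_on D C p r f M" "q \<in> D" "in_box C p r q"
  shows "\<bar>f q\<bar> \<le> M"
proof -
  obtain a where a: "(\<lambda>\<mu>. \<bar>a \<mu>\<bar> * monomial_at C r \<mu>) summable_on multi_indices C"
    "(\<Sum>\<^sub>\<infinity>\<mu>\<in>multi_indices C. \<bar>a \<mu>\<bar> * monomial_at C r \<mu>) \<le> M"
    "\<And>q. q \<in> D \<Longrightarrow> in_box C p r q \<Longrightarrow>
       ((\<lambda>\<mu>. a \<mu> * monomial_at C (\<lambda>c. q c - p c) \<mu>) has_sum f q) (multi_indices C)"
    by (rule power_series_onE[OF assms(1)]) blast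
  have "\<bar>\<Sum>\<^sub>\<infinity>\<mu>\<in>multi_indices C. a \<mu> * monomial_at C (\<lambda>c. q c - p c) \<mu>\<bar>
      \<le> (\<Sum>\<^sub>\<infinity>\<mu>\<in>multi_indices C. \<bar>a \<mu>\<bar> * monomial_at C r \<mu>)"
    by (rule summable_on_abs_comparison(3)[OF a(1)])
      (auto simp: abs_mult intro!: mult_left_mono abs_monomial_at_le[OF assms(3)])
  then show ?thesis using a(2) infsumI[OF a(3)[OF assms(2,3)]] by linarith
qed

lemma power_series_on_depends:
  assumes "power_series_on D C p r f M" "q \<in> D" "q' \<in> D" "in_box C p r q" "\<And>c. c \<in> C \<Longrightarrow> q c = q' c"
  shows "f q = f q'"
proof -
  obtain a where a: "\<And>q. q \<in> D \<Longrightarrow> in_box C p r q \<Longrightarrow>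
       ((\<lambda>\<mu>. a \<mu> * monomial_at C (\<lambda>c. q c - p c) \<mu>) has_sum f q) (multi_indices C)"
    by (rule power_series_onE[OF assms(1)]) blast
  have b: "in_box C p r q'" using assms(4,5) by (auto simp: in_box_def)
  have "monomial_at C (\<lambda>c. q c - p c) \<mu> = monomial_at C (\<lambda>c. q' c - p c) \<mu>" for \<mu>
    using assms(5) by (simp add: monomial_at_def)
  then show ?thesis using has_sum_unique[OF a[OF assms(2,4)]] a[OF assms(3) b] by simp
qed

text \<open>
  The norm bounds make the double series of all coefficients absolutely convergent, so the
  series may be added coefficientwise. Products, composition, inverses and the Neumann series
  in Weierstrass division are all obtained from this one fact.
\<close>

lemma power_series_on_infsum:
  assumes ps: "\<And>k. k \<in> K \<Longrightarrow> power_series_on D C p r (f k) (N k)"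
    and N: "N summable_on K" "infsum N K \<le> M"
    and F: "\<And>q. q \<in> D \<Longrightarrow> in_box C p r q \<Longrightarrow> ((\<lambda>k. f k q) has_sum F q) K"
    and r: "\<And>c. c \<in> C \<Longrightarrow> r c > 0"
  shows "power_series_on D C p r F M"
proof -
  let ?I = "multi_indices C" and ?W = "monomial_at C r"
  have "\<forall>k\<in>K. \<exists>a. (\<lambda>\<mu>. \<bar>a \<mu>\<bar> * ?W \<mu>) summable_on ?I \<and> (\<Sum>\<^sub>\<infinity>\<mu>\<in>?I. \<bar>a \<mu>\<bar> * ?W \<mu>) \<le> N k \<and>
     (\<forall>q\<in>D. in_box C p r q \<longrightarrow> ((\<lambda>\<mu>. a \<mu> * monomial_at C (\<lambda>c. q c - p c) \<mu>) has_sum f k q) ?I)"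
    using ps unfolding power_series_on_def by blast
  from bchoice[OF this] obtain a where a: "\<forall>k\<in>K. (\<lambda>\<mu>. \<bar>a k \<mu>\<bar> * ?W \<mu>) summable_on ?I \<and>
     (\<Sum>\<^sub>\<infinity>\<mu>\<in>?I. \<bar>a k \<mu>\<bar> * ?W \<mu>) \<le> N k \<and>
     (\<forall>q\<in>D. in_box C p r q \<longrightarrow> ((\<lambda>\<mu>. a k \<mu> * monomial_at C (\<lambda>c. q c - p c) \<mu>) has_sum f k q) ?I)"
    by blast
  then have a1: "\<And>k. k \<in> K \<Longrightarrow> (\<lambda>\<mu>. \<bar>a k \<mu>\<bar> * ?W \<mu>) summable_on ?I"
    and a2: "\<And>k. k \<in> K \<Longrightarrow> (\<Sum>\<^sub>\<infinity>\<mu>\<in>?I. \<bar>a k \<mu>\<bar> * ?W \<mu>) \<le> N k"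
    and a3: "\<And>k q. k \<in> K \<Longrightarrow> q \<in> D \<Longrightarrow> in_box C p r q \<Longrightarrow>
      ((\<lambda>\<mu>. a k \<mu> * monomial_at C (\<lambda>c. q c - p c) \<mu>) has_sum f k q) ?I"
    by blast+
  have W: "?W \<mu> > 0" for \<mu> using r by (rule monomial_at_pos)
  have Wn: "?W \<mu> \<ge> 0" for \<mu> using W[of \<mu>] by simp
  have rows: "(\<lambda>k. \<Sum>\<^sub>\<infinity>\<mu>\<in>?I. \<bar>a k \<mu>\<bar> * ?W \<mu>) summable_on K"
    using a2 Wn by (intro summable_on_comparison_test[OF N(1)] infsum_nonneg mult_nonneg_nonneg) auto
  have all: "(\<lambda>(k, \<mu>). \<bar>a k \<mu>\<bar> * ?W \<mu>) summable_on K \<times> ?I"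
    using a1 rows Wn by (intro summable_on_SigmaI[where g = "\<lambda>k. \<Sum>\<^sub>\<infinity>\<mu>\<in>?I. \<bar>a k \<mu>\<bar> * ?W \<mu>"]) (auto intro!: has_sum_infsum)
  have all': "(\<lambda>(\<mu>, k). \<bar>a k \<mu>\<bar> * ?W \<mu>) summable_on ?I \<times> K"
    using all by (subst (asm) summable_on_swap) (simp add: case_prod_unfold)
  have col: "(\<lambda>k. \<bar>a k \<mu>\<bar> * ?W \<mu>) summable_on K" if "\<mu> \<in> ?I" for \<mu>
    using summable_on_SigmaD1[OF all' that] by simp
  have cola: "(\<lambda>k. \<bar>a k \<mu>\<bar>) summable_on K" "(\<lambda>k. a k \<mu>) summable_on K" if "\<mu> \<in> ?I" for \<mu>
  proof -
    show 1: "(\<lambda>k. \<bar>a k \<mu>\<bar>) summable_on K"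
      using summable_on_cmult_left[OF col[OF that], of "inverse (?W \<mu>)"] W[of \<mu>]
      by (simp add: mult.assoc)
    show "(\<lambda>k. a k \<mu>) summable_on K" by (rule summable_on_abs_comparison(1)[OF 1]) simp
  qed
  define b where "b \<mu> = (\<Sum>\<^sub>\<infinity>k\<in>K. a k \<mu>)" for \<mu>
  define g where "g \<mu> = (\<Sum>\<^sub>\<infinity>k\<in>K. \<bar>a k \<mu>\<bar> * ?W \<mu>)" for \<mu>
  have g: "g summable_on ?I" unfolding g_def
    using summable_on_Sigma_banach[OF all'] by simp
  have gs: "infsum g ?I = (\<Sum>\<^sub>\<infinity>k\<in>K. \<Sum>\<^sub>\<infinity>\<mu>\<in>?I. \<bar>a k \<mu>\<bar> * ?W \<mu>)"
    unfolding g_def using infsum_swap_banach[OF all'] .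
  have bg: "\<bar>b \<mu>\<bar> * ?W \<mu> \<le> g \<mu>" if "\<mu> \<in> ?I" for \<mu>
  proof -
    have "\<bar>b \<mu>\<bar> \<le> (\<Sum>\<^sub>\<infinity>k\<in>K. \<bar>a k \<mu>\<bar>)" unfolding b_def
      by (rule summable_on_abs_comparison(3)[OF cola(1)[OF that]]) simp
    then have "\<bar>b \<mu>\<bar> * ?W \<mu> \<le> (\<Sum>\<^sub>\<infinity>k\<in>K. \<bar>a k \<mu>\<bar>) * ?W \<mu>" using Wn by (rule mult_right_mono)
    also have "\<dots> = g \<mu>" unfolding g_def using infsum_cmult_left' by metis
    finally show ?thesis .
  qed
  have abs_bW: "\<bar>\<bar>b \<mu>\<bar> * ?W \<mu>\<bar> \<le> g \<mu>" if "\<mu> \<in> ?I" for \<mu> using bg[OF that] Wn[of \<mu>] by (simp add: abs_mult)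
  show ?thesis unfolding power_series_on_def
  proof (intro exI[of _ b] conjI ballI impI)
    show "(\<lambda>\<mu>. \<bar>b \<mu>\<bar> * ?W \<mu>) summable_on ?I"
      by (rule summable_on_abs_comparison(1)[OF g abs_bW])
    have "(\<Sum>\<^sub>\<infinity>\<mu>\<in>?I. \<bar>b \<mu>\<bar> * ?W \<mu>) \<le> infsum g ?I"
      using summable_on_abs_comparison(3)[OF g abs_bW] by linarith
    also have "\<dots> \<le> infsum N K" unfolding gs using rows N(1) a2 by (rule infsum_mono)
    finally show "(\<Sum>\<^sub>\<infinity>\<mu>\<in>?I. \<bar>b \<mu>\<bar> * ?W \<mu>) \<le> M" using N(2) by linarith
  next
    fix q assume q: "q \<in> D" "in_box C p r q"
    let ?Q = "monomial_at C (\<lambda>c. q c - p c)"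
    have "(\<lambda>(k, \<mu>). a k \<mu> * ?Q \<mu>) summable_on K \<times> ?I"
      by (rule summable_on_abs_comparison(1)[OF all])
        (auto simp: abs_mult intro!: mult_left_mono abs_monomial_at_le[OF q(2)])
    then have "((\<lambda>(k, \<mu>). a k \<mu> * ?Q \<mu>) has_sum F q) (K \<times> ?I)"
      using a3[OF _ q] F[OF q] by (intro has_sum_SigmaI[where g = "\<lambda>k. f k q"]) auto
    then have "((\<lambda>(\<mu>, k). a k \<mu> * ?Q \<mu>) has_sum F q) (?I \<times> K)"
      by (subst (asm) has_sum_swap) (simp add: case_prod_unfold)
    then show "((\<lambda>\<mu>. b \<mu> * ?Q \<mu>) has_sum F q) ?I"
      by (rule has_sum_SigmaD) (auto simp: b_def intro!: has_sum_cmult_left has_sum_infsum cola)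
  qed
qed

lemma power_series_on_const:
  "power_series_on D C p r (\<lambda>_. k) \<bar>k\<bar>"
proof -
  have "((\<lambda>\<mu>. (if \<mu> = (\<lambda>_. 0) then m else 0) * monomial_at C v \<mu>) has_sum m) (multi_indices C)" for m v
    by (rule has_sum_finite_neutralI[of "{\<lambda>_. 0}"]) (auto simp: multi_indices_def monomial_at_def)
  note * = this
  have **: "\<bar>if \<mu> = (\<lambda>_. 0) then k else 0\<bar> = (if \<mu> = (\<lambda>_. 0) then \<bar>k\<bar> else 0)" for \<mu> :: "jet_coord \<Rightarrow> nat" by simp
  show ?thesis unfolding power_series_on_def
    apply (intro exI[of _ "\<lambda>\<mu>. if \<mu> = (\<lambda>_. 0) then k else 0"])
    unfolding ** using *[of k] *[of "\<bar>k\<bar>" r] by (auto simp: has_sum_imp_summable infsumI)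
qed

lemma has_sum_shift_index:
  fixes a :: "(jet_coord \<Rightarrow> nat) \<Rightarrow> real"
  assumes "c \<in> C" "finite C" "((\<lambda>\<mu>. a \<mu> * monomial_at C v \<mu>) has_sum m) (multi_indices C)"
  shows "((\<lambda>\<mu>. (if \<mu> c = 0 then 0 else a (\<mu>(c := \<mu> c - 1))) * monomial_at C v \<mu>) has_sum (v c * m))
     (multi_indices C)"
proof -
  let ?h = "\<lambda>\<mu> :: jet_coord \<Rightarrow> nat. \<mu>(c := Suc (\<mu> c))"
  have inj: "inj_on ?h (multi_indices C)"
    by (rule inj_on_inverseI[where g = "\<lambda>\<mu>. \<mu>(c := \<mu> c - 1)"]) auto
  have mono: "monomial_at C v (?h \<mu>) = v c * monomial_at C v \<mu>" for \<mu>
  proof -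
    have "(\<Prod>d\<in>C - {c}. v d ^ (?h \<mu>) d) = (\<Prod>d\<in>C - {c}. v d ^ \<mu> d)" by (rule prod.cong) auto
    then show ?thesis using assms(1,2) by (simp add: monomial_at_def prod.remove)
  qed
  let ?F = "\<lambda>\<mu>. (if \<mu> c = 0 then 0 else a (\<mu>(c := \<mu> c - 1))) * monomial_at C v \<mu>"
  have "((\<lambda>\<mu>. v c * (a \<mu> * monomial_at C v \<mu>)) has_sum (v c * m)) (multi_indices C)"
    using assms(3) by (rule has_sum_cmult_right)
  moreover have "(\<lambda>\<mu>. v c * (a \<mu> * monomial_at C v \<mu>)) = ?F \<circ> ?h"
    by (rule ext) (simp add: mono)
  ultimately have "((?F \<circ> ?h) has_sum (v c * m)) (multi_indices C)" by metis
  then have "(?F has_sum (v c * m)) (?h ` multi_indices C)"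
    using has_sum_reindex[OF inj] by blast
  moreover have "(?F has_sum (v c * m)) (?h ` multi_indices C) \<longleftrightarrow> (?F has_sum (v c * m)) (multi_indices C)"
  proof (rule has_sum_cong_neutral)
    fix \<mu> assume \<mu>: "\<mu> \<in> multi_indices C - ?h ` multi_indices C"
    have "\<mu> c = 0"
    proof (rule ccontr)
      assume "\<mu> c \<noteq> 0"
      then have "\<mu> = ?h (\<mu>(c := \<mu> c - 1))" by auto
      moreover have "\<mu>(c := \<mu> c - 1) \<in> multi_indices C" using \<mu> assms(1) by (auto simp: multi_indices_def)
      ultimately show False using \<mu> by blast
    qed
    then show "?F \<mu> = 0" by simp
  next
    fix \<mu> assume "\<mu> \<in> ?h ` multi_indices C - multi_indices C"
    moreover have "?h ` multi_indices C \<subseteq> multi_indices C" using assms(1) by (auto simp: multi_indices_def)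
    ultimately show "?F \<mu> = 0" by blast
  qed auto
  ultimately show ?thesis by blast
qed

lemma power_series_on_coord_mult:
  assumes "power_series_on D C p r f M" "c \<in> C" "finite C" "r c > 0"
  shows "power_series_on D C p r (\<lambda>q. (q c - p c) * f q) (r c * M)"
proof -
  obtain a where a: "(\<lambda>\<mu>. \<bar>a \<mu>\<bar> * monomial_at C r \<mu>) summable_on multi_indices C"
    "(\<Sum>\<^sub>\<infinity>\<mu>\<in>multi_indices C. \<bar>a \<mu>\<bar> * monomial_at C r \<mu>) \<le> M"
    "\<And>q. q \<in> D \<Longrightarrow> in_box C p r q \<Longrightarrow>
       ((\<lambda>\<mu>. a \<mu> * monomial_at C (\<lambda>c. q c - p c) \<mu>) has_sum f q) (multi_indices C)"
    by (rule power_series_onE[OF assms(1)]) blast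
  let ?b = "\<lambda>\<mu>. if \<mu> c = 0 then 0 else a (\<mu>(c := \<mu> c - 1))"
  have abs: "\<bar>?b \<mu>\<bar> = (if \<mu> c = 0 then 0 else \<bar>a (\<mu>(c := \<mu> c - 1))\<bar>)" for \<mu> by simp
  have n: "((\<lambda>\<mu>. \<bar>?b \<mu>\<bar> * monomial_at C r \<mu>) has_sum
      (r c * (\<Sum>\<^sub>\<infinity>\<mu>\<in>multi_indices C. \<bar>a \<mu>\<bar> * monomial_at C r \<mu>))) (multi_indices C)"
    unfolding abs using has_sum_shift_index[OF assms(2,3) has_sum_infsum[OF a(1)]] .
  have "((\<lambda>\<mu>. ?b \<mu> * monomial_at C (\<lambda>c. q c - p c) \<mu>) has_sum (q c - p c) * f q) (multi_indices C)"
    if "q \<in> D" "in_box C p r q" for q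
    using has_sum_shift_index[OF assms(2,3) a(3)[OF that]] by simp
  then show ?thesis unfolding power_series_on_def
    using has_sum_imp_summable[OF n] infsumI[OF n] a(2) assms(4)
    by (intro exI[of _ ?b]) (simp add: mult_left_mono)
qed

text \<open>
  Grouping the monomials by the exponent of one coordinate turns \<open>f\<close> into a power series in
  one variable whose coefficients \<open>A k\<close> are free of that coordinate.
\<close>

lemma power_series_on_slice:
  assumes "power_series_on D C p r f M" "c \<in> C" "finite C" and r: "\<And>c. c \<in> C \<Longrightarrow> r c > 0"
  obtains A N where "\<And>k. power_series_on D (C - {c}) p r (A k) (N k)"
    "(\<lambda>k. N k * r c ^ k) summable_on UNIV" "(\<Sum>\<^sub>\<infinity>k. N k * r c ^ k) \<le> M"
    "\<And>q. q \<in> D \<Longrightarrow> in_box C p r q \<Longrightarrow> ((\<lambda>k. A k q * (q c - p c) ^ k) has_sum f q) (UNIV :: nat set)"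
proof -
  let ?I = "multi_indices C" and ?J = "multi_indices (C - {c})"
  obtain a where a: "(\<lambda>\<mu>. \<bar>a \<mu>\<bar> * monomial_at C r \<mu>) summable_on ?I"
    "(\<Sum>\<^sub>\<infinity>\<mu>\<in>?I. \<bar>a \<mu>\<bar> * monomial_at C r \<mu>) \<le> M"
    "\<And>q. q \<in> D \<Longrightarrow> in_box C p r q \<Longrightarrow>
       ((\<lambda>\<mu>. a \<mu> * monomial_at C (\<lambda>c. q c - p c) \<mu>) has_sum f q) ?I"
    by (rule power_series_onE[OF assms(1)]) blast
  define b where "b k \<nu> = a (\<nu>(c := k))" for k \<nu>
  have mono: "monomial_at C v (\<nu>(c := k)) = v c ^ k * monomial_at (C - {c}) v \<nu>" for v k \<nu>
  proof -
    have "(\<Prod>d\<in>C - {c}. v d ^ (\<nu>(c := k)) d) = (\<Prod>d\<in>C - {c}. v d ^ \<nu> d)" by (rule prod.cong) auto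
    then show ?thesis using assms(2,3) by (simp add: monomial_at_def prod.remove)
  qed
  have re: "((\<lambda>\<mu>. h (a \<mu>) * monomial_at C v \<mu>) has_sum m) ?I \<longleftrightarrow>
     ((\<lambda>(k, \<nu>). h (b k \<nu>) * (v c ^ k * monomial_at (C - {c}) v \<nu>)) has_sum m) (UNIV \<times> ?J)"
    for h :: "real \<Rightarrow> real" and v m
    by (rule has_sum_reindex_bij_witness[where j = "\<lambda>\<mu>. (\<mu> c, \<mu>(c := 0))" and i = "\<lambda>(k, \<nu>). \<nu>(c := k)"])
      (use assms(2) in \<open>auto simp: multi_indices_def b_def mono[symmetric]\<close>)
  define m where "m = (\<Sum>\<^sub>\<infinity>\<mu>\<in>?I. \<bar>a \<mu>\<bar> * monomial_at C r \<mu>)"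
  define N where "N k = (\<Sum>\<^sub>\<infinity>\<nu>\<in>?J. \<bar>b k \<nu>\<bar> * monomial_at (C - {c}) r \<nu>)" for k
  define A where "A k q = (\<Sum>\<^sub>\<infinity>\<nu>\<in>?J. b k \<nu> * monomial_at (C - {c}) (\<lambda>c. q c - p c) \<nu>)" for k q
  have all: "((\<lambda>(k, \<nu>). \<bar>b k \<nu>\<bar> * (r c ^ k * monomial_at (C - {c}) r \<nu>)) has_sum m) (UNIV \<times> ?J)"
    using re[of abs r m] has_sum_infsum[OF a(1)] by (simp add: m_def)
  have col: "(\<lambda>\<nu>. \<bar>b k \<nu>\<bar> * monomial_at (C - {c}) r \<nu>) summable_on ?J" for k
  proof -
    have "(\<lambda>\<nu>. \<bar>b k \<nu>\<bar> * (r c ^ k * monomial_at (C - {c}) r \<nu>)) summable_on ?J"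
      using summable_on_SigmaD1[of "\<lambda>k \<nu>. \<bar>b k \<nu>\<bar> * (r c ^ k * monomial_at (C - {c}) r \<nu>)" UNIV "\<lambda>_. ?J" k]
        has_sum_imp_summable[OF all] by simp
    from summable_on_cmult_right[OF this, of "inverse (r c ^ k)"] show ?thesis
      using r[OF assms(2)] by (simp add: field_simps)
  qed
  have Ns: "((\<lambda>k. N k * r c ^ k) has_sum m) UNIV"
  proof (rule has_sum_SigmaD[OF all])
    show "((\<lambda>\<nu>. case (k, \<nu>) of (k, \<nu>) \<Rightarrow> \<bar>b k \<nu>\<bar> * (r c ^ k * monomial_at (C - {c}) r \<nu>)) has_sum N k * r c ^ k) ?J" for k
      using has_sum_cmult_left[OF has_sum_infsum[OF col[of k]], of "r c ^ k"] by (simp add: N_def mult_ac)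
  qed
  have colq: "((\<lambda>\<nu>. b k \<nu> * monomial_at (C - {c}) (\<lambda>c. q c - p c) \<nu>) has_sum A k q) ?J"
    if "in_box (C - {c}) p r q" for k q
    unfolding A_def
    by (intro has_sum_infsum summable_on_abs_comparison(1)[OF col])
      (auto simp: abs_mult intro!: mult_left_mono abs_monomial_at_le[OF that])
  show thesis
  proof (rule that[of A N])
    show "power_series_on D (C - {c}) p r (A k) (N k)" for k
      unfolding power_series_on_def using col colq by (intro exI[of _ "b k"]) (auto simp: N_def)
    show "(\<lambda>k. N k * r c ^ k) summable_on UNIV" using Ns by (rule has_sum_imp_summable)
    show "(\<Sum>\<^sub>\<infinity>k. N k * r c ^ k) \<le> M" using infsumI[OF Ns] a(2) by (simp add: m_def)
  next
    fix q assume q: "q \<in> D" "in_box C p r q"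
    then have q': "in_box (C - {c}) p r q" by (auto simp: in_box_def)
    have "((\<lambda>(k, \<nu>). b k \<nu> * ((q c - p c) ^ k * monomial_at (C - {c}) (\<lambda>c. q c - p c) \<nu>)) has_sum f q) (UNIV \<times> ?J)"
      using re[of "\<lambda>x. x" "\<lambda>c. q c - p c"] a(3)[OF q] by simp
    then show "((\<lambda>k. A k q * (q c - p c) ^ k) has_sum f q) UNIV"
    proof (rule has_sum_SigmaD)
      show "((\<lambda>\<nu>. case (k, \<nu>) of (k, \<nu>) \<Rightarrow> b k \<nu> * ((q c - p c) ^ k * monomial_at (C - {c}) (\<lambda>c. q c - p c) \<nu>))
          has_sum A k q * (q c - p c) ^ k) ?J" for k
        using has_sum_cmult_left[OF colq[OF q', of k], of "(q c - p c) ^ k"] by (simp add: mult_ac)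
    qed
  qed
qed

lemma power_series_on_superset:
  assumes "power_series_on D C p r f M" "C \<subseteq> C'" "finite C'"
  shows "power_series_on D C' p r f M"
proof -
  obtain a where a: "(\<lambda>\<mu>. \<bar>a \<mu>\<bar> * monomial_at C r \<mu>) summable_on multi_indices C"
    "(\<Sum>\<^sub>\<infinity>\<mu>\<in>multi_indices C. \<bar>a \<mu>\<bar> * monomial_at C r \<mu>) \<le> M"
    "\<And>q. q \<in> D \<Longrightarrow> in_box C p r q \<Longrightarrow>
       ((\<lambda>\<mu>. a \<mu> * monomial_at C (\<lambda>c. q c - p c) \<mu>) has_sum f q) (multi_indices C)"
    by (rule power_series_onE[OF assms(1)]) blast
  let ?b = "\<lambda>\<mu>. if \<mu> \<in> multi_indices C then a \<mu> else 0"
  have sub: "multi_indices C \<subseteq> multi_indices C'" using assms(2) by (auto simp: multi_indices_def)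
  have mono: "monomial_at C' v \<mu> = monomial_at C v \<mu>" if "\<mu> \<in> multi_indices C" for v \<mu>
    using that assms(2,3) unfolding monomial_at_def
    by (intro prod.mono_neutral_right) (auto simp: multi_indices_def)
  have "((\<lambda>\<mu>. h (?b \<mu>) * monomial_at C' v \<mu>) has_sum m) (multi_indices C') \<longleftrightarrow>
      ((\<lambda>\<mu>. h (a \<mu>) * monomial_at C v \<mu>) has_sum m) (multi_indices C)"
    if "h 0 = 0" for h :: "real \<Rightarrow> real" and v m
    by (rule has_sum_cong_neutral) (use sub mono that in auto)
  note * = this[of abs] this[of "\<lambda>x. x"]
  have n: "((\<lambda>\<mu>. \<bar>?b \<mu>\<bar> * monomial_at C' r \<mu>) has_sum
      (\<Sum>\<^sub>\<infinity>\<mu>\<in>multi_indices C. \<bar>a \<mu>\<bar> * monomial_at C r \<mu>)) (multi_indices C')"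
    using *(1) has_sum_infsum[OF a(1)] by simp
  have "((\<lambda>\<mu>. ?b \<mu> * monomial_at C' (\<lambda>c. q c - p c) \<mu>) has_sum f q) (multi_indices C')"
    if "q \<in> D" "in_box C' p r q" for q
  proof -
    have "in_box C p r q" using that(2) assms(2) by (auto simp: in_box_def)
    then show ?thesis using *(2) a(3)[OF that(1)] by simp
  qed
  then show ?thesis unfolding power_series_on_def
    using has_sum_imp_summable[OF n] infsumI[OF n] a(2) by (intro exI[of _ ?b]) simp
qed

lemma power_series_on_cmult:
  assumes "power_series_on D C p r f M"
  shows "power_series_on D C p r (\<lambda>q. k * f q) (\<bar>k\<bar> * M)"
proof -
  obtain a where a: "(\<lambda>\<mu>. \<bar>a \<mu>\<bar> * monomial_at C r \<mu>) summable_on multi_indices C"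
    "(\<Sum>\<^sub>\<infinity>\<mu>\<in>multi_indices C. \<bar>a \<mu>\<bar> * monomial_at C r \<mu>) \<le> M"
    "\<And>q. q \<in> D \<Longrightarrow> in_box C p r q \<Longrightarrow>
       ((\<lambda>\<mu>. a \<mu> * monomial_at C (\<lambda>c. q c - p c) \<mu>) has_sum f q) (multi_indices C)"
    by (rule power_series_onE[OF assms(1)]) blast
  have n: "((\<lambda>\<mu>. \<bar>k * a \<mu>\<bar> * monomial_at C r \<mu>) has_sum
      (\<bar>k\<bar> * (\<Sum>\<^sub>\<infinity>\<mu>\<in>multi_indices C. \<bar>a \<mu>\<bar> * monomial_at C r \<mu>))) (multi_indices C)"
    using has_sum_cmult_right[OF has_sum_infsum[OF a(1)], of "\<bar>k\<bar>"] by (simp add: abs_mult mult.assoc)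
  have "((\<lambda>\<mu>. (k * a \<mu>) * monomial_at C (\<lambda>c. q c - p c) \<mu>) has_sum k * f q) (multi_indices C)"
    if "q \<in> D" "in_box C p r q" for q
    using has_sum_cmult_right[OF a(3)[OF that], of k] by (simp add: mult.assoc)
  then show ?thesis unfolding power_series_on_def
    using has_sum_imp_summable[OF n] infsumI[OF n] a(2)
    by (intro exI[of _ "\<lambda>\<mu>. k * a \<mu>"]) (simp add: mult_left_mono)
qed

context
  fixes D :: "jet set" and C :: "jet_coord set" and p :: jet and r :: "jet_coord \<Rightarrow> real"
  assumes fin: "finite C" and pos: "\<And>c. c \<in> C \<Longrightarrow> r c > 0"
begin

lemma power_series_on_sum:
  assumes "finite K" "\<And>k. k \<in> K \<Longrightarrow> power_series_on D C p r (f k) (N k)"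
  shows "power_series_on D C p r (\<lambda>q. \<Sum>k\<in>K. f k q) (\<Sum>k\<in>K. N k)"
  by (rule power_series_on_infsum[where K = K and f = f and N = N])
    (use assms pos in \<open>auto intro!: has_sum_finiteI\<close>)

lemma power_series_on_add:
  assumes "power_series_on D C p r f M" "power_series_on D C p r g N"
  shows "power_series_on D C p r (\<lambda>q. f q + g q) (M + N)"
  using power_series_on_sum[of "UNIV :: bool set" "\<lambda>b. if b then f else g" "\<lambda>b. if b then M else N"] assms
  by (simp add: UNIV_bool add.commute)

lemma power_series_on_diff:
  assumes "power_series_on D C p r f M" "power_series_on D C p r g N"
  shows "power_series_on D C p r (\<lambda>q. f q - g q) (M + N)"
  using power_series_on_add[OF assms(1) power_series_on_cmult[OF assms(2), of "-1"]] by simp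

lemma power_series_on_monomial_mult:
  assumes "power_series_on D C p r f M"
  shows "power_series_on D C p r (\<lambda>q. monomial_at C (\<lambda>c. q c - p c) \<mu> * f q) (monomial_at C r \<mu> * M)"
proof -
  have pow: "power_series_on D C p r (\<lambda>q. (q c - p c) ^ k * g q) (r c ^ k * N)"
    if "c \<in> C" "power_series_on D C p r g N" for c k g N
  proof (induction k)
    case (Suc k)
    show ?case using power_series_on_coord_mult[OF Suc that(1) fin pos[OF that(1)]] by (simp add: mult.assoc)
  qed (use that in simp)
  have "power_series_on D C p r (\<lambda>q. (\<Prod>c\<in>F. (q c - p c) ^ \<mu> c) * f q) ((\<Prod>c\<in>F. r c ^ \<mu> c) * M)"
    if "F \<subseteq> C" for F
    using finite_subset[OF that fin] that
  proof (induction F)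
    case (insert c F)
    then show ?case using pow[of c, OF _ insert.IH] by (simp add: mult.assoc)
  qed (use assms in simp)
  from this[of C] show ?thesis by (simp add: monomial_at_def)
qed

text \<open>
  The product is the sum, over the monomials of \<open>f\<close>, of monomial multiples of \<open>g\<close>.
\<close>

lemma power_series_on_mult:
  assumes "power_series_on D C p r f M" "power_series_on D C p r g N"
  shows "power_series_on D C p r (\<lambda>q. f q * g q) (M * N)"
proof -
  obtain a where a: "(\<lambda>\<mu>. \<bar>a \<mu>\<bar> * monomial_at C r \<mu>) summable_on multi_indices C"
    "(\<Sum>\<^sub>\<infinity>\<mu>\<in>multi_indices C. \<bar>a \<mu>\<bar> * monomial_at C r \<mu>) \<le> M"
    "\<And>q. q \<in> D \<Longrightarrow> in_box C p r q \<Longrightarrow>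
       ((\<lambda>\<mu>. a \<mu> * monomial_at C (\<lambda>c. q c - p c) \<mu>) has_sum f q) (multi_indices C)"
    by (rule power_series_onE[OF assms(1)]) blast
  have N: "N \<ge> 0" using power_series_on_nonneg[OF assms(2) pos] .
  show ?thesis
  proof (rule power_series_on_infsum[where K = "multi_indices C"
        and f = "\<lambda>\<mu> q. a \<mu> * (monomial_at C (\<lambda>c. q c - p c) \<mu> * g q)"
        and N = "\<lambda>\<mu>. \<bar>a \<mu>\<bar> * (monomial_at C r \<mu> * N)"])
    show "power_series_on D C p r (\<lambda>q. a \<mu> * (monomial_at C (\<lambda>c. q c - p c) \<mu> * g q)) (\<bar>a \<mu>\<bar> * (monomial_at C r \<mu> * N))" for \<mu>
      by (intro power_series_on_cmult power_series_on_monomial_mult assms)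
    have n: "((\<lambda>\<mu>. \<bar>a \<mu>\<bar> * (monomial_at C r \<mu> * N)) has_sum
        (\<Sum>\<^sub>\<infinity>\<mu>\<in>multi_indices C. \<bar>a \<mu>\<bar> * monomial_at C r \<mu>) * N) (multi_indices C)"
      using has_sum_cmult_left[OF has_sum_infsum[OF a(1)], of N] by (simp add: mult.assoc)
    show "(\<lambda>\<mu>. \<bar>a \<mu>\<bar> * (monomial_at C r \<mu> * N)) summable_on multi_indices C"
      using n by (rule has_sum_imp_summable)
    show "(\<Sum>\<^sub>\<infinity>\<mu>\<in>multi_indices C. \<bar>a \<mu>\<bar> * (monomial_at C r \<mu> * N)) \<le> M * N"
      unfolding infsumI[OF n] using a(2) N by (rule mult_right_mono)
    show "((\<lambda>\<mu>. a \<mu> * (monomial_at C (\<lambda>c. q c - p c) \<mu> * g q)) has_sum f q * g q) (multi_indices C)"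
      if "q \<in> D" "in_box C p r q" for q
      using has_sum_cmult_left[OF a(3)[OF that], of "g q"] by (simp add: mult.assoc)
  qed (rule pos)
qed

lemma power_series_on_coord:
  assumes "c \<in> C"
  shows "power_series_on D C p r (\<lambda>q. q c - p c) (r c)"
  using power_series_on_coord_mult[OF power_series_on_const[of D C p r 1] assms fin pos[OF assms]] by simp

lemma power_series_on_power:
  assumes "power_series_on D C p r f M"
  shows "power_series_on D C p r (\<lambda>q. f q ^ k) (M ^ k)"
proof (induction k)
  case 0 then show ?case using power_series_on_const[of D C p r 1] by simp
next
  case (Suc k) then show ?case using power_series_on_mult[OF assms Suc] by simp
qed

lemma power_series_on_prod:
  assumes "finite K" "\<And>k. k \<in> K \<Longrightarrow> power_series_on D C p r (f k) (N k)"
  shows "power_series_on D C p r (\<lambda>q. \<Prod>k\<in>K. f k q) (\<Prod>k\<in>K. N k)"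
  using assms
proof (induction K)
  case empty then show ?case using power_series_on_const[of D C p r 1] by simp
next
  case (insert k K)
  then show ?case using power_series_on_mult[of "f k" "N k" "\<lambda>q. \<Prod>k\<in>K. f k q"] by simp
qed

text \<open>
  \<open>A\<close> is the restriction of \<open>f\<close> to the hyperplane where the coordinate has its central value,
  and \<open>B\<close> is the difference quotient. Division by the coordinate costs exactly a factor \<open>r c\<close>
  in norm; this is the estimate behind the contraction in Weierstrass division.
\<close>

lemma power_series_on_shift:
  assumes "power_series_on D C p r f M" "c \<in> C"
  obtains A B where "power_series_on D (C - {c}) p r A M" "power_series_on D C p r B (M / r c)"
    "\<And>q. q \<in> D \<Longrightarrow> in_box C p r q \<Longrightarrow> f q = A q + (q c - p c) * B q"
proof -
  obtain A N where A: "\<And>k. power_series_on D (C - {c}) p r (A k) (N k)"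
    "(\<lambda>k. N k * r c ^ k) summable_on UNIV" "(\<Sum>\<^sub>\<infinity>k. N k * r c ^ k) \<le> M"
    "\<And>q. q \<in> D \<Longrightarrow> in_box C p r q \<Longrightarrow> ((\<lambda>k. A k q * (q c - p c) ^ k) has_sum f q) (UNIV :: nat set)"
    by (rule power_series_on_slice[OF assms fin pos]) blast+
  have rc: "r c > 0" using pos assms by simp
  have N: "N k \<ge> 0" for k by (rule power_series_on_nonneg[OF A(1)]) (use pos in auto)
  have split: "h summable_on UNIV \<Longrightarrow> (\<lambda>k. h (Suc k)) summable_on UNIV \<and>
      infsum h UNIV = h 0 + infsum (\<lambda>k. h (Suc k)) UNIV" for h :: "nat \<Rightarrow> real"
  proof -
    assume h: "h summable_on UNIV"
    have U: "(UNIV :: nat set) = insert 0 (range Suc)" by (auto intro: nat.exhaust)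
    have hs: "h summable_on range Suc" using h by (rule summable_on_subset_banach) auto
    have "infsum h (insert 0 (range Suc)) = h 0 + infsum h (range Suc)"
      by (rule infsum_insert[OF hs]) auto
    then have "infsum h UNIV = h 0 + infsum h (range Suc)" by (simp only: U[symmetric])
    then show ?thesis using hs
      by (simp add: summable_on_reindex infsum_reindex o_def)
  qed
  define B where "B q = (\<Sum>\<^sub>\<infinity>k. A (Suc k) q * (q c - p c) ^ k)" for q
  have Ns: "(\<lambda>k. N (Suc k) * r c ^ Suc k) summable_on UNIV"
    and NM: "N 0 + (\<Sum>\<^sub>\<infinity>k. N (Suc k) * r c ^ Suc k) \<le> M"
    using split[OF A(2)] A(3) by auto
  have Ns': "((\<lambda>k. N (Suc k) * r c ^ k) has_sum (\<Sum>\<^sub>\<infinity>k. N (Suc k) * r c ^ Suc k) / r c) UNIV"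
    using has_sum_cmult_right[OF has_sum_infsum[OF Ns], of "inverse (r c)"] rc
    by (simp add: field_simps)
  have "(\<Sum>\<^sub>\<infinity>k. N (Suc k) * r c ^ Suc k) \<ge> 0"
    using N rc by (intro infsum_nonneg) auto
  then have N0: "N 0 \<le> M" and N1: "(\<Sum>\<^sub>\<infinity>k. N (Suc k) * r c ^ Suc k) \<le> M" using NM N[of 0] by linarith+
  have sq: "(\<lambda>k. A (Suc k) q * (q c - p c) ^ k) summable_on UNIV" if q: "q \<in> D" "in_box C p r q" for q
  proof (rule summable_on_abs_comparison(1)[OF has_sum_imp_summable[OF Ns']])
    fix k
    have "\<bar>A (Suc k) q\<bar> \<le> N (Suc k)"
      using power_series_on_bound[OF A(1) q(1)] q(2) by (auto simp: in_box_def)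
    moreover have "\<bar>(q c - p c) ^ k\<bar> \<le> r c ^ k"
      unfolding power_abs using q(2) assms(2) by (intro power_mono) (auto simp: in_box_def)
    ultimately show "\<bar>A (Suc k) q * (q c - p c) ^ k\<bar> \<le> N (Suc k) * r c ^ k"
      unfolding abs_mult using N by (intro mult_mono) auto
  qed
  show thesis
  proof (rule that[of "A 0" B])
    show "power_series_on D (C - {c}) p r (A 0) M"
      by (rule power_series_on_cong[OF A(1)]) (use N0 in auto)
    show "power_series_on D C p r B (M / r c)"
    proof (rule power_series_on_infsum[where K = UNIV and f = "\<lambda>k q. A (Suc k) q * (q c - p c) ^ k"
          and N = "\<lambda>k. N (Suc k) * r c ^ k"])
      show "power_series_on D C p r (\<lambda>q. A (Suc k) q * (q c - p c) ^ k) (N (Suc k) * r c ^ k)" for k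
        by (intro power_series_on_mult power_series_on_power power_series_on_coord assms(2)
            power_series_on_superset[OF A(1) _ fin]) auto
      show "(\<Sum>\<^sub>\<infinity>k. N (Suc k) * r c ^ k) \<le> M / r c"
        unfolding infsumI[OF Ns'] using rc N1 by (simp add: divide_right_mono)
      show "((\<lambda>k. A (Suc k) q * (q c - p c) ^ k) has_sum B q) UNIV" if "q \<in> D" "in_box C p r q" for q
        unfolding B_def using sq[OF that] by (rule has_sum_infsum)
    qed (use Ns' pos in \<open>auto intro: has_sum_imp_summable\<close>)
  next
    fix q assume q: "q \<in> D" "in_box C p r q"
    have "f q = A 0 q + (\<Sum>\<^sub>\<infinity>k. A (Suc k) q * (q c - p c) ^ Suc k)"
      using split[OF has_sum_imp_summable[OF A(4)[OF q]]] infsumI[OF A(4)[OF q]] by simp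
    also have "(\<Sum>\<^sub>\<infinity>k. A (Suc k) q * (q c - p c) ^ Suc k) = (q c - p c) * B q"
      unfolding B_def using infsum_cmult_right[OF sq[OF q], of "q c - p c"] by (simp add: mult_ac)
    finally show "f q = A 0 q + (q c - p c) * B q" .
  qed
qed

end

text \<open>
  Substituting \<open>G\<close> into a monomial costs at most the value of that monomial at the radii \<open>r\<close>,
  because the norms \<open>N c\<close> of the components do not exceed them; so the norm of \<open>f\<close> is
  preserved.
\<close>

lemma power_series_on_comp:
  assumes f: "power_series_on D C p r f M" and C: "finite C"
    and r: "\<And>c. c \<in> C' \<Longrightarrow> r' c > 0" and C': "finite C'"
    and G: "\<And>c. c \<in> C \<Longrightarrow> power_series_on D' C' p' r' (\<lambda>w. G w c - p c) (N c)"
    and N: "\<And>c. c \<in> C \<Longrightarrow> N c \<le> r c"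
    and D: "\<And>w. w \<in> D' \<Longrightarrow> in_box C' p' r' w \<Longrightarrow> G w \<in> D"
  shows "power_series_on D' C' p' r' (\<lambda>w. f (G w)) M"
proof -
  obtain a where a: "(\<lambda>\<mu>. \<bar>a \<mu>\<bar> * monomial_at C r \<mu>) summable_on multi_indices C"
    "(\<Sum>\<^sub>\<infinity>\<mu>\<in>multi_indices C. \<bar>a \<mu>\<bar> * monomial_at C r \<mu>) \<le> M"
    "\<And>q. q \<in> D \<Longrightarrow> in_box C p r q \<Longrightarrow>
       ((\<lambda>\<mu>. a \<mu> * monomial_at C (\<lambda>c. q c - p c) \<mu>) has_sum f q) (multi_indices C)"
    by (rule power_series_onE[OF f]) blast
  have box: "in_box C p r (G w)" if "w \<in> D'" "in_box C' p' r' w" for w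
    using power_series_on_bound[OF G that] N by (force simp: in_box_def)
  have N0: "N c \<ge> 0" if "c \<in> C" for c using power_series_on_nonneg[OF G[OF that] r] by simp
  have le: "\<bar>\<bar>a \<mu>\<bar> * monomial_at C N \<mu>\<bar> \<le> \<bar>a \<mu>\<bar> * monomial_at C r \<mu>" for \<mu>
  proof -
    have "monomial_at C N \<mu> \<le> monomial_at C r \<mu>"
      unfolding monomial_at_def using N N0 by (intro prod_mono conjI power_mono) auto
    then show ?thesis using monomial_at_nonneg[of C N \<mu>] N0 by (simp add: abs_mult mult_left_mono)
  qed
  show ?thesis
  proof (rule power_series_on_infsum[where K = "multi_indices C"
        and f = "\<lambda>\<mu> w. a \<mu> * monomial_at C (\<lambda>c. G w c - p c) \<mu>"
        and N = "\<lambda>\<mu>. \<bar>a \<mu>\<bar> * monomial_at C N \<mu>"])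
    show "power_series_on D' C' p' r' (\<lambda>w. a \<mu> * monomial_at C (\<lambda>c. G w c - p c) \<mu>) (\<bar>a \<mu>\<bar> * monomial_at C N \<mu>)" for \<mu>
      unfolding monomial_at_def
      by (intro power_series_on_cmult power_series_on_prod power_series_on_power C C' r G)
    show "(\<lambda>\<mu>. \<bar>a \<mu>\<bar> * monomial_at C N \<mu>) summable_on multi_indices C"
      by (rule summable_on_abs_comparison(1)[OF a(1) le])
    show "(\<Sum>\<^sub>\<infinity>\<mu>\<in>multi_indices C. \<bar>a \<mu>\<bar> * monomial_at C N \<mu>) \<le> M"
      using summable_on_abs_comparison(3)[OF a(1) le] a(2) by linarith
    show "((\<lambda>\<mu>. a \<mu> * monomial_at C (\<lambda>c. G w c - p c) \<mu>) has_sum f (G w)) (multi_indices C)"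
      if "w \<in> D'" "in_box C' p' r' w" for w
      using a(3)[OF D[OF that] box[OF that]] .
  qed (rule r)
qed

lemma power_series_on_recenter:
  assumes f: "power_series_on D C p r f M" and C: "finite C"
    and r: "\<And>c. c \<in> C \<Longrightarrow> r' c > 0"
    and le: "\<And>c. c \<in> C \<Longrightarrow> \<bar>p' c - p c\<bar> + r' c \<le> r c"
  shows "power_series_on D C p' r' f M"
proof -
  have "power_series_on D C p' r' (\<lambda>q. q c - p c) (r' c + \<bar>p' c - p c\<bar>)" if "c \<in> C" for c
  proof -
    have "(\<lambda>q. q c - p c) = (\<lambda>q. (q c - p' c) + (p' c - p c))" by auto
    then show ?thesis
      using power_series_on_add[where C = C and r = r', OF C r
          power_series_on_coord[where C = C and r = r', OF C r that, of D p'] power_series_on_const[of D C p' r' "p' c - p c"]]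
      by simp
  qed
  then show ?thesis
    by (intro power_series_on_comp[OF f C r C, where G = "\<lambda>w. w", simplified]) (use le in \<open>auto simp: add.commute\<close>)
qed

lemma power_series_on_shrink:
  assumes "power_series_on D C p r f M" "finite C"
    and "\<And>c. c \<in> C \<Longrightarrow> r' c > 0" "\<And>c. c \<in> C \<Longrightarrow> r' c \<le> r c"
  shows "power_series_on D C p r' f M"
  by (rule power_series_on_recenter[OF assms(1,2)]) (use assms in auto)

text \<open>
  Hadamard's lemma: the coordinates are split off one after the other. Continuity,
  differentiability along curves and smallness near a zero are read off this formula.
\<close>

lemma power_series_on_hadamard:
  assumes "finite C" "power_series_on D C p r f M" and pos: "\<And>c. c \<in> C \<Longrightarrow> r c > 0" and "p \<in> D"
  obtains B where "\<And>c. c \<in> C \<Longrightarrow> power_series_on D C p r (B c) (M / r c)"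
    "\<And>q. q \<in> D \<Longrightarrow> in_box C p r q \<Longrightarrow> f q = f p + (\<Sum>c\<in>C. (q c - p c) * B c q)"
proof -
  have "\<exists>B. (\<forall>c\<in>C. power_series_on D C p r (B c) (M / r c)) \<and>
    (\<forall>q\<in>D. in_box C p r q \<longrightarrow> f q = f p + (\<Sum>c\<in>C. (q c - p c) * B c q))"
    using assms
  proof (induction C arbitrary: f)
    case empty
    then have "f q = f p" if "q \<in> D" for q
      using power_series_on_depends[OF empty(1), of q p] that by (simp add: in_box_def)
    then show ?case by simp
  next
    case (insert c C)
    have fin: "finite (insert c C)" using insert by simp
    have C: "insert c C - {c} = C" using insert(2) by auto
    obtain A E where A: "power_series_on D C p r A M" and E: "power_series_on D (insert c C) p r E (M / r c)"
      and eq: "\<And>q. q \<in> D \<Longrightarrow> in_box (insert c C) p r q \<Longrightarrow> f q = A q + (q c - p c) * E q"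
      using power_series_on_shift[OF fin insert.prems(2,1), of c] C by auto
    from insert.IH[OF A] insert.prems obtain B where
      B: "\<forall>d\<in>C. power_series_on D C p r (B d) (M / r d)"
         "\<forall>q\<in>D. in_box C p r q \<longrightarrow> A q = A p + (\<Sum>d\<in>C. (q d - p d) * B d q)" by auto
    have pin: "in_box (insert c C) p r p" using insert.prems(2) by (auto simp: in_box_def less_imp_le)
    have fp: "f p = A p" using eq[OF insert.prems(3) pin] by simp
    show ?case
    proof (intro exI[of _ "B(c := E)"] conjI ballI impI)
      fix d assume "d \<in> insert c C"
      then show "power_series_on D (insert c C) p r ((B(c := E)) d) (M / r d)"
        using bspec[OF B(1), of d] E power_series_on_superset[of D C p r "B d" "M / r d", OF _ subset_insertI fin] by auto
    next
      fix q assume q: "q \<in> D" "in_box (insert c C) p r q"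
      have "(\<Sum>d\<in>C. (q d - p d) * (B(c := E)) d q) = (\<Sum>d\<in>C. (q d - p d) * B d q)"
        using insert(2) by (intro sum.cong) auto
      moreover have "in_box C p r q" using q(2) by (auto simp: in_box_def)
      ultimately show "f q = f p + (\<Sum>d\<in>insert c C. (q d - p d) * (B(c := E)) d q)"
        using eq[OF q] B(2) q(1) insert(1,2) fp by simp
    qed
  qed
  then show thesis using that by blast
qed

text \<open>
  Every term of Hadamard's formula contains a coordinate difference, whose norm scales with
  \<open>t\<close>.
\<close>

lemma power_series_on_small:
  assumes C: "finite C" and f: "power_series_on D C p r f M" and pos: "\<And>c. c \<in> C \<Longrightarrow> r c > 0"
    and "p \<in> D" "f p = 0" "0 < t" "t \<le> 1"
  shows "power_series_on D C p (\<lambda>c. t * r c) f (t * (real (card C) * M))"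
proof -
  obtain B where B: "\<And>c. c \<in> C \<Longrightarrow> power_series_on D C p r (B c) (M / r c)"
    "\<And>q. q \<in> D \<Longrightarrow> in_box C p r q \<Longrightarrow> f q = f p + (\<Sum>c\<in>C. (q c - p c) * B c q)"
    by (rule power_series_on_hadamard[OF C f pos assms(4)]) blast+
  have pos': "\<And>c. c \<in> C \<Longrightarrow> t * r c > 0" using pos assms(6) by simp
  have le: "t * r c \<le> r c" if "c \<in> C" for c using pos[OF that] assms(7) by simp
  have ser: "power_series_on D C p (\<lambda>c. t * r c) (\<lambda>q. \<Sum>c\<in>C. (q c - p c) * B c q) (\<Sum>c\<in>C. t * r c * (M / r c))"
    by (intro power_series_on_sum power_series_on_coord_mult power_series_on_shrink[OF B(1) C] C pos' le)
  have M: "(\<Sum>c\<in>C. t * r c * (M / r c)) = t * (real (card C) * M)"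
  proof -
    have "(\<Sum>c\<in>C. t * r c * (M / r c)) = (\<Sum>c\<in>C. t * M)"
      using pos by (intro sum.cong) (auto simp: less_imp_neq[THEN not_sym])
    then show ?thesis by simp
  qed
  have box: "in_box C p r q" if "in_box C p (\<lambda>c. t * r c) q" for q
    unfolding in_box_def
  proof
    fix c assume c: "c \<in> C"
    have "\<bar>q c - p c\<bar> \<le> t * r c" using that c by (simp add: in_box_def)
    then show "\<bar>q c - p c\<bar> \<le> r c" using le[OF c] by (rule order_trans)
  qed
  show ?thesis
  proof (rule power_series_on_cong[OF ser])
    show "(\<Sum>c\<in>C. t * r c * (M / r c)) \<le> t * (real (card C) * M)" by (simp only: M order_refl)
    show "(\<Sum>c\<in>C. (q c - p c) * B c q) = f q" if "q \<in> D" "in_box C p (\<lambda>c. t * r c) q" for q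
      using B(2)[OF that(1) box[OF that(2)]] assms(5) by simp
  qed simp
qed

section \<open>Analytic germs and Weierstrass division\<close>

definition analytic_at :: "jet set \<Rightarrow> jet \<Rightarrow> jet_coord set \<Rightarrow> (jet \<Rightarrow> real) \<Rightarrow> bool" where
  "analytic_at D p C f \<longleftrightarrow> (\<exists>\<rho> M. \<rho> > 0 \<and> power_series_on D C p (\<lambda>_. \<rho>) f M)"

text \<open>
  The neighbourhood restricts only the coordinates in \<open>C\<close>, so that germs over different sets
  of coordinates can be compared by enlarging \<open>C\<close>.
\<close>

definition eq_near :: "jet set \<Rightarrow> jet \<Rightarrow> jet_coord set \<Rightarrow> (jet \<Rightarrow> real) \<Rightarrow> (jet \<Rightarrow> real) \<Rightarrow> bool" where
  "eq_near D p C f g \<longleftrightarrow> (\<exists>\<rho>>0. \<forall>q\<in>D. in_box C p (\<lambda>_. \<rho>) q \<longrightarrow> f q = g q)"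

lemma analytic_atI:
  assumes "power_series_on D C p r f M" "finite C" "\<And>c. c \<in> C \<Longrightarrow> r c > 0"
  shows "analytic_at D p C f"
proof -
  define \<rho> where "\<rho> = Min (insert 1 (r ` C))"
  have "\<rho> > 0" "\<And>c. c \<in> C \<Longrightarrow> \<rho> \<le> r c" using assms(2,3) by (auto simp: \<rho>_def)
  then show ?thesis unfolding analytic_at_def
    using power_series_on_shrink[OF assms(1,2), of "\<lambda>_. \<rho>"] by blast
qed

lemma analytic_at_cong:
  assumes "analytic_at D p C f" "eq_near D p C f g" "finite C"
  shows "analytic_at D p C g"
proof -
  from assms(1) obtain \<rho> M where 1: "\<rho> > 0" "power_series_on D C p (\<lambda>_. \<rho>) f M" by (auto simp: analytic_at_def)
  from assms(2) obtain \<sigma> where 2: "\<sigma> > 0" "\<forall>q\<in>D. in_box C p (\<lambda>_. \<sigma>) q \<longrightarrow> f q = g q" by (auto simp: eq_near_def)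
  have "power_series_on D C p (\<lambda>_. min \<rho> \<sigma>) f M"
    using 1 2(1) assms(3) by (intro power_series_on_shrink[OF 1(2)]) auto
  then have "power_series_on D C p (\<lambda>_. min \<rho> \<sigma>) g M"
    by (rule power_series_on_cong) (use 2(2) in \<open>auto simp: in_box_def\<close>)
  then show ?thesis using 1(1) 2(1) by (intro analytic_atI[where r = "\<lambda>_. min \<rho> \<sigma>"]) (use assms(3) in auto)
qed

lemma analytic_at_restrict: "analytic_at D p C f \<Longrightarrow> D' \<subseteq> D \<Longrightarrow> analytic_at D' p C f"
  unfolding analytic_at_def
  by (elim exE conjE, intro exI conjI, assumption, rule power_series_on_cong[OF _ order_refl]) auto

lemma analytic_at_superset:
  "analytic_at D p C f \<Longrightarrow> C \<subseteq> C' \<Longrightarrow> finite C' \<Longrightarrow> analytic_at D p C' f"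
  unfolding analytic_at_def by (meson power_series_on_superset)

lemma analytic_at_const: "analytic_at D p C (\<lambda>_. k)"
  unfolding analytic_at_def by (rule exI[of _ 1]) (auto intro: power_series_on_const)

lemma analytic_at_binary:
  assumes "analytic_at D p C f" "analytic_at D p C g" "finite C"
  obtains \<rho> M N where "\<rho> > 0" "power_series_on D C p (\<lambda>_. \<rho>) f M" "power_series_on D C p (\<lambda>_. \<rho>) g N"
proof -
  from assms(1) obtain \<rho> M where 1: "\<rho> > 0" "power_series_on D C p (\<lambda>_. \<rho>) f M" by (auto simp: analytic_at_def)
  from assms(2) obtain \<sigma> N where 2: "\<sigma> > 0" "power_series_on D C p (\<lambda>_. \<sigma>) g N" by (auto simp: analytic_at_def)
  show ?thesis
    by (rule that[of "min \<rho> \<sigma>" M N])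
      (use 1 2 assms(3) in \<open>auto intro!: power_series_on_shrink[OF 1(2)] power_series_on_shrink[OF 2(2)]\<close>)
qed

lemma analytic_at_add:
  assumes "analytic_at D p C f" "analytic_at D p C g" "finite C"
  shows "analytic_at D p C (\<lambda>q. f q + g q)"
proof -
  obtain \<rho> M N where "\<rho> > 0" "power_series_on D C p (\<lambda>_. \<rho>) f M" "power_series_on D C p (\<lambda>_. \<rho>) g N"
    by (rule analytic_at_binary[OF assms])
  then show ?thesis
    by (intro analytic_atI[OF power_series_on_add[where r = "\<lambda>_. \<rho>"]]) (use assms in auto)
qed

lemma analytic_at_mult:
  assumes "analytic_at D p C f" "analytic_at D p C g" "finite C"
  shows "analytic_at D p C (\<lambda>q. f q * g q)"
proof -
  obtain \<rho> M N where "\<rho> > 0" "power_series_on D C p (\<lambda>_. \<rho>) f M" "power_series_on D C p (\<lambda>_. \<rho>) g N"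
    by (rule analytic_at_binary[OF assms])
  then show ?thesis
    by (intro analytic_atI[OF power_series_on_mult[where r = "\<lambda>_. \<rho>"]]) (use assms in auto)
qed

lemma analytic_at_diff:
  assumes "analytic_at D p C f" "analytic_at D p C g" "finite C"
  shows "analytic_at D p C (\<lambda>q. f q - g q)"
  using analytic_at_add[OF assms(1) analytic_at_mult[OF analytic_at_const[of _ _ _ "-1"] assms(2,3)] assms(3)]
  by simp

lemma analytic_at_coord:
  assumes "c \<in> C" "finite C"
  shows "analytic_at D p C (\<lambda>q. q c)"
proof -
  have "analytic_at D p C (\<lambda>q. q c - p c)"
    by (rule analytic_atI[OF power_series_on_coord[where r = "\<lambda>_. 1"]]) (use assms in auto)
  from analytic_at_add[OF this analytic_at_const[of _ _ _ "p c"] assms(2)] show ?thesis by simp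
qed

lemma eventually_in_box:
  assumes "finite C" "\<And>c. c \<in> C \<Longrightarrow> r c > 0" "\<And>c. c \<in> C \<Longrightarrow> ((\<lambda>\<tau>. \<delta> \<tau> c) \<longlongrightarrow> p c) F"
  shows "eventually (\<lambda>\<tau>. in_box C p r (\<delta> \<tau>)) F"
  unfolding in_box_def
proof (intro eventually_ball_finite assms(1) ballI)
  fix c assume c: "c \<in> C"
  show "eventually (\<lambda>\<tau>. \<bar>\<delta> \<tau> c - p c\<bar> \<le> r c) F"
    using tendstoD[OF assms(3)[OF c] assms(2)[OF c]] by (simp add: dist_real_def eventually_mono)
qed

lemma power_series_on_tendsto:
  assumes C: "finite C" and f: "power_series_on D C p r f M" and pos: "\<And>c. c \<in> C \<Longrightarrow> r c > 0" and p: "p \<in> D"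
    and lim: "\<And>c. c \<in> C \<Longrightarrow> ((\<lambda>\<tau>. \<delta> \<tau> c) \<longlongrightarrow> p c) F" and D: "eventually (\<lambda>\<tau>. \<delta> \<tau> \<in> D) F"
  shows "((\<lambda>\<tau>. f (\<delta> \<tau>)) \<longlongrightarrow> f p) F"
proof -
  obtain B where B: "\<And>c. c \<in> C \<Longrightarrow> power_series_on D C p r (B c) (M / r c)"
    "\<And>q. q \<in> D \<Longrightarrow> in_box C p r q \<Longrightarrow> f q = f p + (\<Sum>c\<in>C. (q c - p c) * B c q)"
    by (rule power_series_on_hadamard[OF C f pos p]) blast+
  have box: "eventually (\<lambda>\<tau>. in_box C p r (\<delta> \<tau>)) F"
    by (rule eventually_in_box[OF C pos lim])
  let ?u = "\<lambda>\<tau>. \<Sum>c\<in>C. \<bar>\<delta> \<tau> c - p c\<bar> * (M / r c)"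
  have u: "(?u \<longlongrightarrow> 0) F" by (rule tendsto_eq_intros lim | simp)+
  have "eventually (\<lambda>\<tau>. norm (f (\<delta> \<tau>) - f p) \<le> ?u \<tau>) F"
    using D box
  proof eventually_elim
    case (elim \<tau>)
    have "\<bar>(\<Sum>d\<in>C. (\<delta> \<tau> d - p d) * B d (\<delta> \<tau>))\<bar> \<le> (\<Sum>d\<in>C. \<bar>(\<delta> \<tau> d - p d) * B d (\<delta> \<tau>)\<bar>)"
      by (rule sum_abs)
    also have "\<dots> \<le> ?u \<tau>"
      unfolding abs_mult using power_series_on_bound[OF B(1) elim] by (intro sum_mono mult_left_mono) auto
    finally show ?case using B(2)[OF elim] by simp
  qed
  then have "((\<lambda>\<tau>. f (\<delta> \<tau>) - f p) \<longlongrightarrow> 0) F" using u by (rule Lim_null_comparison)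
  then show ?thesis by (simp add: LIM_zero_iff)
qed

text \<open>
  \<open>b\<close> is the gradient of \<open>f\<close> at \<open>p\<close>. Allowing arbitrary differentiable curves gives partial
  derivatives, the total derivative and the chain rule from a single statement.
\<close>

lemma power_series_on_curve:
  assumes C: "finite C" and f: "power_series_on D C p r f M" and pos: "\<And>c. c \<in> C \<Longrightarrow> r c > 0" and p: "p \<in> D"
  obtains b where "\<And>\<delta> v t. \<delta> t = p \<Longrightarrow> eventually (\<lambda>\<tau>. \<delta> \<tau> \<in> D) (at t) \<Longrightarrow>
      (\<And>c. c \<in> C \<Longrightarrow> ((\<lambda>\<tau>. \<delta> \<tau> c) has_real_derivative v c) (at t)) \<Longrightarrow>
      ((\<lambda>\<tau>. f (\<delta> \<tau>)) has_real_derivative (\<Sum>c\<in>C. v c * b c)) (at (t :: real))"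
proof -
  obtain B where B: "\<And>c. c \<in> C \<Longrightarrow> power_series_on D C p r (B c) (M / r c)"
    "\<And>q. q \<in> D \<Longrightarrow> in_box C p r q \<Longrightarrow> f q = f p + (\<Sum>c\<in>C. (q c - p c) * B c q)"
    by (rule power_series_on_hadamard[OF C f pos p]) blast+
  show thesis
  proof (rule that[of "\<lambda>c. B c p"])
    fix \<delta> :: "real \<Rightarrow> jet" and v and t :: real
    assume \<delta>: "\<delta> t = p" "eventually (\<lambda>\<tau>. \<delta> \<tau> \<in> D) (at t)"
      and v: "\<And>c. c \<in> C \<Longrightarrow> ((\<lambda>\<tau>. \<delta> \<tau> c) has_real_derivative v c) (at t)"
    have lim: "((\<lambda>\<tau>. \<delta> \<tau> c) \<longlongrightarrow> p c) (at t)" if "c \<in> C" for c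
      using DERIV_isCont[OF v[OF that]] \<delta>(1) by (simp add: isCont_def)
    have box: "eventually (\<lambda>\<tau>. in_box C p r (\<delta> \<tau>)) (at t)"
      by (rule eventually_in_box[OF C pos lim])
    have cont: "((\<lambda>\<tau>. B c (\<delta> \<tau>)) \<longlongrightarrow> B c p) (at t)" if c: "c \<in> C" for c
      by (rule power_series_on_tendsto[OF C B(1)[OF c] pos p lim \<delta>(2)])
    have "((\<lambda>\<tau>. (f (\<delta> \<tau>) - f p) / (\<tau> - t)) \<longlongrightarrow> (\<Sum>c\<in>C. v c * B c p)) (at t)"
    proof (rule Lim_transform_eventually)
      show "((\<lambda>\<tau>. \<Sum>c\<in>C. (\<delta> \<tau> c - p c) / (\<tau> - t) * B c (\<delta> \<tau>)) \<longlongrightarrow> (\<Sum>c\<in>C. v c * B c p)) (at t)"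
        using v cont unfolding has_field_derivative_iff \<delta>(1) by (intro tendsto_sum tendsto_mult)
      show "eventually (\<lambda>\<tau>. (\<Sum>c\<in>C. (\<delta> \<tau> c - p c) / (\<tau> - t) * B c (\<delta> \<tau>)) = (f (\<delta> \<tau>) - f p) / (\<tau> - t)) (at t)"
        using \<delta>(2) box
      proof eventually_elim
        case (elim \<tau>)
        show ?case using B(2)[OF elim] by (simp add: sum_divide_distrib)
      qed
    qed
    then show "((\<lambda>\<tau>. f (\<delta> \<tau>)) has_real_derivative (\<Sum>c\<in>C. v c * B c p)) (at t)"
      unfolding has_field_derivative_iff \<delta>(1) .
  qed
qed

lemma analytic_at_partial:
  assumes "finite C" "analytic_at D p C f" "p \<in> D" "eventually (\<lambda>v. p(c := v) \<in> D) (at (p c))"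
  shows "((\<lambda>v. f (p(c := v))) has_real_derivative jet_partial c f p) (at (p c))"
proof -
  from assms(2) obtain \<rho> M where 1: "\<rho> > 0" "power_series_on D C p (\<lambda>_. \<rho>) f M" by (auto simp: analytic_at_def)
  obtain b where b: "\<And>\<delta> v t. \<delta> t = p \<Longrightarrow> eventually (\<lambda>\<tau>. \<delta> \<tau> \<in> D) (at t) \<Longrightarrow>
      (\<And>c. c \<in> C \<Longrightarrow> ((\<lambda>\<tau>. \<delta> \<tau> c) has_real_derivative v c) (at t)) \<Longrightarrow>
      ((\<lambda>\<tau>. f (\<delta> \<tau>)) has_real_derivative (\<Sum>c\<in>C. v c * b c)) (at (t :: real))"
    using power_series_on_curve[OF assms(1) 1(2) _ assms(3)] 1(1) by blast
  have "((\<lambda>v. f (p(c := v))) has_real_derivative (\<Sum>d\<in>C. (if d = c then 1 else 0) * b d)) (at (p c))"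
  proof (rule b[OF _ assms(4)])
    show "((\<lambda>\<tau>. (p(c := \<tau>)) d) has_real_derivative (if d = c then 1 else 0)) (at (p c))" for d
      by (cases "d = c") (auto intro: derivative_eq_intros)
  qed simp
  then show ?thesis unfolding jet_partial_def using DERIV_imp_deriv by force
qed

lemma has_sum_geometric_half: "((\<lambda>k. (1/2 :: real) ^ k) has_sum 2) UNIV"
  using sums_nonneg_imp_has_sum[OF geometric_sums[of "1/2 :: real"]] by simp

lemma power_series_on_remainder_step:
  assumes C: "finite C" and pos: "\<And>d. d \<in> C \<Longrightarrow> r d > 0" and c: "c \<in> C"
    and f: "power_series_on D C p r f (r c / 2)" and h: "power_series_on D C p r h N"
  shows "\<exists>B R. power_series_on D C p r B (N / 2) \<and> power_series_on D (C - {c}) p r R (N * (r c / 2)) \<and>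
    (\<forall>q\<in>D. in_box C p r q \<longrightarrow> h q * f q = R q + (q c - p c) * B q)"
proof -
  have prod: "power_series_on D C p r (\<lambda>q. h q * f q) (N * (r c / 2))"
    by (rule power_series_on_mult[OF C pos h f])
  obtain A B where "power_series_on D (C - {c}) p r A (N * (r c / 2))"
    "power_series_on D C p r B (N * (r c / 2) / r c)"
    "\<And>q. q \<in> D \<Longrightarrow> in_box C p r q \<Longrightarrow> h q * f q = A q + (q c - p c) * B q"
    by (rule power_series_on_shift[OF C pos prod c]) blast+
  moreover have "N * (r c / 2) / r c = N / 2" using pos[OF c] by simp
  ultimately show ?thesis by metis
qed

text \<open>
  The divisor is the coordinate minus a function \<open>f\<close> that is small in comparison. Multiplying
  by \<open>f\<close> and then dividing by the coordinate halves the norm; iterating this from the quotient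
  of \<open>g\<close> gives functions \<open>h k\<close> with \<open>h k * f = R k + x * h (k + 1)\<close>. Their sum is the quotient
  \<open>Q\<close>: the multiples of the coordinate \<open>x\<close> telescope, and the remainders \<open>R k\<close>, which are free
  of \<open>x\<close>, add up.
\<close>

lemma power_series_on_division_small:
  assumes C: "finite C" and pos: "\<And>d. d \<in> C \<Longrightarrow> r d > 0" and c: "c \<in> C"
    and f: "power_series_on D C p r f (r c / 2)" and g: "power_series_on D C p r g M"
  obtains Q R where "power_series_on D C p r Q (2 * (M / r c))"
    "power_series_on D (C - {c}) p r R (2 * M)"
    "\<And>q. q \<in> D \<Longrightarrow> in_box C p r q \<Longrightarrow> g q = Q q * ((q c - p c) - f q) + R q"
proof -
  have rc: "r c > 0" using pos c by simp
  obtain A B where A: "power_series_on D (C - {c}) p r A M" and B: "power_series_on D C p r B (M / r c)"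
    and AB: "\<And>q. q \<in> D \<Longrightarrow> in_box C p r q \<Longrightarrow> g q = A q + (q c - p c) * B q"
    by (rule power_series_on_shift[OF C pos g c]) blast+
  define N where "N k = (M / r c) * (1/2) ^ k" for k
  have "\<exists>h. \<forall>k. power_series_on D C p r (h k) (N k) \<and> (k = 0 \<longrightarrow> h k = B) \<and>
      (\<exists>R. power_series_on D (C - {c}) p r R (N k * (r c / 2)) \<and>
        (\<forall>q\<in>D. in_box C p r q \<longrightarrow> h k q * f q = R q + (q c - p c) * h (Suc k) q))"
  proof -
    let ?P = "\<lambda>k h. power_series_on D C p r h (N k) \<and> (k = 0 \<longrightarrow> h = B)"
    let ?S = "\<lambda>k h h'. \<exists>R. power_series_on D (C - {c}) p r R (N k * (r c / 2)) \<and>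
        (\<forall>q\<in>D. in_box C p r q \<longrightarrow> h q * f q = R q + (q c - p c) * h' q)"
    have "\<exists>h. \<forall>k. ?P k (h k) \<and> ?S k (h k) (h (Suc k))"
    proof (rule dependent_nat_choice)
      show "\<exists>h. ?P 0 h" using B by (auto simp: N_def)
      fix h k assume "?P k h"
      then obtain B' R where "power_series_on D C p r B' (N k / 2)"
        "power_series_on D (C - {c}) p r R (N k * (r c / 2))"
        "\<forall>q\<in>D. in_box C p r q \<longrightarrow> h q * f q = R q + (q c - p c) * B' q"
        using power_series_on_remainder_step[OF C pos c f] by blast
      moreover have "N k / 2 = N (Suc k)" by (simp add: N_def)
      ultimately show "\<exists>h'. ?P (Suc k) h' \<and> ?S k h h'" by auto
    qed
    then show ?thesis by blast
  qed
  then obtain h where h: "\<And>k. power_series_on D C p r (h k) (N k)" "h 0 = B"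
    "\<forall>k. \<exists>R. power_series_on D (C - {c}) p r R (N k * (r c / 2)) \<and>
        (\<forall>q\<in>D. in_box C p r q \<longrightarrow> h k q * f q = R q + (q c - p c) * h (Suc k) q)"
    by blast
  from choice[OF h(3)] obtain R where R: "\<And>k. power_series_on D (C - {c}) p r (R k) (N k * (r c / 2))"
    "\<And>k q. q \<in> D \<Longrightarrow> in_box C p r q \<Longrightarrow> h k q * f q = R k q + (q c - p c) * h (Suc k) q"
    by blast
  note geo = has_sum_geometric_half
  have N: "(N has_sum (2 * (M / r c))) UNIV" unfolding N_def
    using has_sum_cmult_right[OF geo, of "M / r c"] by (simp add: mult.commute)
  have NR: "((\<lambda>k. N k * (r c / 2)) has_sum M) UNIV"
    using has_sum_cmult_left[OF N, of "r c / 2"] rc by simp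
  have hs: "(\<lambda>k. h k q) summable_on UNIV" if "q \<in> D" "in_box C p r q" for q
    by (rule summable_on_abs_comparison(1)[OF has_sum_imp_summable[OF N] power_series_on_bound[OF h(1) that]])
  have Rs: "(\<lambda>k. R k q) summable_on UNIV" if "q \<in> D" "in_box (C - {c}) p r q" for q
    by (rule summable_on_abs_comparison(1)[OF has_sum_imp_summable[OF NR] power_series_on_bound[OF R(1) that]])
  define Q where "Q q = (\<Sum>\<^sub>\<infinity>k. h k q)" for q
  define S where "S q = (\<Sum>\<^sub>\<infinity>k. R k q)" for q
  have Q: "power_series_on D C p r Q (2 * (M / r c))"
    by (rule power_series_on_infsum[where K = UNIV and N = N, OF h(1)])
      (use N hs pos in \<open>auto simp: Q_def infsumI intro: has_sum_imp_summable has_sum_infsum\<close>)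
  have S: "power_series_on D (C - {c}) p r S M"
    by (rule power_series_on_infsum[where K = UNIV and N = "\<lambda>k. N k * (r c / 2)", OF R(1)])
      (use NR Rs pos in \<open>auto simp: S_def infsumI intro: has_sum_imp_summable has_sum_infsum\<close>)
  show thesis
  proof (rule that[of Q "\<lambda>q. A q + S q"])
    show "power_series_on D (C - {c}) p r (\<lambda>q. A q + S q) (2 * M)"
      using power_series_on_add[of "C - {c}" r, OF _ _ A S] C pos by simp
  next
    fix q assume q: "q \<in> D" "in_box C p r q"
    then have q': "in_box (C - {c}) p r q" by (auto simp: in_box_def)
    let ?x = "q c - p c"
    have hq: "(\<lambda>k. h k q) sums Q q" unfolding Q_def by (rule has_sum_imp_sums[OF has_sum_infsum[OF hs[OF q]]])
    have Rq: "(\<lambda>k. R k q) sums S q" unfolding S_def by (rule has_sum_imp_sums[OF has_sum_infsum[OF Rs[OF q(1) q']]])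
    have "(\<lambda>k. h (Suc k) q) sums (Q q - B q)"
      using hq h(2) by (subst sums_Suc_iff) simp
    then have "(\<lambda>k. R k q + ?x * h (Suc k) q) sums (S q + ?x * (Q q - B q))"
      by (intro sums_add sums_mult Rq)
    then have "(\<lambda>k. h k q * f q) sums (S q + ?x * (Q q - B q))" using R(2)[OF q] by simp
    from sums_unique2[OF this sums_mult2[OF hq]] have "S q + ?x * (Q q - B q) = Q q * f q" by simp
    then show "g q = Q q * (?x - f q) + (A q + S q)" using AB[OF q] by (simp add: algebra_simps)
  qed (rule Q)
qed

text \<open>
  Weierstrass division by a function of order one in the coordinate \<open>c\<close>. After scaling, \<open>f\<close> is
  the coordinate minus \<open>a + x * (b + x * e)\<close> with \<open>a\<close> and \<open>b\<close> free of \<open>c\<close> and zero at \<open>p\<close>. A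
  small radius \<open>\<rho>\<close> for \<open>c\<close> controls the quadratic part \<open>e\<close>; after that, much smaller radii
  \<open>t * \<rho>\<close> for the other coordinates control \<open>a\<close> and \<open>b\<close>.

  Division of the coordinate itself yields the implicit function as its remainder, together
  with the statement that the difference is a multiple of \<open>f\<close>; division of other functions
  replaces the substitution of that implicit function.
\<close>

lemma weierstrass_division:
  assumes C: "finite C" and c: "c \<in> C" and p: "p \<in> D" and D: "eventually (\<lambda>v. p(c := v) \<in> D) (at (p c))"
    and f: "analytic_at D p C f" "f p = 0" "jet_partial c f p \<noteq> 0" and g: "analytic_at D p C g"
  obtains Q R where "analytic_at D p C Q" "analytic_at D p (C - {c}) R"
    "eq_near D p C g (\<lambda>q. Q q * f q + R q)"
proof -
  obtain \<rho>0 M N where \<rho>0: "\<rho>0 > 0" and fM: "power_series_on D C p (\<lambda>_. \<rho>0) f M"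
    and gN: "power_series_on D C p (\<lambda>_. \<rho>0) g N"
    by (rule analytic_at_binary[OF f(1) g C])
  obtain A B where A: "power_series_on D (C - {c}) p (\<lambda>_. \<rho>0) A M" and B: "power_series_on D C p (\<lambda>_. \<rho>0) B (M / \<rho>0)"
    and AB: "\<And>q. q \<in> D \<Longrightarrow> in_box C p (\<lambda>_. \<rho>0) q \<Longrightarrow> f q = A q + (q c - p c) * B q"
    by (rule power_series_on_shift[OF C \<rho>0 fM c]) blast+
  obtain A1 E where A1: "power_series_on D (C - {c}) p (\<lambda>_. \<rho>0) A1 (M / \<rho>0)"
    and E: "power_series_on D C p (\<lambda>_. \<rho>0) E (M / \<rho>0 / \<rho>0)"
    and A1E: "\<And>q. q \<in> D \<Longrightarrow> in_box C p (\<lambda>_. \<rho>0) q \<Longrightarrow> B q = A1 q + (q c - p c) * E q"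
    by (rule power_series_on_shift[OF C \<rho>0 B c]) blast+
  have pbox: "in_box C p (\<lambda>_. \<rho>0) p" using \<rho>0 by (simp add: in_box_def)
  have A0: "A p = 0" using AB[OF p pbox] f(2) by simp
  define u where "u = A1 p"
  have "jet_partial c f p = u"
  proof -
    have 1: "((\<lambda>v. f (p(c := v))) has_real_derivative jet_partial c f p) (at (p c))"
      by (rule analytic_at_partial[OF C f(1) p D])
    have 2: "((\<lambda>v. B (p(c := v))) has_real_derivative jet_partial c B p) (at (p c))"
      by (rule analytic_at_partial[OF C _ p D]) (rule analytic_atI[OF B C \<rho>0])
    have 3: "((\<lambda>v. (v - p c) * B (p(c := v))) has_real_derivative B p) (at (p c))"
      by (rule derivative_eq_intros 2 refl | simp)+
    have "eventually (\<lambda>v. \<bar>v - p c\<bar> < \<rho>0) (at (p c))"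
      unfolding eventually_at using \<rho>0 by (auto simp: dist_real_def intro!: exI[of _ \<rho>0])
    with D have "eventually (\<lambda>v. (v - p c) * B (p(c := v)) = f (p(c := v))) (at (p c))"
    proof eventually_elim
      case (elim v)
      then have box: "in_box C p (\<lambda>_. \<rho>0) (p(c := v))" using \<rho>0 by (auto simp: in_box_def)
      have "A (p(c := v)) = A p"
        by (rule power_series_on_depends[OF A elim(1) p]) (use box in \<open>auto simp: in_box_def\<close>)
      then show ?case using AB[OF elim(1) box] A0 by simp
    qed
    then have "((\<lambda>v. f (p(c := v))) has_real_derivative B p) (at (p c))"
      using DERIV_cong_ev[OF refl, of "\<lambda>v. (v - p c) * B (p(c := v))" "\<lambda>v. f (p(c := v))" "p c" "B p" "B p"] 3 f(2)
      by (auto simp: eventually_nhds_conv_at)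
    then have "jet_partial c f p = B p" using 1 DERIV_unique by blast
    then show ?thesis using A1E[OF p pbox] by (simp add: u_def)
  qed
  with f(3) have u: "u \<noteq> 0" by simp
  \<comment> \<open>\<open>K\<close> bounds the quadratic part; \<open>\<rho>\<close> is chosen such that it contributes at most \<open>\<rho> / 8\<close>.\<close>
  define K where "K = \<bar>1 / u\<bar> * (M / \<rho>0 / \<rho>0)"
  have K: "K \<ge> 0" unfolding K_def using power_series_on_nonneg[OF E \<rho>0] by (intro mult_nonneg_nonneg) auto
  define \<rho> where "\<rho> = min \<rho>0 (1 / (8 * (K + 1)))"
  have \<rho>: "\<rho> > 0" "\<rho> \<le> \<rho>0" using \<rho>0 K by (auto simp: \<rho>_def)
  have "\<rho> * K \<le> (1 / (8 * (K + 1))) * K" using K by (intro mult_right_mono) (auto simp: \<rho>_def)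
  also have "\<dots> \<le> 1 / 8" using K by (simp add: field_simps)
  finally have \<rho>K: "\<rho> * K \<le> 1 / 8" .
  let ?C' = "C - {c}"
  have C': "finite ?C'" using C by simp
  define a where "a q = (- 1 / u) * A q" for q
  define b where "b q = 1 - (1 / u) * A1 q" for q
  define e where "e q = (- 1 / u) * E q" for q
  have aser: "power_series_on D ?C' p (\<lambda>_. \<rho>) a (\<bar>- 1 / u\<bar> * M)"
    unfolding a_def by (intro power_series_on_cmult power_series_on_shrink[OF A C']) (use \<rho> in auto)
  have bser: "power_series_on D ?C' p (\<lambda>_. \<rho>) b (\<bar>1\<bar> + \<bar>1 / u\<bar> * (M / \<rho>0))"
    unfolding b_def
    by (intro power_series_on_diff[OF C'] power_series_on_const power_series_on_cmult power_series_on_shrink[OF A1 C'])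
      (use \<rho> in auto)
  obtain Ma Mb where Mab: "power_series_on D ?C' p (\<lambda>_. \<rho>) a Ma" "power_series_on D ?C' p (\<lambda>_. \<rho>) b Mb"
    using aser bser by blast
  have ab0: "a p = 0" "b p = 0" using A0 u by (auto simp: a_def b_def u_def)
  have Mab0: "Ma \<ge> 0" "Mb \<ge> 0" using Mab[THEN power_series_on_nonneg] \<rho>(1) by auto
  define n where "n = real (card ?C')"
  have n: "n \<ge> 0" by (simp add: n_def)
  define t where "t = min 1 (min (\<rho> / (8 * (n * Ma + 1))) (1 / (8 * (n * Mb + 1))))"
  have nn: "n * Ma \<ge> 0" "n * Mb \<ge> 0" using n Mab0 by auto
  have t: "t > 0" "t \<le> 1" using \<rho>(1) nn by (auto simp: t_def)
  have "t * (n * Ma) \<le> (\<rho> / (8 * (n * Ma + 1))) * (n * Ma)"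
    using nn by (intro mult_right_mono) (auto simp: t_def)
  also have "\<dots> \<le> \<rho> / 8" using nn \<rho>(1) by (simp add: field_simps)
  finally have ta: "t * (n * Ma) \<le> \<rho> / 8" .
  have "t * (n * Mb) \<le> (1 / (8 * (n * Mb + 1))) * (n * Mb)"
    using nn by (intro mult_right_mono) (auto simp: t_def)
  also have "\<dots> \<le> 1 / 8" using nn by (simp add: field_simps)
  finally have tb: "t * (n * Mb) \<le> 1 / 8" .
  define r where "r d = (if d = c then \<rho> else t * \<rho>)" for d
  have r: "r d > 0" "r d \<le> \<rho>0" "r d \<le> \<rho>" for d
    using \<rho> t mult_right_mono[OF t(2), of \<rho>] order_trans[of "t * \<rho>" \<rho> \<rho>0] by (auto simp: r_def)
  have rp: "d \<in> C \<Longrightarrow> r d > 0" for d using r by simp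
  have rp': "d \<in> C - {c} \<Longrightarrow> r d > 0" for d using r by simp
  have rc: "r c = \<rho>" by (simp add: r_def)
  have aw: "power_series_on D C p r a (\<rho> / 8)"
  proof (rule power_series_on_superset[OF _ _ C])
    show "power_series_on D ?C' p r a (\<rho> / 8)"
    proof (rule power_series_on_shrink[OF _ C'])
      show "power_series_on D ?C' p (\<lambda>_. t * \<rho>) a (\<rho> / 8)"
        by (rule power_series_on_cong[OF power_series_on_small[OF C' Mab(1) \<rho>(1) p ab0(1) t]])
          (use ta in \<open>auto simp: n_def\<close>)
    qed (use t \<rho> in \<open>auto simp: r_def\<close>)
  qed auto
  have bw: "power_series_on D C p r b (1 / 8)"
  proof (rule power_series_on_superset[OF _ _ C])
    show "power_series_on D ?C' p r b (1 / 8)"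
    proof (rule power_series_on_shrink[OF _ C'])
      show "power_series_on D ?C' p (\<lambda>_. t * \<rho>) b (1 / 8)"
        by (rule power_series_on_cong[OF power_series_on_small[OF C' Mab(2) \<rho>(1) p ab0(2) t]])
          (use tb in \<open>auto simp: n_def\<close>)
    qed (use t \<rho> in \<open>auto simp: r_def\<close>)
  qed auto
  have ew: "power_series_on D C p r e K"
    unfolding e_def K_def
    using power_series_on_cmult[OF power_series_on_shrink[OF E C, of r], of "- 1 / u"] r by simp
  have xw: "power_series_on D C p r (\<lambda>q. q c - p c) \<rho>"
    using power_series_on_coord[where r = r, OF C rp c, of D p] rc by simp
  \<comment> \<open>With these radii the part of \<open>f / u\<close> other than the coordinate itself is small.\<close>
  let ?h = "\<lambda>q. a q + (q c - p c) * (b q + (q c - p c) * e q)"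
  have "power_series_on D C p r ?h (\<rho> / 8 + \<rho> * (1 / 8 + \<rho> * K))"
    by (intro power_series_on_add[OF C rp] power_series_on_mult[OF C rp] aw bw ew xw)
  moreover have "\<rho> / 8 + \<rho> * (1 / 8 + \<rho> * K) \<le> r c / 2"
  proof -
    have "\<rho> * (1 / 8 + \<rho> * K) \<le> \<rho> * (1 / 4)" using \<rho>K \<rho>(1) by (intro mult_left_mono) auto
    then show ?thesis using \<rho>(1) unfolding rc by linarith
  qed
  ultimately have h: "power_series_on D C p r ?h (r c / 2)" by (rule power_series_on_cong) auto
  have gN': "power_series_on D C p r g N"
    by (rule power_series_on_shrink[OF gN C]) (use r in auto)
  obtain Q R where Q: "power_series_on D C p r Q (2 * (N / r c))"
    and R: "power_series_on D (C - {c}) p r R (2 * N)"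
    and QR: "\<And>q. q \<in> D \<Longrightarrow> in_box C p r q \<Longrightarrow> g q = Q q * ((q c - p c) - ?h q) + R q"
    by (rule power_series_on_division_small[OF C rp c h gN']) blast+
  show thesis
  proof (rule that[of "\<lambda>q. (1 / u) * Q q" R])
    show "analytic_at D p C (\<lambda>q. (1 / u) * Q q)"
      by (rule analytic_atI[OF power_series_on_cmult[OF Q] C rp])
    show "analytic_at D p (C - {c}) R" by (rule analytic_atI[OF R C' rp'])
    show "eq_near D p C g (\<lambda>q. (1 / u) * Q q * f q + R q)"
      unfolding eq_near_def
    proof (intro exI[of _ "t * \<rho>"] conjI ballI impI)
      show "t * \<rho> > 0" using t \<rho> by simp
      fix q assume q: "q \<in> D" "in_box C p (\<lambda>_. t * \<rho>) q"
      have "t * \<rho> \<le> r d" for d using t(2) \<rho>(1) by (simp add: r_def)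
      then have box: "in_box C p r q" using q(2) unfolding in_box_def by (meson order_trans)
      then have box0: "in_box C p (\<lambda>_. \<rho>0) q" using r(2) unfolding in_box_def by (meson order_trans)
      have "(q c - p c) - ?h q = (1 / u) * f q"
        unfolding AB[OF q(1) box0] A1E[OF q(1) box0] a_def b_def e_def using u by (simp add: field_simps)
      then show "g q = (1 / u) * Q q * f q + R q" using QR[OF q(1) box] by (simp add: mult_ac)
    qed
  qed
qed

text \<open>
  Up to the factor \<open>f p\<close> the function is \<open>1 - e\<close> with \<open>e p = 0\<close>, so \<open>e\<close> has norm at most \<open>1/2\<close>
  at small radii and the geometric series applies.
\<close>

lemma analytic_at_inverse:
  assumes C: "finite C" and p: "p \<in> D" and f: "analytic_at D p C f" "f p \<noteq> 0"
  obtains w where "analytic_at D p C w" "eq_near D p C (\<lambda>q. w q * f q) (\<lambda>_. 1)"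
proof -
  define e where "e q = 1 - (1 / f p) * f q" for q
  have "analytic_at D p C e" unfolding e_def
    by (intro analytic_at_diff analytic_at_const analytic_at_mult f C)
  then obtain \<rho> M where \<rho>: "\<rho> > 0" "power_series_on D C p (\<lambda>_. \<rho>) e M" by (auto simp: analytic_at_def)
  have M: "M \<ge> 0" using power_series_on_nonneg[OF \<rho>(2)] \<rho>(1) by simp
  define n where "n = real (card C)"
  have n: "n * M \<ge> 0" using M by (simp add: n_def)
  define t where "t = min 1 (1 / (2 * (n * M + 1)))"
  have t: "0 < t" "t \<le> 1" using n by (auto simp: t_def)
  have "t * (n * M) \<le> (1 / (2 * (n * M + 1))) * (n * M)"
    using n by (intro mult_right_mono) (auto simp: t_def)
  also have "\<dots> \<le> 1 / 2" using n by (simp add: field_simps)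
  finally have tn: "t * (n * M) \<le> 1 / 2" .
  have e: "power_series_on D C p (\<lambda>_. t * \<rho>) e (1 / 2)"
    by (rule power_series_on_cong[OF power_series_on_small[OF C \<rho>(2) \<rho>(1) p _ t]])
      (use f(2) tn in \<open>auto simp: e_def n_def\<close>)
  have t\<rho>: "t * \<rho> > 0" using t \<rho> by simp
  note geo = has_sum_geometric_half
  have lt: "\<bar>e q\<bar> \<le> 1 / 2" if "q \<in> D" "in_box C p (\<lambda>_. t * \<rho>) q" for q
    by (rule power_series_on_bound[OF e that])
  have sum: "((\<lambda>k. e q ^ k) has_sum (1 / (1 - e q))) UNIV" if "q \<in> D" "in_box C p (\<lambda>_. t * \<rho>) q" for q
  proof (rule norm_summable_imp_has_sum)
    have "norm (e q) < 1" using lt[OF that] by simp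
    then show "(\<lambda>k. e q ^ k) sums (1 / (1 - e q))" by (rule geometric_sums)
    show "summable (\<lambda>k. norm (e q ^ k))" unfolding norm_power using lt[OF that] by (intro summable_geometric) simp
  qed
  have inv: "power_series_on D C p (\<lambda>_. t * \<rho>) (\<lambda>q. 1 / (1 - e q)) 2"
    by (rule power_series_on_infsum[where K = UNIV and f = "\<lambda>k q. e q ^ k" and N = "\<lambda>k. (1/2) ^ k"])
      (use sum t\<rho> geo in \<open>auto intro!: power_series_on_power[OF C _ e] simp: infsumI intro: has_sum_imp_summable\<close>)
  show thesis
  proof (rule that[of "\<lambda>q. (1 / f p) * (1 / (1 - e q))"])
    show "analytic_at D p C (\<lambda>q. (1 / f p) * (1 / (1 - e q)))"
      by (rule analytic_atI[OF power_series_on_cmult[OF inv] C t\<rho>])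
    show "eq_near D p C (\<lambda>q. (1 / f p) * (1 / (1 - e q)) * f q) (\<lambda>_. 1)"
      unfolding eq_near_def
    proof (intro exI[of _ "t * \<rho>"] conjI ballI impI t\<rho>)
      fix q assume "q \<in> D" "in_box C p (\<lambda>_. t * \<rho>) q"
      from lt[OF this] have "f q \<noteq> 0" by (auto simp: e_def)
      then show "(1 / f p) * (1 / (1 - e q)) * f q = 1" using f(2) by (simp add: e_def)
    qed
  qed
qed

section \<open>Elimination in ideals of germs\<close>

definition near :: "jet set \<Rightarrow> jet \<Rightarrow> jet_coord set \<Rightarrow> jet filter" where
  "near D p C = (INF \<rho>\<in>{0<..}. principal {q\<in>D. in_box C p (\<lambda>_. \<rho>) q})"

lemma eventually_near:
  "eventually P (near D p C) \<longleftrightarrow> (\<exists>\<rho>>0. \<forall>q\<in>D. in_box C p (\<lambda>_. \<rho>) q \<longrightarrow> P q)"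
proof -
  have "eventually P (near D p C) \<longleftrightarrow>
      (\<exists>\<rho>\<in>{0<..}. eventually P (principal {q\<in>D. in_box C p (\<lambda>_. \<rho>) q}))"
    unfolding near_def
  proof (rule eventually_INF_base)
    fix a b :: real assume "a \<in> {0<..}" "b \<in> {0<..}"
    then show "\<exists>x\<in>{0<..}. principal {q\<in>D. in_box C p (\<lambda>_. x) q} \<le>
        inf (principal {q\<in>D. in_box C p (\<lambda>_. a) q}) (principal {q\<in>D. in_box C p (\<lambda>_. b) q})"
      by (intro bexI[of _ "min a b"]) (auto simp: in_box_def)
  qed auto
  then show ?thesis by (auto simp: eventually_principal)
qed

lemma eq_near_iff: "eq_near D p C f g \<longleftrightarrow> eventually (\<lambda>q. f q = g q) (near D p C)"
  by (simp add: eq_near_def eventually_near)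

lemma near_superset: "eventually P (near D p C) \<Longrightarrow> C \<subseteq> C' \<Longrightarrow> eventually P (near D p C')"
  unfolding eventually_near in_box_def by blast

lemma near_center: "eventually P (near D p C) \<Longrightarrow> p \<in> D \<Longrightarrow> P p"
  unfolding eventually_near in_box_def by force

text \<open>
  The ideal generated by the family \<open>F\<close> in the ring of analytic germs over the coordinates
  \<open>C\<close>.
\<close>

definition germ_ideal ::
    "jet set \<Rightarrow> jet \<Rightarrow> jet_coord set \<Rightarrow> 'i set \<Rightarrow> ('i \<Rightarrow> jet \<Rightarrow> real) \<Rightarrow> (jet \<Rightarrow> real) set" where
  "germ_ideal D p C I F = {f. \<exists>Q. (\<forall>i\<in>I. analytic_at D p C (Q i)) \<and>
     eq_near D p C f (\<lambda>q. \<Sum>i\<in>I. Q i q * F i q)}"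

lemma germ_idealE:
  assumes "f \<in> germ_ideal D p C I F"
  obtains Q where "\<And>i. i \<in> I \<Longrightarrow> analytic_at D p C (Q i)"
    "eventually (\<lambda>q. f q = (\<Sum>i\<in>I. Q i q * F i q)) (near D p C)"
  using assms unfolding germ_ideal_def eq_near_iff by blast

lemma germ_idealI:
  assumes "\<And>i. i \<in> I \<Longrightarrow> analytic_at D p C (Q i)"
    "eventually (\<lambda>q. f q = (\<Sum>i\<in>I. Q i q * F i q)) (near D p C)"
  shows "f \<in> germ_ideal D p C I F"
  using assms unfolding germ_ideal_def eq_near_iff by blast

lemma germ_ideal_cong:
  assumes "f \<in> germ_ideal D p C I F" "eventually (\<lambda>q. f q = g q) (near D p C)"
  shows "g \<in> germ_ideal D p C I F"
proof -
  obtain Q where Q: "\<And>i. i \<in> I \<Longrightarrow> analytic_at D p C (Q i)"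
    "eventually (\<lambda>q. f q = (\<Sum>i\<in>I. Q i q * F i q)) (near D p C)"
    by (rule germ_idealE[OF assms(1)]) blast
  show ?thesis
  proof (rule germ_idealI[OF Q(1)])
    show "eventually (\<lambda>q. g q = (\<Sum>i\<in>I. Q i q * F i q)) (near D p C)"
      using Q(2) assms(2) by eventually_elim simp
  qed
qed

lemma germ_ideal_mem:
  assumes "finite I" "i \<in> I"
  shows "F i \<in> germ_ideal D p C I F"
  by (rule germ_idealI[where Q = "\<lambda>j _. if j = i then 1 else 0"])
    (use assms in \<open>auto intro: analytic_at_const simp: if_distrib[where f = "\<lambda>x. x * _"] cong: if_cong\<close>)

lemma germ_ideal_superset:
  assumes "f \<in> germ_ideal D p C I F" "C \<subseteq> C'" "finite C'"
  shows "f \<in> germ_ideal D p C' I F"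
proof -
  obtain Q where Q: "\<And>i. i \<in> I \<Longrightarrow> analytic_at D p C (Q i)"
    "eventually (\<lambda>q. f q = (\<Sum>i\<in>I. Q i q * F i q)) (near D p C)"
    by (rule germ_idealE[OF assms(1)]) blast
  show ?thesis
    by (rule germ_idealI[OF analytic_at_superset[OF Q(1) assms(2,3)] near_superset[OF Q(2) assms(2)]])
qed

lemma germ_ideal_add:
  assumes "f \<in> germ_ideal D p C I F" "g \<in> germ_ideal D p C I F" "finite C"
  shows "(\<lambda>q. f q + g q) \<in> germ_ideal D p C I F"
proof -
  obtain Q where Q: "\<And>i. i \<in> I \<Longrightarrow> analytic_at D p C (Q i)"
    "eventually (\<lambda>q. f q = (\<Sum>i\<in>I. Q i q * F i q)) (near D p C)"
    by (rule germ_idealE[OF assms(1)]) blast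
  obtain R where R: "\<And>i. i \<in> I \<Longrightarrow> analytic_at D p C (R i)"
    "eventually (\<lambda>q. g q = (\<Sum>i\<in>I. R i q * F i q)) (near D p C)"
    by (rule germ_idealE[OF assms(2)]) blast
  show ?thesis
  proof (rule germ_idealI[OF analytic_at_add[OF Q(1) R(1) assms(3)]])
    show "eventually (\<lambda>q. f q + g q = (\<Sum>i\<in>I. (Q i q + R i q) * F i q)) (near D p C)"
      using Q(2) R(2) by eventually_elim (simp add: sum.distrib distrib_right)
  qed
qed

lemma germ_ideal_mult:
  assumes "f \<in> germ_ideal D p C I F" "analytic_at D p C g" "finite C"
  shows "(\<lambda>q. g q * f q) \<in> germ_ideal D p C I F"
proof -
  obtain Q where Q: "\<And>i. i \<in> I \<Longrightarrow> analytic_at D p C (Q i)"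
    "eventually (\<lambda>q. f q = (\<Sum>i\<in>I. Q i q * F i q)) (near D p C)"
    by (rule germ_idealE[OF assms(1)]) blast
  show ?thesis
  proof (rule germ_idealI[OF analytic_at_mult[OF assms(2) Q(1) assms(3)]])
    show "eventually (\<lambda>q. g q * f q = (\<Sum>i\<in>I. (g q * Q i q) * F i q)) (near D p C)"
      using Q(2) by eventually_elim (simp add: sum_distrib_left mult.assoc)
  qed
qed

lemma germ_ideal_diff:
  assumes "f \<in> germ_ideal D p C I F" "g \<in> germ_ideal D p C I F" "finite C"
  shows "(\<lambda>q. f q - g q) \<in> germ_ideal D p C I F"
  using germ_ideal_add[OF assms(1) germ_ideal_mult[OF assms(2) analytic_at_const[of _ _ _ "-1"] assms(3)] assms(3)]
  by simp

lemma germ_ideal_zero: "(\<lambda>_. 0) \<in> germ_ideal D p C I F"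
  by (rule germ_idealI[where Q = "\<lambda>_ _. 0"]) (auto intro: analytic_at_const)

lemma germ_ideal_sum:
  assumes "\<And>k. k \<in> K \<Longrightarrow> f k \<in> germ_ideal D p C I F" "finite C"
  shows "(\<lambda>q. \<Sum>k\<in>K. f k q) \<in> germ_ideal D p C I F"
  using assms
  by (induction K rule: infinite_finite_induct) (auto intro: germ_ideal_zero germ_ideal_add)

lemma germ_ideal_trans:
  assumes "f \<in> germ_ideal D p C I F" "\<And>i. i \<in> I \<Longrightarrow> F i \<in> germ_ideal D p C J G" "finite C"
  shows "f \<in> germ_ideal D p C J G"
proof -
  obtain Q where Q: "\<And>i. i \<in> I \<Longrightarrow> analytic_at D p C (Q i)"
    "eventually (\<lambda>q. f q = (\<Sum>i\<in>I. Q i q * F i q)) (near D p C)"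
    by (rule germ_idealE[OF assms(1)]) blast
  have "(\<lambda>q. \<Sum>i\<in>I. Q i q * F i q) \<in> germ_ideal D p C J G"
    by (intro germ_ideal_sum germ_ideal_mult assms Q)
  then show ?thesis
    by (rule germ_ideal_cong) (use Q(2) in \<open>auto elim: eventually_mono\<close>)
qed

lemma germ_ideal_vanish:
  assumes "f \<in> germ_ideal D p C I F" "p \<in> D" "\<And>i. i \<in> I \<Longrightarrow> F i p = 0"
  shows "f p = 0"
proof -
  obtain Q where Q: "eventually (\<lambda>q. f q = (\<Sum>i\<in>I. Q i q * F i q)) (near D p C)"
    by (rule germ_idealE[OF assms(1)]) blast
  show ?thesis using near_center[OF Q assms(2)] assms(3) by simp
qed

context
  fixes D :: "jet set" and p :: jet and J :: "jet_coord set"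
  assumes p: "p \<in> D" and nb: "\<And>c. c \<in> J \<Longrightarrow> eventually (\<lambda>v. p(c := v) \<in> D) (at (p c))"
begin

lemma eventually_near_curve:
  assumes "eventually P (near D p C)" "c \<in> J"
  shows "eventually (\<lambda>v. P (p(c := v))) (nhds (p c))"
proof -
  obtain \<rho> where \<rho>: "\<rho> > 0" "\<forall>q\<in>D. in_box C p (\<lambda>_. \<rho>) q \<longrightarrow> P q" using assms(1) by (auto simp: eventually_near)
  have "eventually (\<lambda>v. \<bar>v - p c\<bar> < \<rho>) (at (p c))"
    unfolding eventually_at using \<rho>(1) by (auto simp: dist_real_def intro!: exI[of _ \<rho>])
  with nb[OF assms(2)] have "eventually (\<lambda>v. P (p(c := v))) (at (p c))"
  proof eventually_elim
    case (elim v)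
    then show ?case using \<rho> by (auto simp: in_box_def)
  qed
  moreover have "P (p(c := p c))" using near_center[OF assms(1) p] by simp
  ultimately show ?thesis by (simp add: eventually_nhds_conv_at)
qed

lemma jet_partial_near_eqI:
  assumes "eventually (\<lambda>q. f q = g q) (near D p C)" "c \<in> J"
    and "((\<lambda>v. g (p(c := v))) has_real_derivative d) (at (p c))"
  shows "jet_partial c f p = d"
proof -
  have "((\<lambda>v. f (p(c := v))) has_real_derivative d) (at (p c))"
    using DERIV_cong_ev[OF refl eventually_near_curve[OF assms(1,2)] refl, of d] assms(3) by simp
  then show ?thesis unfolding jet_partial_def by (rule DERIV_imp_deriv)
qed

lemma jet_partial_indep:
  assumes "analytic_at D p C f" "finite C" "c \<in> J - C"
  shows "jet_partial c f p = 0"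
proof -
  obtain \<rho> M where \<rho>: "\<rho> > 0" and f: "power_series_on D C p (\<lambda>_. \<rho>) f M"
    using assms(1) by (auto simp: analytic_at_def)
  have "f q = f p" if "q \<in> D" "in_box (insert c C) p (\<lambda>_. \<rho>) q" "\<forall>d\<in>C. q d = p d" for q
    by (rule power_series_on_depends[OF f that(1) p]) (use that in \<open>auto simp: in_box_def\<close>)
  moreover have "eventually (\<lambda>q. q \<in> D \<and> in_box (insert c C) p (\<lambda>_. \<rho>) q) (near D p (insert c C))"
    using \<rho> by (auto simp: eventually_near)
  ultimately have "eventually (\<lambda>q. (\<forall>d\<in>C. q d = p d) \<longrightarrow> f q = f p) (near D p (insert c C))"
    by (auto elim: eventually_mono)
  from eventually_near_curve[OF this, of c] assms(3)
  have *: "eventually (\<lambda>v. f (p(c := v)) = f p) (nhds (p c))"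
    by (auto elim!: eventually_mono)
  have "((\<lambda>v. f (p(c := v))) has_real_derivative 0) (at (p c))"
    using DERIV_cong_ev[OF refl *, of 0 0] by simp
  then show ?thesis unfolding jet_partial_def by (rule DERIV_imp_deriv)
qed

lemma jet_partial_combination:
  assumes C: "finite C" and "c \<in> J"
    and an: "analytic_at D p C g" "analytic_at D p C f" "analytic_at D p C h"
    and eq: "eventually (\<lambda>q. F q = g q * f q + h q) (near D p C)"
  shows "jet_partial c F p = jet_partial c g p * f p + g p * jet_partial c f p + jet_partial c h p"
proof (rule jet_partial_near_eqI[OF eq assms(2)])
  note d = analytic_at_partial[OF C _ p nb[OF assms(2)]]
  show "((\<lambda>v. g (p(c := v)) * f (p(c := v)) + h (p(c := v))) has_real_derivative
      jet_partial c g p * f p + g p * jet_partial c f p + jet_partial c h p) (at (p c))"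
    by (rule derivative_eq_intros d an refl | simp)+
qed

lemma jet_partial_coord_diff:
  assumes "finite C" "c \<in> J" "analytic_at D p (C - {c}) H"
  shows "jet_partial c (\<lambda>q. q c - H q) p = 1"
proof -
  have an: "analytic_at D p (insert c C) H"
    using assms by (intro analytic_at_superset[OF assms(3)]) auto
  have fin: "finite (insert c C)" using assms(1) by simp
  have "((\<lambda>v. v - H (p(c := v))) has_real_derivative 1 - jet_partial c H p) (at (p c))"
    by (rule derivative_eq_intros analytic_at_partial[OF fin an p nb[OF assms(2)]] refl)+
  moreover have "jet_partial c H p = 0" using jet_partial_indep[OF assms(3)] assms(1,2) by simp
  ultimately show ?thesis unfolding jet_partial_def by (intro DERIV_imp_deriv) simp
qed

text \<open>
  The coordinates in \<open>X\<close> are replaced by the functions \<open>H c\<close>, by division by \<open>x_c - H c\<close> one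
  coordinate at a time; so the difference lies in the ideal by construction.
\<close>

lemma reduce_modulo_graph:
  assumes "finite X" "finite C" "X \<subseteq> C" "C \<subseteq> J"
    and "\<And>c. c \<in> X \<Longrightarrow> analytic_at D p (C - X) (H c)" "\<And>c. c \<in> X \<Longrightarrow> H c p = p c"
    and "analytic_at D p C h"
  shows "\<exists>h'. analytic_at D p (C - X) h' \<and>
    (\<lambda>q. h q - h' q) \<in> germ_ideal D p C X (\<lambda>c q. q c - H c q)"
  using assms
proof (induction X arbitrary: C h)
  case empty
  then show ?case by (intro exI[of _ h]) (simp add: germ_ideal_zero)
next
  case (insert c X)
  let ?C = "C - {c}" and ?F = "\<lambda>c q. q c - H c q"
  have CX: "?C - X = C - insert c X" by auto
  have cC: "c \<in> C" "c \<in> J" using insert.prems by auto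
  have fin: "finite ?C" using insert.prems by simp
  have Hc: "analytic_at D p ?C (H c)"
    by (rule analytic_at_superset[OF insert.prems(4) _ fin]) auto
  have an: "analytic_at D p C (?F c)"
    using insert.prems(1) cC
    by (intro analytic_at_diff analytic_at_coord analytic_at_superset[OF Hc]) auto
  obtain Q R where Q: "analytic_at D p C Q" and R: "analytic_at D p ?C R"
    and eq: "eq_near D p C h (\<lambda>q. Q q * ?F c q + R q)"
  proof (rule weierstrass_division[OF insert.prems(1) cC(1) p nb[OF cC(2)] an _ _ insert.prems(6)])
    show "p c - H c p = 0" using insert.prems(5) by simp
    show "jet_partial c (?F c) p \<noteq> 0"
      using jet_partial_coord_diff[OF insert.prems(1) cC(2) Hc] by simp
  qed
  have "\<exists>h'. analytic_at D p (?C - X) h' \<and> (\<lambda>q. R q - h' q) \<in> germ_ideal D p ?C X ?F"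
  proof (rule insert.IH[OF fin _ _ _ _ R])
    show "X \<subseteq> ?C" "?C \<subseteq> J" using insert by auto
    show "analytic_at D p (?C - X) (H d)" if "d \<in> X" for d
      unfolding CX using insert.prems(4) that by blast
    show "H d p = p d" if "d \<in> X" for d using insert.prems(5) that by blast
  qed
  then obtain h' where h': "analytic_at D p (C - insert c X) h'"
    "(\<lambda>q. R q - h' q) \<in> germ_ideal D p ?C X ?F" unfolding CX by blast
  have mem: "?F d \<in> germ_ideal D p C (insert c X) ?F" if "d \<in> insert c X" for d
    using germ_ideal_mem[of "insert c X" d ?F D p C] insert.hyps(1) that by simp
  have "(\<lambda>q. R q - h' q) \<in> germ_ideal D p C (insert c X) ?F"
    by (rule germ_ideal_trans[OF germ_ideal_superset[OF h'(2) _ insert.prems(1)] mem insert.prems(1)]) auto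
  then have "(\<lambda>q. Q q * ?F c q + (R q - h' q)) \<in> germ_ideal D p C (insert c X) ?F"
    by (intro germ_ideal_add germ_ideal_mult mem Q insert.prems(1)) auto
  then have "(\<lambda>q. h q - h' q) \<in> germ_ideal D p C (insert c X) ?F"
    by (rule germ_ideal_cong) (use eq in \<open>auto simp: eq_near_iff elim: eventually_mono\<close>)
  with h'(1) show ?case by blast
qed

text \<open>
  An implicit function theorem for ideals, by elimination of one equation at a time. Some
  coordinate \<open>c0\<close> has a nonzero derivative in \<open>P i0\<close>. Division of the other equations by
  \<open>P i0\<close> leaves remainders \<open>r i\<close> free of \<open>c0\<close>, and division of the coordinate \<open>c0\<close> leaves a
  function \<open>h\<close>. On the level of differentials this is a row operation; therefore nondegeneracy
  is stated as the absence of row relations, which passes to the remainders directly. The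
  ideals generated by the equations and by the differences \<open>x_c - H c\<close> contain each other: one
  inclusion parametrizes the solutions, the other shows that nothing has been lost.
\<close>

theorem implicit_functions_germ_ideal:
  assumes "finite I" "finite C" "X \<subseteq> C" "C \<subseteq> J" "card X = card I"
    and "\<And>i. i \<in> I \<Longrightarrow> analytic_at D p C (P i)" "\<And>i. i \<in> I \<Longrightarrow> P i p = 0"
    and "\<And>v. (\<And>c. c \<in> X \<Longrightarrow> (\<Sum>i\<in>I. v i * jet_partial c (P i) p) = 0) \<Longrightarrow> (\<And>i. i \<in> I \<Longrightarrow> v i = 0)"
  shows "\<exists>H. (\<forall>c\<in>X. analytic_at D p (C - X) (H c) \<and> (\<lambda>q. q c - H c q) \<in> germ_ideal D p C I P) \<and>
    (\<forall>i\<in>I. P i \<in> germ_ideal D p C X (\<lambda>c q. q c - H c q))"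
  using assms
proof (induction I arbitrary: C X P)
  case empty
  then have "X = {}" using finite_subset by fastforce
  then show ?case by simp
next
  case (insert i0 I)
  note C = insert.prems(1) and XC = insert.prems(2) and CJ = insert.prems(3) and cardX = insert.prems(4)
    and P = insert.prems(5) and P0 = insert.prems(6) and nondeg = insert.prems(7)
  have "\<exists>c\<in>X. jet_partial c (P i0) p \<noteq> 0"
  proof (rule ccontr)
    assume "\<not> ?thesis"
    then have "(\<Sum>i\<in>insert i0 I. (if i = i0 then 1 else 0) * jet_partial c (P i) p) = 0" if "c \<in> X" for c
      using that insert.hyps by (simp add: if_distrib[where f = "\<lambda>x. x * _"] cong: if_cong)
    from nondeg[of "\<lambda>i. if i = i0 then 1 else 0" i0, OF this] show False by simp
  qed
  then obtain c0 where c0: "c0 \<in> X" "jet_partial c0 (P i0) p \<noteq> 0" by blast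
  have c0C: "c0 \<in> C" "c0 \<in> J" using c0 XC CJ by auto
  let ?C = "C - {c0}" and ?X = "X - {c0}" and ?A = "insert i0 I"
  have fin: "finite ?C" "finite X" using C finite_subset[OF XC] by auto
  have CX: "?C - ?X = C - X" using c0 by auto
  note div = weierstrass_division[OF C c0C(1) p nb[OF c0C(2)] P[of i0] P0[of i0] c0(2)]
  have "\<exists>q r. analytic_at D p C q \<and> analytic_at D p ?C r \<and>
      eventually (\<lambda>x. g x = q x * P i0 x + r x) (near D p C)" if "analytic_at D p C g" for g
    by (rule div[OF _ _ that]) (auto simp: eq_near_iff)
  note ex = this
  obtain u h where u: "analytic_at D p C u" and h: "analytic_at D p ?C h"
    and uh: "eventually (\<lambda>x. x c0 = u x * P i0 x + h x) (near D p C)"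
    using ex[OF analytic_at_coord[OF c0C(1) C]] by blast
  have "\<forall>i\<in>I. \<exists>q r. analytic_at D p C q \<and> analytic_at D p ?C r \<and>
      eventually (\<lambda>x. P i x = q x * P i0 x + r x) (near D p C)"
    using ex P by simp
  from bchoice[OF this] obtain q where "\<forall>i\<in>I. \<exists>r. analytic_at D p C (q i) \<and> analytic_at D p ?C r \<and>
      eventually (\<lambda>x. P i x = q i x * P i0 x + r x) (near D p C)" by blast
  from bchoice[OF this] obtain r where "\<forall>i\<in>I. analytic_at D p C (q i) \<and> analytic_at D p ?C (r i) \<and>
      eventually (\<lambda>x. P i x = q i x * P i0 x + r i x) (near D p C)" by blast
  then have q: "\<And>i. i \<in> I \<Longrightarrow> analytic_at D p C (q i)"
    and r: "\<And>i. i \<in> I \<Longrightarrow> analytic_at D p ?C (r i)"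
    and qr: "\<And>i. i \<in> I \<Longrightarrow> eventually (\<lambda>x. P i x = q i x * P i0 x + r i x) (near D p C)"
    by blast+
  have r': "analytic_at D p C (r i)" if "i \<in> I" for i
    by (rule analytic_at_superset[OF r[OF that] _ C]) auto
  have h': "analytic_at D p C h" by (rule analytic_at_superset[OF h _ C]) auto
  have r0: "r i p = 0" if "i \<in> I" for i
    using near_center[OF qr[OF that] p] P0 that by simp
  have dr: "jet_partial c (P i) p = q i p * jet_partial c (P i0) p + jet_partial c (r i) p"
    if "i \<in> I" "c \<in> J" for c i
    using jet_partial_combination[OF C that(2) q[OF that(1)] P[of i0] r'[OF that(1)] qr[OF that(1)]] P0[of i0]
    by simp
  have "\<exists>H. (\<forall>c\<in>?X. analytic_at D p (?C - ?X) (H c) \<and> (\<lambda>q. q c - H c q) \<in> germ_ideal D p ?C I r) \<and>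
    (\<forall>i\<in>I. r i \<in> germ_ideal D p ?C ?X (\<lambda>c q. q c - H c q))"
  proof (rule insert.IH[OF fin(1)])
    show "?X \<subseteq> ?C" "?C \<subseteq> J" using XC CJ by auto
    show "card ?X = card I" using cardX insert.hyps fin c0 by simp
    fix v i assume v: "\<And>c. c \<in> ?X \<Longrightarrow> (\<Sum>i\<in>I. v i * jet_partial c (r i) p) = 0" and i: "i \<in> I"
    have v': "(\<Sum>i\<in>I. v i * jet_partial c (r i) p) = 0" if "c \<in> X" for c
    proof (cases "c = c0")
      case True
      then show ?thesis using jet_partial_indep[OF r fin(1)] c0C by simp
    qed (use v that in simp)
    \<comment> \<open>A relation among the remainders, extended to \<open>i0\<close> so as to undo the division.\<close>
    define w where "w j = (if j = i0 then - (\<Sum>i\<in>I. v i * q i p) else v j)" for j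
    have "w i = 0"
    proof (rule nondeg)
      fix c assume c: "c \<in> X"
      then have cJ: "c \<in> J" using XC CJ by auto
      have "(\<Sum>i\<in>?A. w i * jet_partial c (P i) p)
          = w i0 * jet_partial c (P i0) p + (\<Sum>i\<in>I. v i * jet_partial c (P i) p)"
        using insert.hyps by (auto simp: w_def intro!: sum.cong)
      also have "(\<Sum>i\<in>I. v i * jet_partial c (P i) p) =
          (\<Sum>i\<in>I. v i * q i p) * jet_partial c (P i0) p + (\<Sum>i\<in>I. v i * jet_partial c (r i) p)"
        unfolding sum_distrib_right sum.distrib[symmetric]
        by (intro sum.cong refl) (simp add: dr[OF _ cJ] algebra_simps)
      finally show "(\<Sum>i\<in>?A. w i * jet_partial c (P i) p) = 0" using v'[OF c] by (simp add: w_def)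
    qed (use i in simp)
    moreover have "i \<noteq> i0" using i insert.hyps by blast
    ultimately show "v i = 0" by (simp add: w_def)
  qed (use r r0 in auto)
  then obtain H where H: "\<And>c. c \<in> ?X \<Longrightarrow> analytic_at D p (C - X) (H c)"
    "\<And>c. c \<in> ?X \<Longrightarrow> (\<lambda>q. q c - H c q) \<in> germ_ideal D p ?C I r"
    "\<And>i. i \<in> I \<Longrightarrow> r i \<in> germ_ideal D p ?C ?X (\<lambda>c q. q c - H c q)"
    unfolding CX by blast
  have Hp: "H c p = p c" if "c \<in> ?X" for c
    using germ_ideal_vanish[OF H(2)[OF that] p r0] by simp
  have "\<exists>k. analytic_at D p (?C - ?X) k \<and> (\<lambda>q. h q - k q) \<in> germ_ideal D p ?C ?X (\<lambda>c q. q c - H c q)"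
    by (rule reduce_modulo_graph) (use H(1) Hp h fin XC CJ CX in auto)
  then obtain k where k: "analytic_at D p (C - X) k"
    "(\<lambda>q. h q - k q) \<in> germ_ideal D p ?C ?X (\<lambda>c q. q c - H c q)"
    unfolding CX by blast
  define G where "G = H(c0 := k)"
  let ?P = "germ_ideal D p C ?A P" and ?G = "germ_ideal D p C X (\<lambda>c q. q c - G c q)"
  have memP: "P i \<in> ?P" if "i \<in> ?A" for i using germ_ideal_mem[of ?A i P] insert.hyps that by simp
  have memG: "(\<lambda>q. q c - G c q) \<in> ?G" if "c \<in> X" for c
    using germ_ideal_mem[of X c "\<lambda>c q. q c - G c q"] fin that by simp
  have rP: "r i \<in> ?P" if "i \<in> I" for i
  proof (rule germ_ideal_cong)
    show "(\<lambda>x. P i x - q i x * P i0 x) \<in> ?P"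
      by (intro germ_ideal_diff germ_ideal_mult memP q C) (use that in auto)
    show "eventually (\<lambda>x. P i x - q i x * P i0 x = r i x) (near D p C)"
      using qr[OF that] by eventually_elim simp
  qed
  have HP: "(\<lambda>q. q c - H c q) \<in> ?P" if "c \<in> ?X" for c
    by (rule germ_ideal_trans[OF germ_ideal_superset[OF H(2)[OF that] _ C] rP C]) auto
  have hkP: "(\<lambda>q. h q - k q) \<in> ?P"
    by (rule germ_ideal_trans[OF germ_ideal_superset[OF k(2) _ C] HP C]) auto
  have HG: "(\<lambda>q. q c - H c q) \<in> ?G" if "c \<in> ?X" for c
    using memG[of c] that by (simp add: G_def)
  have hkG: "(\<lambda>q. h q - k q) \<in> ?G"
    by (rule germ_ideal_trans[OF germ_ideal_superset[OF k(2) _ C] HG C]) auto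
  have xk: "(\<lambda>q. q c0 - k q) \<in> ?P"
  proof (rule germ_ideal_cong)
    show "(\<lambda>q. u q * P i0 q + (h q - k q)) \<in> ?P"
      by (intro germ_ideal_add germ_ideal_mult memP u hkP C) auto
    show "eventually (\<lambda>q. u q * P i0 q + (h q - k q) = q c0 - k q) (near D p C)"
      using uh by eventually_elim simp
  qed
  have "jet_partial c0 (\<lambda>q. q c0) p = 1"
    using jet_partial_coord_diff[OF C c0C(2) analytic_at_const[of _ _ _ 0]] by simp
  moreover have "jet_partial c0 (\<lambda>q. q c0) p = u p * jet_partial c0 (P i0) p"
    using jet_partial_combination[OF C c0C(2) u P[of i0] h' uh] P0[of i0]
      jet_partial_indep[OF h fin(1), of c0] c0C by simp
  ultimately have "u p \<noteq> 0" by auto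
  then obtain w where w: "analytic_at D p C w" "eq_near D p C (\<lambda>q. w q * u q) (\<lambda>_. 1)"
    by (rule analytic_at_inverse[OF C p u])
  have P0G: "P i0 \<in> ?G"
  proof (rule germ_ideal_cong)
    show "(\<lambda>q. w q * ((q c0 - G c0 q) - (h q - k q))) \<in> ?G"
      by (intro germ_ideal_mult germ_ideal_diff memG c0 hkG w C)
    have "eventually (\<lambda>q. w q * u q = 1) (near D p C)" using w(2) by (simp add: eq_near_iff)
    with uh show "eventually (\<lambda>q. w q * ((q c0 - G c0 q) - (h q - k q)) = P i0 q) (near D p C)"
    proof eventually_elim
      case (elim q)
      have "w q * ((q c0 - G c0 q) - (h q - k q)) = w q * (u q * P i0 q)"
        unfolding elim(1) by (simp add: G_def)
      also have "\<dots> = P i0 q" using elim(2) by (simp add: mult.assoc[symmetric])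
      finally show ?case .
    qed
  qed
  have PG: "P i \<in> ?G" if "i \<in> I" for i
  proof (rule germ_ideal_cong)
    have "r i \<in> ?G"
      by (rule germ_ideal_trans[OF germ_ideal_superset[OF H(3)[OF that] _ C] HG C]) auto
    then show "(\<lambda>x. q i x * P i0 x + r i x) \<in> ?G"
      by (intro germ_ideal_add germ_ideal_mult P0G q that C)
    show "eventually (\<lambda>x. q i x * P i0 x + r i x = P i x) (near D p C)"
      using qr[OF that] by eventually_elim simp
  qed
  show ?case
  proof (intro exI[of _ G] conjI ballI)
    fix c assume c: "c \<in> X"
    show "analytic_at D p (C - X) (G c)" using H(1) k(1) c by (auto simp: G_def)
    show "(\<lambda>q. q c - G c q) \<in> ?P" using HP xk c by (auto simp: G_def)
  next
    fix i assume "i \<in> ?A"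
    then show "P i \<in> ?G" using P0G PG by auto
  qed
qed

end

section \<open>Differential functions as analytic functions\<close>

definition jet_box :: "nat \<Rightarrow> jet_coord set \<Rightarrow> jet \<Rightarrow> real \<Rightarrow> jet set" where
  "jet_box n C p \<epsilon> = {q\<in>jet_space n. \<forall>c\<in>C. \<bar>q c - p c\<bar> < \<epsilon>}"

lemma jet_open_subset: "jet_open n V \<Longrightarrow> V \<subseteq> jet_space n"
  by (drule openin_imp_subset)

lemma jet_open_jet_box:
  assumes "finite C"
  shows "jet_open n (jet_box n C p \<epsilon>)"
proof -
  have "open {q. \<forall>c\<in>C. q (id c) \<in> {p c - \<epsilon><..<p c + \<epsilon>}}"
    by (rule product_topology_basis'[OF assms]) auto
  moreover have "jet_box n C p \<epsilon> = jet_space n \<inter> {q. \<forall>c\<in>C. q (id c) \<in> {p c - \<epsilon><..<p c + \<epsilon>}}"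
    by (auto simp: jet_box_def abs_less_iff algebra_simps)
  ultimately show ?thesis by (auto simp: openin_open)
qed

lemma jet_open_contains_box:
  assumes "jet_open n V" "p \<in> V"
  obtains C \<epsilon> where "finite C" "C \<subseteq> jet_coords n" "\<epsilon> > 0" "jet_box n C p \<epsilon> \<subseteq> V"
proof -
  from assms(1) obtain T where T: "open T" "V = jet_space n \<inter> T" by (auto simp: openin_open)
  have "openin (product_topology (\<lambda>_. euclidean) UNIV) T" using T(1) by (simp add: open_fun_def)
  then have "\<exists>X. p \<in> (\<Pi>\<^sub>E i\<in>UNIV. X i) \<and> (\<forall>i. openin euclidean (X i)) \<and>
      finite {i. X i \<noteq> topspace euclidean} \<and> (\<Pi>\<^sub>E i\<in>UNIV. X i) \<subseteq> T"
    by (rule product_topology_open_contains_basis) (use assms T in auto)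
  then obtain X where X: "\<And>i. p i \<in> X i" "\<And>i. open (X i)" "finite {i. X i \<noteq> UNIV}" "(\<Pi>\<^sub>E i\<in>UNIV. X i) \<subseteq> T"
    by auto
  let ?C = "{i. X i \<noteq> UNIV} \<inter> jet_coords n"
  have "\<exists>e>0. \<forall>x. \<bar>x - p i\<bar> < e \<longrightarrow> x \<in> X i" for i
    using X(2)[of i] X(1)[of i] by (auto simp: open_dist dist_real_def)
  then obtain e where e: "\<And>i. e i > 0" "\<And>i x. \<bar>x - p i\<bar> < e i \<Longrightarrow> x \<in> X i" by metis
  define \<epsilon> where "\<epsilon> = Min (insert 1 (e ` ?C))"
  have fin: "finite ?C" using X(3) by simp
  have \<epsilon>: "\<epsilon> > 0" "\<And>i. i \<in> ?C \<Longrightarrow> \<epsilon> \<le> e i" using fin e(1) by (auto simp: \<epsilon>_def)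
  have "jet_box n ?C p \<epsilon> \<subseteq> V"
  proof
    fix q assume q: "q \<in> jet_box n ?C p \<epsilon>"
    have "q i \<in> X i" for i
    proof (cases "i \<in> jet_coords n")
      case True
      show ?thesis
      proof (cases "X i = UNIV")
        case False
        then have "\<bar>q i - p i\<bar> < e i" using True q \<epsilon>(2)[of i] by (force simp: jet_box_def)
        then show ?thesis by (rule e(2))
      qed simp
    next
      case False
      then have "q i = p i" using q assms T by (auto simp: jet_box_def jet_space_def)
      then show ?thesis using X(1) by simp
    qed
    then have "q \<in> T" using X(4) by auto
    then show "q \<in> V" using q T(2) by (auto simp: jet_box_def)
  qed
  with fin \<epsilon>(1) show thesis by (intro that[of ?C \<epsilon>]) auto
qed

lemma eventually_in_jet_open:
  fixes \<delta> :: "real \<Rightarrow> jet"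
  assumes "jet_open n V" "\<delta> t \<in> V" "\<And>\<tau>. \<delta> \<tau> \<in> jet_space n" "\<And>c. continuous_on UNIV (\<lambda>\<tau>. \<delta> \<tau> c)"
  shows "eventually (\<lambda>\<tau>. \<delta> \<tau> \<in> V) (nhds t)"
proof -
  from assms(1) obtain T where T: "open T" "V = jet_space n \<inter> T" by (auto simp: openin_open)
  have "continuous_on UNIV \<delta>" using assms(4) by (rule continuous_on_coordinatewise_then_product)
  then have "open (\<delta> -` T)" using T(1) by (simp add: open_vimage)
  moreover have "t \<in> \<delta> -` T" using assms(2) T(2) by simp
  ultimately have "eventually (\<lambda>\<tau>. \<tau> \<in> \<delta> -` T) (nhds t)" by (rule eventually_nhds_in_open)
  then show ?thesis by (rule eventually_mono) (use assms(3) T(2) in auto)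
qed

lemma jet_open_update:
  assumes "jet_open n V" "q \<in> V" "c \<in> jet_coords n"
  shows "eventually (\<lambda>v. q(c := v) \<in> V) (nhds (q c))"
proof (rule eventually_in_jet_open[OF assms(1)])
  show "q(c := \<tau>) \<in> jet_space n" for \<tau>
    using jet_open_subset[OF assms(1)] assms(2,3) by (auto simp: jet_space_def)
  show "continuous_on UNIV (\<lambda>\<tau>. (q(c := \<tau>)) d)" for d
    by (cases "d = c") (auto intro: continuous_intros)
qed (use assms in simp)

lemma jet_open_update_at:
  assumes "jet_open n V" "q \<in> V" "c \<in> jet_coords n"
  shows "eventually (\<lambda>v. q(c := v) \<in> V) (at (q c))"
  using jet_open_update[OF assms] by (simp add: eventually_nhds_conv_at)

text \<open>
  Unconditional convergence of a real series is absolute convergence. Evaluating the expansion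
  at the point whose coordinates in \<open>C\<close> are all moved by the same small \<open>\<rho>\<close> therefore bounds
  the norm of the coefficients at radius \<open>\<rho>\<close>.
\<close>

lemma differential_function_iff:
  assumes V: "jet_open n V"
  shows "differential_function n V f \<longleftrightarrow>
    (\<exists>C. finite C \<and> C \<subseteq> jet_coords n \<and> (\<forall>p\<in>V. analytic_at V p C f))"
    (is "_ \<longleftrightarrow> ?R")
proof
  assume "differential_function n V f"
  then obtain C where C: "finite C" "C \<subseteq> jet_coords n" and ser: "\<forall>p\<in>V. \<exists>a \<epsilon>. \<epsilon> > 0 \<and>
           (\<forall>q\<in>V. (\<forall>c\<in>C. \<bar>q c - p c\<bar> < \<epsilon>) \<longrightarrow>
              ((\<lambda>\<mu>. a \<mu> * (\<Prod>c\<in>C. (q c - p c) ^ \<mu> c)) has_sum f q) (multi_indices C))"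
    unfolding differential_function_def by (elim exE conjE) (rule that)
  have "analytic_at V p C f" if p: "p \<in> V" for p
  proof -
    obtain a \<epsilon> where \<epsilon>: "\<epsilon> > 0" and a: "\<And>q. q \<in> V \<Longrightarrow> (\<And>c. c \<in> C \<Longrightarrow> \<bar>q c - p c\<bar> < \<epsilon>) \<Longrightarrow>
              ((\<lambda>\<mu>. a \<mu> * monomial_at C (\<lambda>c. q c - p c) \<mu>) has_sum f q) (multi_indices C)"
    proof -
      assume *: "\<And>\<epsilon> a. \<epsilon> > 0 \<Longrightarrow> (\<And>q. q \<in> V \<Longrightarrow> (\<And>c. c \<in> C \<Longrightarrow> \<bar>q c - p c\<bar> < \<epsilon>) \<Longrightarrow>
          ((\<lambda>\<mu>. a \<mu> * monomial_at C (\<lambda>c. q c - p c) \<mu>) has_sum f q) (multi_indices C)) \<Longrightarrow> thesis"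
      from bspec[OF ser p] obtain a \<epsilon> where "\<epsilon> > 0" "\<forall>q\<in>V. (\<forall>c\<in>C. \<bar>q c - p c\<bar> < \<epsilon>) \<longrightarrow>
          ((\<lambda>\<mu>. a \<mu> * (\<Prod>c\<in>C. (q c - p c) ^ \<mu> c)) has_sum f q) (multi_indices C)" by blast
      then show thesis by (intro *[of \<epsilon> a]) (auto simp: monomial_at_def)
    qed
    define \<delta> where "\<delta> \<tau> = (\<lambda>c. if c \<in> C then p c + \<tau> else p c)" for \<tau> :: real
    have "eventually (\<lambda>\<tau>. \<delta> \<tau> \<in> V) (nhds 0)"
    proof (rule eventually_in_jet_open[OF V])
      have "\<delta> 0 = p" by (auto simp: \<delta>_def)
      then show "\<delta> 0 \<in> V" using p by simp
      show "\<delta> \<tau> \<in> jet_space n" for \<tau>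
        using jet_open_subset[OF V] p C(2) by (auto simp: jet_space_def \<delta>_def)
      show "continuous_on UNIV (\<lambda>\<tau>. \<delta> \<tau> c)" for c
        unfolding \<delta>_def by (cases "c \<in> C") (auto intro!: continuous_intros)
    qed
    then obtain d where d: "d > 0" "\<And>\<tau>. \<bar>\<tau>\<bar> < d \<Longrightarrow> \<delta> \<tau> \<in> V"
      by (auto simp: eventually_nhds_metric dist_real_def)
    define \<rho> where "\<rho> = min \<epsilon> d / 2"
    have \<rho>: "\<rho> > 0" "\<rho> < \<epsilon>" "\<rho> < d" using \<epsilon> d by (auto simp: \<rho>_def)
    have "((\<lambda>\<mu>. a \<mu> * monomial_at C (\<lambda>c. \<delta> \<rho> c - p c) \<mu>) has_sum f (\<delta> \<rho>)) (multi_indices C)"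
      by (rule a) (use d \<rho> in \<open>auto simp: \<delta>_def\<close>)
    moreover have "monomial_at C (\<lambda>c. \<delta> \<rho> c - p c) \<mu> = monomial_at C (\<lambda>_. \<rho>) \<mu>" for \<mu>
      unfolding monomial_at_def by (rule prod.cong) (auto simp: \<delta>_def)
    ultimately have "(\<lambda>\<mu>. a \<mu> * monomial_at C (\<lambda>_. \<rho>) \<mu>) summable_on multi_indices C"
      by (auto intro: has_sum_imp_summable)
    then have "(\<lambda>\<mu>. norm (a \<mu> * monomial_at C (\<lambda>_. \<rho>) \<mu>)) summable_on multi_indices C"
      unfolding summable_on_iff_abs_summable_on_real[symmetric] .
    moreover have "norm (a \<mu> * monomial_at C (\<lambda>_. \<rho>) \<mu>) = \<bar>a \<mu>\<bar> * monomial_at C (\<lambda>_. \<rho>) \<mu>" for \<mu>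
      using monomial_at_nonneg[of C "\<lambda>_. \<rho>" \<mu>] \<rho>(1) by (simp add: abs_mult)
    ultimately have "(\<lambda>\<mu>. \<bar>a \<mu>\<bar> * monomial_at C (\<lambda>_. \<rho>) \<mu>) summable_on multi_indices C" by simp
    then have "power_series_on V C p (\<lambda>_. \<rho>) f (\<Sum>\<^sub>\<infinity>\<mu>\<in>multi_indices C. \<bar>a \<mu>\<bar> * monomial_at C (\<lambda>_. \<rho>) \<mu>)"
      unfolding power_series_on_def using a \<rho>(2)
      by (intro exI[of _ a]) (force simp: in_box_def)
    with \<rho>(1) show ?thesis unfolding analytic_at_def by blast
  qed
  with C show ?R by blast
next
  assume ?R
  then obtain C where C: "finite C" "C \<subseteq> jet_coords n" "\<And>p. p \<in> V \<Longrightarrow> analytic_at V p C f" by blast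
  show "differential_function n V f" unfolding differential_function_def
  proof (intro exI[of _ C] conjI ballI C)
    fix p assume "p \<in> V"
    from C(3)[OF this] obtain \<rho> M where \<rho>: "\<rho> > 0" and ps: "power_series_on V C p (\<lambda>_. \<rho>) f M"
      by (auto simp: analytic_at_def)
    obtain a where "\<And>q. q \<in> V \<Longrightarrow> in_box C p (\<lambda>_. \<rho>) q \<Longrightarrow>
       ((\<lambda>\<mu>. a \<mu> * monomial_at C (\<lambda>c. q c - p c) \<mu>) has_sum f q) (multi_indices C)"
      by (rule power_series_onE[OF ps]) blast
    then show "\<exists>a \<epsilon>. \<epsilon> > 0 \<and>
           (\<forall>q\<in>V. (\<forall>c\<in>C. \<bar>q c - p c\<bar> < \<epsilon>) \<longrightarrow>
              ((\<lambda>\<mu>. a \<mu> * (\<Prod>c\<in>C. (q c - p c) ^ \<mu> c)) has_sum f q) (multi_indices C))"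
      using \<rho> unfolding monomial_at_def in_box_def
      by (intro exI[of _ a] exI[of _ \<rho>]) (auto simp: less_imp_le)
  qed
qed

lemma differential_functionE:
  assumes "differential_function n V f" "jet_open n V"
  obtains C where "finite C" "C \<subseteq> jet_coords n" "\<And>p. p \<in> V \<Longrightarrow> analytic_at V p C f"
  using assms by (auto simp: differential_function_iff)

lemma differential_functionI:
  assumes "jet_open n V" "finite C" "C \<subseteq> jet_coords n" "\<And>p. p \<in> V \<Longrightarrow> analytic_at V p C f"
  shows "differential_function n V f"
  using assms by (auto simp: differential_function_iff)

lemma differential_functionE2:
  assumes "differential_function n V f" "differential_function n V g" "jet_open n V"
  obtains C where "finite C" "C \<subseteq> jet_coords n" "\<And>p. p \<in> V \<Longrightarrow> analytic_at V p C f" "\<And>p. p \<in> V \<Longrightarrow> analytic_at V p C g"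
proof -
  obtain C where C: "finite C" "C \<subseteq> jet_coords n" "\<And>p. p \<in> V \<Longrightarrow> analytic_at V p C f"
    by (rule differential_functionE[OF assms(1,3)]) blast
  obtain C' where C': "finite C'" "C' \<subseteq> jet_coords n" "\<And>p. p \<in> V \<Longrightarrow> analytic_at V p C' g"
    by (rule differential_functionE[OF assms(2,3)]) blast
  show thesis
    by (rule that[of "C \<union> C'"])
      (use C C' in \<open>auto intro: analytic_at_superset[OF C(3)] analytic_at_superset[OF C'(3)]\<close>)
qed

lemma differential_function_subset:
  "differential_function n V f \<Longrightarrow> W \<subseteq> V \<Longrightarrow> differential_function n W f"
  unfolding differential_function_def by (meson subsetD)

lemma differential_function_cong:
  assumes "differential_function n V f" "\<And>q. q \<in> V \<Longrightarrow> f q = g q"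
  shows "differential_function n V g"
  using assms unfolding differential_function_def by simp

context
  fixes n :: nat and V :: "jet set"
  assumes V: "jet_open n V"
begin

lemma differential_function_const: "differential_function n V (\<lambda>_. k)"
  by (rule differential_functionI[OF V, of "{}"]) (auto intro: analytic_at_const)

lemma differential_function_coord: "differential_function n V (\<lambda>q. q c)"
proof (cases "c \<in> jet_coords n")
  case True
  then show ?thesis by (intro differential_functionI[OF V, of "{c}"]) (auto intro: analytic_at_coord)
next
  case False
  then have "q c = 0" if "q \<in> V" for q using that jet_open_subset[OF V] by (auto simp: jet_space_def)
  then show ?thesis by (intro differential_function_cong[OF differential_function_const[of 0]]) auto
qed

lemma differential_function_add:
  assumes "differential_function n V f" "differential_function n V g"
  shows "differential_function n V (\<lambda>q. f q + g q)"
proof -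
  obtain C where "finite C" "C \<subseteq> jet_coords n" "\<And>p. p \<in> V \<Longrightarrow> analytic_at V p C f" "\<And>p. p \<in> V \<Longrightarrow> analytic_at V p C g"
    by (rule differential_functionE2[OF assms V]) blast
  then show ?thesis by (intro differential_functionI[OF V, of C] analytic_at_add) auto
qed

lemma differential_function_mult:
  assumes "differential_function n V f" "differential_function n V g"
  shows "differential_function n V (\<lambda>q. f q * g q)"
proof -
  obtain C where "finite C" "C \<subseteq> jet_coords n" "\<And>p. p \<in> V \<Longrightarrow> analytic_at V p C f" "\<And>p. p \<in> V \<Longrightarrow> analytic_at V p C g"
    by (rule differential_functionE2[OF assms V]) blast
  then show ?thesis by (intro differential_functionI[OF V, of C] analytic_at_mult) auto
qed

lemma differential_function_diff:
  assumes "differential_function n V f" "differential_function n V g"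
  shows "differential_function n V (\<lambda>q. f q - g q)"
  using differential_function_add[OF assms(1) differential_function_mult[OF differential_function_const[of "-1"] assms(2)]]
  by simp

lemma differential_function_sum:
  "(\<And>k. k \<in> K \<Longrightarrow> differential_function n V (f k)) \<Longrightarrow> differential_function n V (\<lambda>q. \<Sum>k\<in>K. f k q)"
  by (induction K rule: infinite_finite_induct) (auto intro: differential_function_const differential_function_add)

text \<open>
  Sliced by \<open>c\<close>, the partial derivative is the termwise derivative of a power series in one
  variable; halving the radius compensates the factors that differentiation produces.
\<close>

lemma analytic_at_jet_partial:
  assumes C: "finite C" "C \<subseteq> jet_coords n" and c: "c \<in> jet_coords n"
    and f: "\<And>q. q \<in> V \<Longrightarrow> analytic_at V q C f" and p: "p \<in> V"
  shows "analytic_at V p C (jet_partial c f)"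
proof (cases "c \<in> C")
  case False
  have "eq_near V p C (\<lambda>_. 0) (jet_partial c f)" unfolding eq_near_def
  proof (intro exI[of _ 1] conjI ballI impI)
    fix q assume q: "q \<in> V"
    show "0 = jet_partial c f q"
      using jet_partial_indep[OF q jet_open_update_at[OF V q] f[OF q] C(1), where c = c] False c by simp
  qed simp
  then show ?thesis by (rule analytic_at_cong[OF analytic_at_const _ C(1)])
next
  case True
  obtain \<rho> M where \<rho>: "\<rho> > 0" and ps: "power_series_on V C p (\<lambda>_. \<rho>) f M"
    using f[OF p] by (auto simp: analytic_at_def)
  obtain A N where A: "\<And>k. power_series_on V (C - {c}) p (\<lambda>_. \<rho>) (A k) (N k)"
    and N: "(\<lambda>k. N k * \<rho> ^ k) summable_on UNIV"
    and fs: "\<And>q. q \<in> V \<Longrightarrow> in_box C p (\<lambda>_. \<rho>) q \<Longrightarrow> ((\<lambda>k. A k q * (q c - p c) ^ k) has_sum f q) (UNIV :: nat set)"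
    by (rule power_series_on_slice[OF ps True C(1) \<rho>]) blast
  have N0: "N k \<ge> 0" for k by (rule power_series_on_nonneg[OF A]) (use \<rho> in auto)
  have Nsum: "summable (\<lambda>k. N k * x ^ k)" if "norm x < \<rho>" for x
    by (rule powser_inside[OF summable_on_imp_summable[OF N]]) (use that \<rho> in auto)
  let ?r = "\<rho> / 2"
  have dN: "summable (\<lambda>k. diffs N k * ?r ^ k)"
    by (rule termdiff_converges[OF _ Nsum]) (use \<rho> in auto)
  have dN0: "diffs N k \<ge> 0" for k using N0 by (simp add: diffs_def)
  have dNs: "(\<lambda>k. diffs N k * ?r ^ k) summable_on UNIV"
    using dN dN0 \<rho> by (intro summable_nonneg_imp_summable_on) auto
  let ?A = "\<lambda>q k. A k q"
  have Ab: "\<bar>A k q\<bar> \<le> N k" if "q \<in> V" "in_box C p (\<lambda>_. \<rho>) q" for k q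
    by (rule power_series_on_bound[OF A that(1)]) (use that(2) in \<open>auto simp: in_box_def\<close>)
  have partial: "((\<lambda>k. diffs (?A q) k * (q c - p c) ^ k) has_sum jet_partial c f q) UNIV"
    if q: "q \<in> V" "in_box C p (\<lambda>_. ?r) q" for q
  proof -
    have qb: "in_box C p (\<lambda>_. \<rho>) q" using q(2) \<rho> by (force simp: in_box_def)
    have xr: "\<bar>q c - p c\<bar> \<le> ?r" using q(2) True by (auto simp: in_box_def)
    have "summable (\<lambda>k. A k q * \<rho> ^ k)"
      by (rule summable_comparison_test'[OF summable_on_imp_summable[OF N], of 0])
        (use Ab[OF q(1) qb] \<rho> in \<open>auto simp: abs_mult\<close>)
    then have D: "DERIV (\<lambda>x. \<Sum>k. A k q * x ^ k) (q c - p c) :> (\<Sum>k. diffs (?A q) k * (q c - p c) ^ k)"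
      by (rule termdiffs_strong) (use xr \<rho> in auto)
    have "DERIV (\<lambda>v. v - p c) (q c) :> 1" by (auto intro!: derivative_eq_intros)
    from DERIV_chain2[OF D this]
    have D': "DERIV (\<lambda>v. \<Sum>k. A k q * (v - p c) ^ k) (q c) :> (\<Sum>k. diffs (?A q) k * (q c - p c) ^ k)" by simp
    have "eventually (\<lambda>v. \<bar>v - q c\<bar> < ?r) (nhds (q c))"
      unfolding eventually_nhds_metric using \<rho> by (auto simp: dist_real_def intro!: exI[of _ ?r])
    with jet_open_update[OF V q(1) c]
    have "eventually (\<lambda>v. (\<Sum>k. A k q * (v - p c) ^ k) = f (q(c := v))) (nhds (q c))"
    proof eventually_elim
      case (elim v)
      have "\<bar>v - p c\<bar> \<le> \<rho>" using elim(2) xr by linarith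
      then have vb: "in_box C p (\<lambda>_. \<rho>) (q(c := v))" using qb by (auto simp: in_box_def)
      have "A k (q(c := v)) = A k q" for k
        by (rule power_series_on_depends[OF A elim(1) q(1)]) (use qb in \<open>auto simp: in_box_def\<close>)
      then show ?case using has_sum_imp_sums[OF fs[OF elim(1) vb]] by (simp add: sums_iff)
    qed
    from DERIV_cong_ev[OF refl this refl] D'
    have "DERIV (\<lambda>v. f (q(c := v))) (q c) :> (\<Sum>k. diffs (?A q) k * (q c - p c) ^ k)" by blast
    then have "jet_partial c f q = (\<Sum>k. diffs (?A q) k * (q c - p c) ^ k)"
      unfolding jet_partial_def by (rule DERIV_imp_deriv)
    moreover have "(\<lambda>k. diffs (?A q) k * (q c - p c) ^ k) summable_on UNIV"
    proof (rule summable_on_abs_comparison(1)[OF dNs])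
      fix k
      have "\<bar>diffs (?A q) k\<bar> \<le> diffs N k" using Ab[OF q(1) qb] by (simp add: diffs_def abs_mult)
      moreover have "\<bar>(q c - p c) ^ k\<bar> \<le> ?r ^ k" unfolding power_abs using xr by (rule power_mono) simp
      ultimately show "\<bar>diffs (?A q) k * (q c - p c) ^ k\<bar> \<le> diffs N k * ?r ^ k"
        unfolding abs_mult using dN0 by (intro mult_mono) auto
    qed
    ultimately show ?thesis
      using has_sum_infsum[of "\<lambda>k. diffs (?A q) k * (q c - p c) ^ k" UNIV]
        has_sum_imp_sums sums_unique by metis
  qed
  have half: "?r > 0" using \<rho> by simp
  have "power_series_on V C p (\<lambda>_. ?r) (jet_partial c f) (\<Sum>\<^sub>\<infinity>k. diffs N k * ?r ^ k)"
  proof (rule power_series_on_infsum[where K = UNIV and f = "\<lambda>k q. diffs (?A q) k * (q c - p c) ^ k", OF _ dNs])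
    fix k
    have "power_series_on V C p (\<lambda>_. ?r) (A (Suc k)) (N (Suc k))"
      by (rule power_series_on_superset[OF power_series_on_shrink[OF A] _ C(1)]) (use C \<rho> in auto)
    from power_series_on_mult[OF C(1) half power_series_on_cmult[OF this, of "of_nat (Suc k)"]
        power_series_on_power[OF C(1) half power_series_on_coord[OF C(1) half True]]]
    show "power_series_on V C p (\<lambda>_. ?r) (\<lambda>q. diffs (?A q) k * (q c - p c) ^ k) (diffs N k * ?r ^ k)"
      by (simp add: diffs_def)
  qed (use partial \<rho> in auto)
  then show ?thesis by (rule analytic_atI) (use C \<rho> in auto)
qed

end

section \<open>The total derivative\<close>

text \<open>
  The components of the vector field \<open>d_t\<close> at \<open>q\<close>.
\<close>

definition jet_velocity :: "jet \<Rightarrow> jet_coord \<Rightarrow> real" where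
  "jet_velocity q c = (case c of Time \<Rightarrow> 1 | Jet j k \<Rightarrow> q (Jet j (Suc k)))"

lemma analytic_at_curve:
  assumes C: "finite C" "C \<subseteq> J" and f: "analytic_at D p C f" and p: "p \<in> D"
    and nb: "\<And>c. c \<in> J \<Longrightarrow> eventually (\<lambda>v. p(c := v) \<in> D) (at (p c))"
    and \<delta>: "\<delta> t = p" "eventually (\<lambda>\<tau>. \<delta> \<tau> \<in> D) (at t)"
      "\<And>c. c \<in> C \<Longrightarrow> ((\<lambda>\<tau>. \<delta> \<tau> c) has_real_derivative v c) (at t)"
  shows "((\<lambda>\<tau>. f (\<delta> \<tau>)) has_real_derivative (\<Sum>c\<in>C. v c * jet_partial c f p)) (at t)"
proof -
  obtain \<rho> M where \<rho>: "\<rho> > 0" and ps: "power_series_on D C p (\<lambda>_. \<rho>) f M"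
    using f by (auto simp: analytic_at_def)
  obtain b where b: "\<And>\<delta> v t. \<delta> t = p \<Longrightarrow> eventually (\<lambda>\<tau>. \<delta> \<tau> \<in> D) (at t) \<Longrightarrow>
      (\<And>c. c \<in> C \<Longrightarrow> ((\<lambda>\<tau>. \<delta> \<tau> c) has_real_derivative v c) (at t)) \<Longrightarrow>
      ((\<lambda>\<tau>. f (\<delta> \<tau>)) has_real_derivative (\<Sum>c\<in>C. v c * b c)) (at (t :: real))"
    by (rule power_series_on_curve[OF C(1) ps \<rho> p]) blast
  have "jet_partial c f p = b c" if c: "c \<in> C" for c
  proof -
    have "((\<lambda>v. f (p(c := v))) has_real_derivative (\<Sum>d\<in>C. (if d = c then 1 else 0) * b d)) (at (p c))"
    proof (rule b[OF _ nb])
      show "((\<lambda>\<tau>. (p(c := \<tau>)) d) has_real_derivative (if d = c then 1 else 0)) (at (p c))" for d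
        by (cases "d = c") (auto intro: derivative_eq_intros)
    qed (use c C in auto)
    moreover have "(\<Sum>d\<in>C. (if d = c then 1 else 0) * b d) = b c"
      using c C(1) by (simp add: if_distrib[where f = "\<lambda>x. x * _"] cong: if_cong)
    ultimately show ?thesis unfolding jet_partial_def by (intro DERIV_imp_deriv) simp
  qed
  then show ?thesis using b[OF \<delta>] by (simp cong: sum.cong)
qed

lemma total_deriv_eq_sum:
  assumes V: "jet_open n V" and C: "finite C" "C \<subseteq> jet_coords n" and f: "analytic_at V q C f" and q: "q \<in> V"
  shows "total_deriv n f q = (\<Sum>c\<in>C. jet_velocity q c * jet_partial c f q)"
proof -
  have zero: "jet_partial c f q = 0" if "c \<in> jet_coords n - C" for c
    by (rule jet_partial_indep[OF q jet_open_update_at[OF V q] f C(1)]) (use that in auto)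
  let ?g = "\<lambda>(j, k). q (Jet j (Suc k)) * jet_partial (Jet j k) f q"
  let ?F = "{(j, k). Jet j k \<in> C}"
  have img: "case_prod Jet ` ?F = C - {Time}"
  proof -
    have "c \<in> case_prod Jet ` ?F" if "c \<in> C" "c \<noteq> Time" for c
      using that by (cases c) force+
    then show ?thesis by force
  qed
  have inj: "inj_on (case_prod Jet) ?F" by (auto simp: inj_on_def)
  have finF: "finite ?F" by (rule finite_imageD[OF _ inj]) (use img C in simp)
  have "(?g has_sum sum ?g ?F) ({..<n} \<times> UNIV)"
  proof (rule has_sum_finite_neutralI[OF finF])
    show "?F \<subseteq> {..<n} \<times> UNIV" using C(2) by (auto simp: jet_coords_def)
    fix x assume x: "x \<in> {..<n} \<times> (UNIV :: nat set) - ?F"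
    then have "case_prod Jet x \<in> jet_coords n - C" by (auto simp: jet_coords_def)
    from zero[OF this] show "?g x = 0" by (simp add: split_beta)
  qed simp
  then have "infsum ?g ({..<n} \<times> UNIV) = sum ?g ?F" by (rule infsumI)
  also have "\<dots> = (\<Sum>c\<in>C - {Time}. jet_velocity q c * jet_partial c f q)"
    unfolding img[symmetric] sum.reindex[OF inj] by (rule sum.cong) (auto simp: jet_velocity_def)
  finally have "total_deriv n f q = jet_partial Time f q + (\<Sum>c\<in>C - {Time}. jet_velocity q c * jet_partial c f q)"
    by (simp add: total_deriv_def)
  also have "\<dots> = (\<Sum>c\<in>C. jet_velocity q c * jet_partial c f q)"
  proof (cases "Time \<in> C")
    case True
    then show ?thesis using C(1) by (simp add: sum.remove jet_velocity_def)
  next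
    case False
    then show ?thesis using zero[of Time] by (simp add: jet_coords_def)
  qed
  finally show ?thesis .
qed

text \<open>
  A curve with velocity \<open>d_t\<close> at \<open>q\<close>. Only its first order contact matters, so a straight line
  serves, and rules for the total derivative reduce to rules for derivatives in one real
  variable.
\<close>

definition jet_line :: "nat \<Rightarrow> jet \<Rightarrow> real \<Rightarrow> jet" where
  "jet_line n q \<tau> = (\<lambda>c. if c \<in> jet_coords n then q c + \<tau> * jet_velocity q c else q c)"

lemma jet_line_0 [simp]: "jet_line n q 0 = q"
  by (auto simp: jet_line_def)

lemma jet_line_eventually:
  assumes "jet_open n V" "q \<in> V"
  shows "eventually (\<lambda>\<tau>. jet_line n q \<tau> \<in> V) (nhds 0)"
proof (rule eventually_in_jet_open[OF assms(1)])
  show "jet_line n q \<tau> \<in> jet_space n" for \<tau>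
    using jet_open_subset[OF assms(1)] assms(2) by (auto simp: jet_line_def jet_space_def)
  show "continuous_on UNIV (\<lambda>\<tau>. jet_line n q \<tau> c)" for c
    by (cases "c \<in> jet_coords n") (auto simp: jet_line_def intro!: continuous_intros)
qed (use assms in simp)

lemma total_deriv_along_line:
  assumes V: "jet_open n V" and f: "differential_function n V f" and q: "q \<in> V"
  shows "((\<lambda>\<tau>. f (jet_line n q \<tau>)) has_real_derivative total_deriv n f q) (at 0)"
proof -
  obtain C where C: "finite C" "C \<subseteq> jet_coords n" "\<And>p. p \<in> V \<Longrightarrow> analytic_at V p C f"
    by (rule differential_functionE[OF f V]) blast
  show ?thesis unfolding total_deriv_eq_sum[OF V C(1,2) C(3)[OF q] q]
  proof (rule analytic_at_curve[OF C(1,2) C(3)[OF q] q jet_open_update_at[OF V q]])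
    show "eventually (\<lambda>\<tau>. jet_line n q \<tau> \<in> V) (at 0)"
      using jet_line_eventually[OF V q] by (simp add: eventually_nhds_conv_at)
    show "((\<lambda>\<tau>. jet_line n q \<tau> c) has_real_derivative jet_velocity q c) (at 0)" if "c \<in> C" for c
    proof -
      have "c \<in> jet_coords n" using that C(2) by auto
      then show ?thesis by (auto simp: jet_line_def intro!: derivative_eq_intros)
    qed
  qed auto
qed

lemma total_deriv_unique:
  assumes "jet_open n V" "differential_function n V f" "q \<in> V"
    and "((\<lambda>\<tau>. f (jet_line n q \<tau>)) has_real_derivative d) (at 0)"
  shows "total_deriv n f q = d"
  using total_deriv_along_line[OF assms(1-3)] assms(4) by (rule DERIV_unique)

context
  fixes n :: nat and V :: "jet set"
  assumes V: "jet_open n V"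
begin

lemma differential_function_total_deriv:
  assumes f: "differential_function n V f"
  shows "differential_function n V (total_deriv n f)"
proof -
  obtain C where C: "finite C" "C \<subseteq> jet_coords n" "\<And>p. p \<in> V \<Longrightarrow> analytic_at V p C f"
    by (rule differential_functionE[OF f V]) blast
  have part: "differential_function n V (jet_partial c f)" if "c \<in> C" for c
    by (rule differential_functionI[OF V C(1,2)], rule analytic_at_jet_partial[OF V C(1,2) _ C(3)])
      (use that C in auto)
  have vel: "differential_function n V (\<lambda>q. jet_velocity q c)" for c
    by (cases c) (auto simp: jet_velocity_def intro: differential_function_const[OF V] differential_function_coord[OF V])
  have "differential_function n V (\<lambda>q. \<Sum>c\<in>C. jet_velocity q c * jet_partial c f q)"
    by (intro differential_function_sum[OF V] differential_function_mult[OF V] vel part)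
  then show ?thesis
    by (rule differential_function_cong) (simp add: total_deriv_eq_sum[OF V C(1,2) C(3)])
qed

lemma differential_function_iterated:
  "differential_function n V f \<Longrightarrow> differential_function n V ((total_deriv n ^^ k) f)"
  by (induction k) (auto intro: differential_function_total_deriv)

lemma total_deriv_cong:
  assumes f: "differential_function n V f" and eq: "\<And>q. q \<in> V \<Longrightarrow> f q = g q" and q: "q \<in> V"
  shows "total_deriv n g q = total_deriv n f q"
proof (rule total_deriv_unique[OF V differential_function_cong[OF f eq] q])
  have "eventually (\<lambda>\<tau>. f (jet_line n q \<tau>) = g (jet_line n q \<tau>)) (nhds 0)"
    using jet_line_eventually[OF V q] by (rule eventually_mono) (rule eq)
  from DERIV_cong_ev[OF refl this refl] total_deriv_along_line[OF V f q]
  show "((\<lambda>\<tau>. g (jet_line n q \<tau>)) has_real_derivative total_deriv n f q) (at 0)" by blast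
qed

lemma iterated_cong:
  assumes f: "differential_function n V f" and eq: "\<And>q. q \<in> V \<Longrightarrow> f q = g q" and q: "q \<in> V"
  shows "(total_deriv n ^^ k) g q = (total_deriv n ^^ k) f q"
  using q
proof (induction k arbitrary: q)
  case 0 then show ?case using eq by simp
next
  case (Suc k)
  show ?case using total_deriv_cong[OF differential_function_iterated[OF f, of k] _ Suc.prems, of "(total_deriv n ^^ k) g"]
      Suc.IH by simp
qed

lemma total_deriv_add:
  assumes "differential_function n V f" "differential_function n V g" "q \<in> V"
  shows "total_deriv n (\<lambda>q. f q + g q) q = total_deriv n f q + total_deriv n g q"
  by (rule total_deriv_unique[OF V differential_function_add[OF V assms(1,2)] assms(3)])
    (rule derivative_intros total_deriv_along_line[OF V] assms)+

lemma total_deriv_diff: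
  assumes "differential_function n V f" "differential_function n V g" "q \<in> V"
  shows "total_deriv n (\<lambda>q. f q - g q) q = total_deriv n f q - total_deriv n g q"
  by (rule total_deriv_unique[OF V differential_function_diff[OF V assms(1,2)] assms(3)])
    (rule derivative_intros total_deriv_along_line[OF V] assms)+

lemma total_deriv_mult:
  assumes "differential_function n V f" "differential_function n V g" "q \<in> V"
  shows "total_deriv n (\<lambda>q. f q * g q) q = total_deriv n f q * g q + f q * total_deriv n g q"
proof (rule total_deriv_unique[OF V differential_function_mult[OF V assms(1,2)] assms(3)])
  show "((\<lambda>\<tau>. f (jet_line n q \<tau>) * g (jet_line n q \<tau>)) has_real_derivative
      total_deriv n f q * g q + f q * total_deriv n g q) (at 0)"
    using DERIV_mult[OF total_deriv_along_line[OF V assms(1,3)] total_deriv_along_line[OF V assms(2,3)]]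
    by (simp add: mult.commute)
qed

lemma iterated_add:
  assumes f: "differential_function n V f" and g: "differential_function n V g" and q: "q \<in> V"
  shows "(total_deriv n ^^ k) (\<lambda>q. f q + g q) q = (total_deriv n ^^ k) f q + (total_deriv n ^^ k) g q"
  using q
proof (induction k arbitrary: q)
  case (Suc k)
  note d = differential_function_iterated[OF f, of k] differential_function_iterated[OF g, of k]
  show ?case
    using total_deriv_cong[OF differential_function_add[OF V d] _ Suc.prems,
        of "(total_deriv n ^^ k) (\<lambda>q. f q + g q)"] Suc.IH total_deriv_add[OF d Suc.prems] by simp
qed simp

lemma iterated_diff:
  assumes f: "differential_function n V f" and g: "differential_function n V g" and q: "q \<in> V"
  shows "(total_deriv n ^^ k) (\<lambda>q. f q - g q) q = (total_deriv n ^^ k) f q - (total_deriv n ^^ k) g q"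
  using q
proof (induction k arbitrary: q)
  case (Suc k)
  note d = differential_function_iterated[OF f, of k] differential_function_iterated[OF g, of k]
  show ?case
    using total_deriv_cong[OF differential_function_diff[OF V d] _ Suc.prems,
        of "(total_deriv n ^^ k) (\<lambda>q. f q - g q)"] Suc.IH total_deriv_diff[OF d Suc.prems] by simp
qed simp

text \<open>
  The functions all of whose total derivatives vanish at a point form an ideal. Hence two
  systems that generate the same algebraic ideal define the same diffiety.
\<close>

lemma iterated_mult_vanish:
  assumes "differential_function n V f" "differential_function n V g" and q: "q \<in> V"
    and "\<And>k. (total_deriv n ^^ k) g q = 0"
  shows "(total_deriv n ^^ k) (\<lambda>q. f q * g q) q = 0"
  using assms(1,2,4)
proof (induction k arbitrary: f g)
  case 0 then show ?case using "0.prems"(3)[of 0] by simp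
next
  case (Suc k)
  note f = Suc.prems(1) and g = Suc.prems(2)
  have g': "(total_deriv n ^^ k) (total_deriv n g) q = 0" for k
    using Suc.prems(3)[of "Suc k"] by (simp add: funpow_swap1)
  note df = differential_function_total_deriv[OF f] and dg = differential_function_total_deriv[OF g]
  note m1 = differential_function_mult[OF V df g] and m2 = differential_function_mult[OF V f dg]
  have "(total_deriv n ^^ Suc k) (\<lambda>q. f q * g q) q = (total_deriv n ^^ k) (total_deriv n (\<lambda>q. f q * g q)) q"
    by (simp add: funpow_swap1)
  also have "\<dots> = (total_deriv n ^^ k) (\<lambda>q. total_deriv n f q * g q + f q * total_deriv n g q) q"
    by (rule iterated_cong[OF differential_function_add[OF V m1 m2] _ q]) (simp add: total_deriv_mult[OF f g])
  also have "\<dots> = 0"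
    using iterated_add[OF m1 m2 q] Suc.IH[OF df g Suc.prems(3)] Suc.IH[OF f dg g'] by simp
  finally show ?case .
qed

lemma iterated_zero: "q \<in> V \<Longrightarrow> (total_deriv n ^^ k) (\<lambda>_. 0) q = 0"
proof (induction k arbitrary: q)
  case (Suc k)
  have z: "differential_function n V (\<lambda>_. 0)" by (rule differential_function_const[OF V])
  have "total_deriv n (\<lambda>_. 0) q = 0" if "q \<in> V" for q
    by (rule total_deriv_unique[OF V z that]) simp
  then show ?case
    using total_deriv_cong[OF z _ Suc.prems, of "(total_deriv n ^^ k) (\<lambda>_. 0)"] Suc by simp
qed simp

lemma iterated_ideal_vanish:
  assumes "finite I" "\<And>i. i \<in> I \<Longrightarrow> differential_function n V (Q i)" "\<And>i. i \<in> I \<Longrightarrow> differential_function n V (P i)"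
    and q: "q \<in> V" and "\<And>i k. i \<in> I \<Longrightarrow> (total_deriv n ^^ k) (P i) q = 0"
    and eq: "\<And>x. x \<in> V \<Longrightarrow> f x = (\<Sum>i\<in>I. Q i x * P i x)"
  shows "(total_deriv n ^^ k) f q = 0"
proof -
  have "(total_deriv n ^^ k) (\<lambda>x. \<Sum>i\<in>I. Q i x * P i x) q = 0"
    using assms(1,2,3,5)
  proof (induction I)
    case empty then show ?case using iterated_zero[OF q] by simp
  next
    case (insert i I)
    have "differential_function n V (\<lambda>x. Q i x * P i x)"
      by (intro differential_function_mult[OF V]) (use insert.prems in auto)
    moreover have "differential_function n V (\<lambda>x. \<Sum>i\<in>I. Q i x * P i x)"
      by (intro differential_function_sum[OF V] differential_function_mult[OF V]) (use insert.prems in auto)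
    moreover have "(total_deriv n ^^ k) (\<lambda>x. Q i x * P i x) q = 0"
      by (rule iterated_mult_vanish[OF _ _ q]) (use insert.prems in auto)
    moreover have "(total_deriv n ^^ k) (\<lambda>x. \<Sum>i\<in>I. Q i x * P i x) q = 0"
      by (rule insert.IH) (use insert.prems in auto)
    ultimately show ?case using insert.hyps iterated_add[OF _ _ q] by simp
  qed
  moreover have "differential_function n V (\<lambda>x. \<Sum>i\<in>I. Q i x * P i x)"
    by (intro differential_function_sum[OF V] differential_function_mult[OF V]) (use assms in auto)
  ultimately show ?thesis using iterated_cong[OF _ _ q, of "\<lambda>x. \<Sum>i\<in>I. Q i x * P i x" f] eq by simp
qed

lemma iterated_coord:
  assumes "q \<in> V" "j < n"
  shows "(total_deriv n ^^ k) (\<lambda>q. q (Jet j 0)) q = q (Jet j k)"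
  using assms(1)
proof (induction k arbitrary: q)
  case (Suc k)
  have c: "differential_function n V (\<lambda>q. q (Jet j k))" by (rule differential_function_coord[OF V])
  have "total_deriv n (\<lambda>q. q (Jet j k)) q = q (Jet j (Suc k))"
    by (rule total_deriv_unique[OF V c Suc.prems])
      (use assms(2) in \<open>auto simp: jet_line_def jet_coords_def jet_velocity_def intro!: derivative_eq_intros\<close>)
  then show ?case using total_deriv_cong[OF c _ Suc.prems, of "(total_deriv n ^^ k) (\<lambda>q. q (Jet j 0))"] Suc by simp
qed simp

end

lemma depends_only_partial_zero:
  assumes V: "jet_open n V" and dep: "depends_only_on V f S" and q: "q \<in> V" and c: "c \<in> jet_coords n - S"
  shows "jet_partial c f q = 0"
proof -
  have ev: "eventually (\<lambda>v. f (q(c := v)) = f q) (nhds (q c))"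
    using jet_open_update[OF V q, of c] c
    by (auto elim!: eventually_mono intro!: dep[unfolded depends_only_on_def, rule_format] q)
  have "((\<lambda>v. f (q(c := v))) has_real_derivative 0) (at (q c))"
    using DERIV_cong_ev[OF refl ev, of 0 0] by simp
  then show ?thesis unfolding jet_partial_def by (rule DERIV_imp_deriv)
qed

lemma differential_function_continuous_on:
  assumes V: "jet_open n V" and f: "differential_function n V f"
  shows "continuous_on V f"
proof -
  obtain C where C: "finite C" "C \<subseteq> jet_coords n" "\<And>p. p \<in> V \<Longrightarrow> analytic_at V p C f"
    by (rule differential_functionE[OF f V]) blast
  have "(f \<longlongrightarrow> f p) (at p within V)" if p: "p \<in> V" for p
  proof -
    obtain \<rho> M where \<rho>: "\<rho> > 0" and ps: "power_series_on V C p (\<lambda>_. \<rho>) f M"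
      using C(3)[OF p] by (auto simp: analytic_at_def)
    show ?thesis
    proof (rule power_series_on_tendsto[OF C(1) ps \<rho> p])
      show "((\<lambda>q. q c) \<longlongrightarrow> p c) (at p within V)" for c
        using continuous_on_subset[OF continuous_on_product_coordinates[of c] subset_UNIV, of V] p
        by (simp add: continuous_on_def)
      show "eventually (\<lambda>q. q \<in> V) (at p within V)" by (simp add: eventually_at_filter)
    qed
  qed
  then show ?thesis by (simp add: continuous_on_def)
qed

lemma jet_open_vimage:
  assumes B: "jet_open m B" and V: "jet_open n V"
    and \<psi>: "\<And>c. differential_function m B (\<lambda>w. \<psi> w c)" and sp: "\<And>w. w \<in> B \<Longrightarrow> \<psi> w \<in> jet_space n"
  shows "jet_open m {w\<in>B. \<psi> w \<in> V}"
proof -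
  have cont: "continuous_on B \<psi>"
    by (rule continuous_on_coordinatewise_then_product) (rule differential_function_continuous_on[OF B \<psi>])
  have "openin (top_of_set B) (B \<inter> \<psi> -` V)"
    by (rule continuous_openin_preimage[OF cont _ V]) (use sp in auto)
  moreover have "B \<inter> \<psi> -` V = {w\<in>B. \<psi> w \<in> V}" by auto
  ultimately show ?thesis using B openin_trans by metis
qed

lemma analytic_at_comp:
  assumes C: "finite C" and f: "analytic_at V (\<psi> w) C f" and C': "finite C'" and w: "w \<in> B"
    and \<psi>: "\<And>c. c \<in> C \<Longrightarrow> analytic_at B w C' (\<lambda>w. \<psi> w c)" and sub: "\<And>w. w \<in> B \<Longrightarrow> \<psi> w \<in> V"
  shows "analytic_at B w C' (\<lambda>w. f (\<psi> w))"
proof -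
  obtain \<rho> M where \<rho>: "\<rho> > 0" and ps: "power_series_on V C (\<psi> w) (\<lambda>_. \<rho>) f M"
    using f by (auto simp: analytic_at_def)
  have "\<exists>\<sigma>>0. power_series_on B C' w (\<lambda>_. \<sigma>) (\<lambda>x. \<psi> x c - \<psi> w c) \<rho>" if c: "c \<in> C" for c
  proof -
    have "analytic_at B w C' (\<lambda>x. \<psi> x c - \<psi> w c)"
      by (intro analytic_at_diff analytic_at_const \<psi> c C')
    then obtain \<sigma> N where \<sigma>: "\<sigma> > 0" and N: "power_series_on B C' w (\<lambda>_. \<sigma>) (\<lambda>x. \<psi> x c - \<psi> w c) N"
      by (auto simp: analytic_at_def)
    have "N \<ge> 0" using power_series_on_nonneg[OF N] \<sigma> by simp
    then have k: "real (card C') * N \<ge> 0" by simp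
    define t where "t = min 1 (\<rho> / (real (card C') * N + 1))"
    have t: "0 < t" "t \<le> 1" using \<rho> k by (auto simp: t_def)
    have "t * (real (card C') * N) \<le> \<rho> / (real (card C') * N + 1) * (real (card C') * N)"
      using k by (intro mult_right_mono) (auto simp: t_def)
    also have "\<dots> \<le> \<rho>" using k \<rho> by (simp add: field_simps)
    finally have le: "t * (real (card C') * N) \<le> \<rho>" .
    have "power_series_on B C' w (\<lambda>_. t * \<sigma>) (\<lambda>x. \<psi> x c - \<psi> w c) \<rho>"
      by (rule power_series_on_cong[OF power_series_on_small[OF C' N \<sigma> w _ t] le]) auto
    then show ?thesis using t \<sigma> by (intro exI[of _ "t * \<sigma>"]) auto
  qed
  then obtain \<sigma> where \<sigma>: "\<And>c. c \<in> C \<Longrightarrow> \<sigma> c > 0"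
    "\<And>c. c \<in> C \<Longrightarrow> power_series_on B C' w (\<lambda>_. \<sigma> c) (\<lambda>x. \<psi> x c - \<psi> w c) \<rho>" by metis
  define s where "s = Min (insert 1 (\<sigma> ` C))"
  have s: "s > 0" "\<And>c. c \<in> C \<Longrightarrow> s \<le> \<sigma> c" using C \<sigma>(1) by (auto simp: s_def)
  have "power_series_on B C' w (\<lambda>_. s) (\<lambda>w. f (\<psi> w)) M"
    by (rule power_series_on_comp[OF ps C s(1) C', where N = "\<lambda>_. \<rho>"])
      (use s \<sigma> sub in \<open>auto intro: power_series_on_shrink[OF \<sigma>(2) C']\<close>)
  then show ?thesis using s(1) by (auto simp: analytic_at_def)
qed

lemma differential_function_comp:
  assumes B: "jet_open m B" and V: "jet_open n V" and f: "differential_function n V f"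
    and \<psi>: "\<And>c. differential_function m B (\<lambda>w. \<psi> w c)" and sub: "\<And>w. w \<in> B \<Longrightarrow> \<psi> w \<in> V"
  shows "differential_function m B (\<lambda>w. f (\<psi> w))"
proof -
  obtain C where C: "finite C" "C \<subseteq> jet_coords n" "\<And>p. p \<in> V \<Longrightarrow> analytic_at V p C f"
    by (rule differential_functionE[OF f V]) blast
  have "\<exists>K. finite K \<and> K \<subseteq> jet_coords m \<and> (\<forall>w\<in>B. analytic_at B w K (\<lambda>w. \<psi> w c))" for c
    using \<psi>[of c] unfolding differential_function_iff[OF B] .
  then obtain K where K: "\<And>c. finite (K c)" "\<And>c. K c \<subseteq> jet_coords m"
    "\<And>c w. w \<in> B \<Longrightarrow> analytic_at B w (K c) (\<lambda>w. \<psi> w c)" by metis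
  let ?C = "\<Union>c\<in>C. K c"
  have fin: "finite ?C" using C K by auto
  show ?thesis
  proof (rule differential_functionI[OF B fin])
    show "?C \<subseteq> jet_coords m" using K by auto
    fix w assume w: "w \<in> B"
    show "analytic_at B w ?C (\<lambda>w. f (\<psi> w))"
      by (rule analytic_at_comp[where \<psi> = \<psi> and w = w and V = V, OF C(1) C(3)[OF sub[OF w]] fin w _ sub])
        (use K w fin in \<open>auto intro: analytic_at_superset[OF K(3)]\<close>)
  qed
qed

text \<open>
  The map \<open>\<psi>\<close> has to respect the derivation on the coordinates \<open>S\<close> that enter into \<open>f\<close>, but
  may freeze the others; the stages of the lift in the proof of flatness are of this kind.
\<close>

lemma total_deriv_chain:
  assumes B: "jet_open m B" and V: "jet_open n V" and f: "differential_function n V f"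
    and S: "depends_only_on V f S"
    and \<psi>: "\<And>c. differential_function m B (\<lambda>w. \<psi> w c)" and sub: "\<And>w. w \<in> B \<Longrightarrow> \<psi> w \<in> V"
    and w: "w \<in> B"
    and vel: "\<And>c. c \<in> S \<inter> jet_coords n \<Longrightarrow> total_deriv m (\<lambda>w. \<psi> w c) w = jet_velocity (\<psi> w) c"
  shows "total_deriv m (\<lambda>w. f (\<psi> w)) w = total_deriv n f (\<psi> w)"
proof -
  obtain C where C: "finite C" "C \<subseteq> jet_coords n" "\<And>p. p \<in> V \<Longrightarrow> analytic_at V p C f"
    by (rule differential_functionE[OF f V]) blast
  have D: "((\<lambda>\<tau>. f (\<psi> (jet_line m w \<tau>))) has_real_derivative
      (\<Sum>c\<in>C. total_deriv m (\<lambda>w. \<psi> w c) w * jet_partial c f (\<psi> w))) (at 0)"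
  proof (rule analytic_at_curve[OF C(1,2) C(3)[OF sub[OF w]] sub[OF w] jet_open_update_at[OF V sub[OF w]]])
    show "eventually (\<lambda>\<tau>. \<psi> (jet_line m w \<tau>) \<in> V) (at 0)"
      using jet_line_eventually[OF B w] by (auto simp: eventually_nhds_conv_at sub elim: eventually_mono)
  qed (use total_deriv_along_line[OF B \<psi> w] in auto)
  have "total_deriv m (\<lambda>w. f (\<psi> w)) w = (\<Sum>c\<in>C. total_deriv m (\<lambda>w. \<psi> w c) w * jet_partial c f (\<psi> w))"
    by (rule total_deriv_unique[OF B differential_function_comp[where \<psi> = \<psi>, OF B V f \<psi> sub] w D])
  also have "\<dots> = (\<Sum>c\<in>C. jet_velocity (\<psi> w) c * jet_partial c f (\<psi> w))"
  proof (rule sum.cong[OF refl])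
    fix c assume c: "c \<in> C"
    show "total_deriv m (\<lambda>w. \<psi> w c) w * jet_partial c f (\<psi> w) = jet_velocity (\<psi> w) c * jet_partial c f (\<psi> w)"
    proof (cases "c \<in> S")
      case True
      then show ?thesis using vel[of c] c C(2) by auto
    next
      case False
      then have "jet_partial c f (\<psi> w) = 0"
        using depends_only_partial_zero[OF V S sub[OF w], of c] c C(2) by auto
      then show ?thesis by simp
    qed
  qed
  also have "\<dots> = total_deriv n f (\<psi> w)"
    using total_deriv_eq_sum[OF V C(1,2) C(3)[OF sub[OF w]] sub[OF w]] by simp
  finally show ?thesis .
qed

lemma depends_only_total_deriv:
  assumes V: "jet_open n V" and f: "differential_function n V f" and S: "depends_only_on V f S"
    and closed: "\<And>j k. Jet j k \<in> S \<Longrightarrow> Jet j (Suc k) \<in> S"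
  shows "depends_only_on V (total_deriv n f) S"
  unfolding depends_only_on_def
proof (intro ballI impI)
  fix p q assume p: "p \<in> V" and q: "q \<in> V" and eq: "\<forall>c\<in>S. p c = q c"
  obtain C where C: "finite C" "C \<subseteq> jet_coords n" "\<And>p. p \<in> V \<Longrightarrow> analytic_at V p C f"
    by (rule differential_functionE[OF f V]) blast
  have "jet_velocity p c * jet_partial c f p = jet_velocity q c * jet_partial c f q" if c: "c \<in> C" for c
  proof (cases "c \<in> S")
    case True
    have cn: "c \<in> jet_coords n" using c C by auto
    have pq: "p c = q c" using True eq by simp
    have "eventually (\<lambda>v. f (p(c := v)) = f (q(c := v))) (nhds (p c))"
      using jet_open_update[OF V p cn] jet_open_update[OF V q cn, folded pq]
    proof eventually_elim
      case (elim v)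
      show ?case by (rule S[unfolded depends_only_on_def, rule_format, OF elim]) (use eq in auto)
    qed
    then have "jet_partial c f p = jet_partial c f q"
      unfolding jet_partial_def pq[symmetric] by (intro deriv_cong_ev) auto
    moreover have "jet_velocity p c = jet_velocity q c"
      using eq closed True by (cases c) (auto simp: jet_velocity_def)
    ultimately show ?thesis by simp
  next
    case False
    then show ?thesis
      using depends_only_partial_zero[OF V S p, of c] depends_only_partial_zero[OF V S q, of c] c C(2) by auto
  qed
  then show "total_deriv n f p = total_deriv n f q"
    using total_deriv_eq_sum[OF V C(1,2) C(3)[OF p] p] total_deriv_eq_sum[OF V C(1,2) C(3)[OF q] q]
    by (simp cong: sum.cong)
qed

section \<open>Jacobi numbers and truncated determinants\<close>

lemma det_nonzero_imp_permutation:
  fixes A :: "'a :: idom mat"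
  assumes "A \<in> carrier_mat s s" "det A \<noteq> 0"
  obtains \<pi> where "\<pi> permutes {0..<s}" "\<And>i. i < s \<Longrightarrow> A $$ (i, \<pi> i) \<noteq> 0"
proof -
  obtain \<pi> where "\<pi> permutes {0..<s}" "signof \<pi> * (\<Prod>i = 0..<s. A $$ (i, \<pi> i)) \<noteq> 0"
    using assms(2) sum.not_neutral_contains_not_neutral unfolding det_def'[OF assms(1)] by blast
  then show thesis using that by auto
qed

text \<open>
  In a nonzero term of the Leibniz formula all inequalities between levels are equalities,
  because both sides have the same sum. So a block triangular matrix, in a form that needs no
  reordering of rows and columns, has the determinant of its diagonal blocks.
\<close>

lemma det_level_diagonal:
  fixes A :: "'a :: idom mat" and \<alpha> \<gamma> :: "nat \<Rightarrow> nat"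
  assumes A: "A \<in> carrier_mat s s"
    and level: "\<And>i k. i < s \<Longrightarrow> k < s \<Longrightarrow> A $$ (i, k) \<noteq> 0 \<Longrightarrow> \<gamma> k \<le> \<alpha> i"
    and sum: "(\<Sum>i<s. \<alpha> i) = (\<Sum>i<s. \<gamma> i)"
  shows "det A = det (mat s s (\<lambda>(i, k). if \<gamma> k = \<alpha> i then A $$ (i, k) else 0))"
proof -
  let ?B = "mat s s (\<lambda>(i, k). if \<gamma> k = \<alpha> i then A $$ (i, k) else 0)"
  have B: "?B \<in> carrier_mat s s" by simp
  have "(\<Prod>i = 0..<s. A $$ (i, \<pi> i)) = (\<Prod>i = 0..<s. ?B $$ (i, \<pi> i))" if \<pi>: "\<pi> permutes {0..<s}" for \<pi>
  proof (cases "\<forall>i\<in>{0..<s}. A $$ (i, \<pi> i) \<noteq> 0")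
    case True
    have in_s: "\<pi> i < s" if "i < s" for i using permutes_in_image[OF \<pi>, of i] that by simp
    have le: "\<gamma> (\<pi> i) \<le> \<alpha> i" if "i \<in> {0..<s}" for i using True level in_s that by auto
    have "(\<Sum>i\<in>{0..<s}. \<gamma> (\<pi> i)) = (\<Sum>i\<in>{0..<s}. \<gamma> i)"
      using sum.permute[OF \<pi>, of \<gamma>] by (simp add: o_def)
    with sum have eq: "(\<Sum>i\<in>{0..<s}. \<gamma> (\<pi> i)) = (\<Sum>i\<in>{0..<s}. \<alpha> i)" by (simp add: lessThan_atLeast0)
    have "\<gamma> (\<pi> i) = \<alpha> i" if i: "i \<in> {0..<s}" for i
    proof (rule ccontr)
      assume "\<gamma> (\<pi> i) \<noteq> \<alpha> i"
      then have "\<gamma> (\<pi> i) < \<alpha> i" using le[OF i] by simp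
      then have "(\<Sum>i\<in>{0..<s}. \<gamma> (\<pi> i)) < (\<Sum>i\<in>{0..<s}. \<alpha> i)"
        using le i by (intro sum_strict_mono_ex1) auto
      with eq show False by simp
    qed
    then show ?thesis using in_s by (intro prod.cong) auto
  next
    case False
    then obtain i where i: "i \<in> {0..<s}" "A $$ (i, \<pi> i) = 0" by blast
    then have B0: "?B $$ (i, \<pi> i) = 0" using permutes_in_image[OF \<pi>, of i] by auto
    have "(\<Prod>i = 0..<s. A $$ (i, \<pi> i)) = 0" by (rule prod_zero) (use i in blast)+
    also have "\<dots> = (\<Prod>i = 0..<s. ?B $$ (i, \<pi> i))" by (rule sym, rule prod_zero) (use i B0 in blast)+
    finally show ?thesis .
  qed
  then show ?thesis unfolding det_def'[OF A] det_def'[OF B] by (intro sum.cong) auto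
qed

lemma coeff_prod_sum:
  fixes f :: "'i \<Rightarrow> 'a :: comm_ring_1 poly"
  assumes "finite I" "\<And>i. i \<in> I \<Longrightarrow> degree (f i) \<le> e i"
  shows "degree (prod f I) \<le> sum e I \<and> coeff (prod f I) (sum e I) = (\<Prod>i\<in>I. coeff (f i) (e i))"
  using assms
proof (induction I)
  case (insert i I)
  have two: "coeff (p * q) (m + n) = coeff p m * coeff q n" if "degree p \<le> m" "degree q \<le> n" for p q :: "'a poly" and m n
  proof -
    have "coeff (p * q) (m + n) = (\<Sum>k\<le>m + n. coeff p k * coeff q (m + n - k))" by (rule coeff_mult)
    also have "\<dots> = (\<Sum>k\<in>{m}. coeff p k * coeff q (m + n - k))"
    proof (rule sum.mono_neutral_right)
      show "\<forall>k\<in>{..m + n} - {m}. coeff p k * coeff q (m + n - k) = 0"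
      proof
        fix k assume k: "k \<in> {..m + n} - {m}"
        show "coeff p k * coeff q (m + n - k) = 0"
        proof (cases "k < m")
          case True
          then have "coeff q (m + n - k) = 0" using that(2) by (intro coeff_eq_0) auto
          then show ?thesis by simp
        next
          case False
          then have "coeff p k = 0" using that(1) k by (intro coeff_eq_0) auto
          then show ?thesis by simp
        qed
      qed
    qed auto
    finally show ?thesis by simp
  qed
  have I: "degree (prod f I) \<le> sum e I" "coeff (prod f I) (sum e I) = (\<Prod>i\<in>I. coeff (f i) (e i))"
    using insert by auto
  have "degree (f i * prod f I) \<le> e i + sum e I"
    using degree_mult_le[of "f i" "prod f I"] I(1) insert.prems[of i] by simp
  then show ?case using two[OF insert.prems[of i] I(1)] I(2) insert.hyps by simp
qed simp

lemma coeff_signof_mult: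
  "coeff (signof \<pi> * p) k = signof \<pi> * coeff (p :: 'a :: comm_ring_1 poly) k"
  by (cases "evenperm \<pi>") (simp_all add: sign_def)

text \<open>
  When the degrees of the entries are covered by \<open>\<alpha> i + \<beta> k\<close>, the coefficient of the
  determinant in the degree \<open>\<Sum> \<alpha> + \<Sum> \<beta>\<close> collects the top coefficients only. For the linearized
  system this coefficient is Jacobi's truncated determinant.
\<close>

lemma coeff_det_weighted:
  fixes A :: "real poly mat" and \<alpha> \<beta> :: "nat \<Rightarrow> int"
  assumes A: "A \<in> carrier_mat s s"
    and deg: "\<And>i k l. i < s \<Longrightarrow> k < s \<Longrightarrow> coeff (A $$ (i, k)) l \<noteq> 0 \<Longrightarrow> int l \<le> \<alpha> i + \<beta> k"
    and pos: "0 \<le> (\<Sum>i<s. \<alpha> i) + (\<Sum>i<s. \<beta> i)"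
  shows "coeff (det A) (nat ((\<Sum>i<s. \<alpha> i) + (\<Sum>i<s. \<beta> i))) =
    det (mat s s (\<lambda>(i, k). if 0 \<le> \<alpha> i + \<beta> k then coeff (A $$ (i, k)) (nat (\<alpha> i + \<beta> k)) else 0))"
proof -
  let ?B = "mat s s (\<lambda>(i, k). if 0 \<le> \<alpha> i + \<beta> k then coeff (A $$ (i, k)) (nat (\<alpha> i + \<beta> k)) else 0)"
  let ?O = "nat ((\<Sum>i<s. \<alpha> i) + (\<Sum>i<s. \<beta> i))"
  have B: "?B \<in> carrier_mat s s" by simp
  have prod: "coeff (\<Prod>i = 0..<s. A $$ (i, \<pi> i)) ?O = (\<Prod>i = 0..<s. ?B $$ (i, \<pi> i))"
    if \<pi>: "\<pi> permutes {0..<s}" for \<pi>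
  proof (cases "\<forall>i\<in>{0..<s}. 0 \<le> \<alpha> i + \<beta> (\<pi> i)")
    case True
    have in_s: "\<pi> i < s" if "i < s" for i using permutes_in_image[OF \<pi>, of i] that by simp
    define e where "e i = nat (\<alpha> i + \<beta> (\<pi> i))" for i
    have "degree (A $$ (i, \<pi> i)) \<le> e i" if "i \<in> {0..<s}" for i
      using deg[of i "\<pi> i"] in_s[of i] that True by (intro degree_le) (force simp: e_def)
    from coeff_prod_sum[of "{0..<s}" "\<lambda>i. A $$ (i, \<pi> i)" e, OF _ this]
    have c: "coeff (\<Prod>i = 0..<s. A $$ (i, \<pi> i)) (sum e {0..<s}) = (\<Prod>i = 0..<s. coeff (A $$ (i, \<pi> i)) (e i))"
      by simp
    have "(\<Sum>i\<in>{0..<s}. \<beta> (\<pi> i)) = (\<Sum>i\<in>{0..<s}. \<beta> i)"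
      using sum.permute[OF \<pi>, of \<beta>] by (simp add: o_def)
    moreover have "int (sum e {0..<s}) = (\<Sum>i\<in>{0..<s}. \<alpha> i + \<beta> (\<pi> i))"
      unfolding of_nat_sum e_def using True by (intro sum.cong) auto
    ultimately have "int (sum e {0..<s}) = (\<Sum>i<s. \<alpha> i) + (\<Sum>i<s. \<beta> i)"
      by (simp only: sum.distrib lessThan_atLeast0)
    then have "sum e {0..<s} = ?O" by (metis nat_int)
    moreover have "(\<Prod>i = 0..<s. coeff (A $$ (i, \<pi> i)) (e i)) = (\<Prod>i = 0..<s. ?B $$ (i, \<pi> i))"
      using True in_s by (intro prod.cong) (auto simp: e_def)
    ultimately show ?thesis using c by simp
  next
    case False
    then obtain i where i: "i \<in> {0..<s}" "\<alpha> i + \<beta> (\<pi> i) < 0" by force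
    have "\<pi> i < s" using permutes_in_image[OF \<pi>, of i] i by simp
    then have "A $$ (i, \<pi> i) = 0" using deg[of i "\<pi> i"] i by (intro poly_eqI) force
    then have A0: "(\<Prod>i = 0..<s. A $$ (i, \<pi> i)) = 0" using i by (intro prod_zero) blast+
    have B0: "?B $$ (i, \<pi> i) = 0" using i \<open>\<pi> i < s\<close> by simp
    have "(\<Prod>i = 0..<s. ?B $$ (i, \<pi> i)) = 0" by (rule prod_zero) (use i B0 in blast)+
    with A0 show ?thesis by (simp only: coeff_0)
  qed
  show ?thesis unfolding det_def'[OF A] det_def'[OF B]
    by (auto simp: coeff_sum coeff_signof_mult prod intro!: sum.cong)
qed

lemma sorted_list_bij:
  assumes "finite Y" "card Y = s"
  shows "bij_betw (\<lambda>k. sorted_list_of_set Y ! k) {..<s} Y"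
  using bij_betw_nth[of "sorted_list_of_set Y" "{..<s}" Y] assms by simp

context
  fixes n :: nat and U :: "jet set"
  assumes U: "jet_open n U"
begin

lemma depends_on_finite:
  assumes "differential_function n U f"
  obtains C where "finite C" "C \<subseteq> jet_coords n" "\<And>c. depends_on U f c \<Longrightarrow> c \<in> C"
    "\<And>p. p \<in> U \<Longrightarrow> analytic_at U p C f"
proof -
  obtain C where C: "finite C" "C \<subseteq> jet_coords n" "\<And>p. p \<in> U \<Longrightarrow> analytic_at U p C f"
    by (rule differential_functionE[OF assms U]) blast
  have "c \<in> C" if dep: "depends_on U f c" for c
  proof (rule ccontr)
    assume c: "c \<notin> C"
    obtain p v where p: "p \<in> U" "p(c := v) \<in> U" "f (p(c := v)) \<noteq> f p"
      using dep unfolding depends_on_def by blast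
    obtain \<rho> M where \<rho>: "\<rho> > 0" "power_series_on U C p (\<lambda>_. \<rho>) f M" using C(3)[OF p(1)] by (auto simp: analytic_at_def)
    have "f p = f (p(c := v))"
      by (rule power_series_on_depends[OF \<rho>(2) p(1,2)]) (use \<rho>(1) c in \<open>auto simp: in_box_def\<close>)
    with p(3) show False by simp
  qed
  with C show thesis using that by blast
qed

lemma top_order_greatest:
  assumes "differential_function n U f" "depends_on U f (Jet j k)"
  shows "depends_on U f (Jet j (top_order U f j))" "k \<le> top_order U f j"
proof -
  obtain C where C: "finite C" "\<And>c. depends_on U f c \<Longrightarrow> c \<in> C"
    by (rule depends_on_finite[OF assms(1)]) blast
  have "finite {k. Jet j k \<in> C}" by (rule finite_vimageI[OF C(1), of "Jet j", unfolded vimage_def]) (simp add: inj_def)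
  then obtain b where b: "\<forall>k\<in>{k. Jet j k \<in> C}. k \<le> b" using finite_nat_set_iff_bounded_le by blast
  show "depends_on U f (Jet j (top_order U f j))" unfolding top_order_def
    by (rule GreatestI_nat[where P = "\<lambda>k. depends_on U f (Jet j k)" and b = b, OF assms(2)]) (use b C(2) in auto)
  show "k \<le> top_order U f j" unfolding top_order_def
    by (rule Greatest_le_nat[where P = "\<lambda>k. depends_on U f (Jet j k)" and b = b, OF assms(2)]) (use b C(2) in auto)
qed

lemma jet_ord_le_iff:
  assumes "differential_function n U f"
  shows "jet_ord U f j \<le> ereal (of_int m) \<longleftrightarrow> (\<forall>k. depends_on U f (Jet j k) \<longrightarrow> int k \<le> m)"
proof (cases "\<exists>k. depends_on U f (Jet j k)")
  case True
  then obtain k where k: "depends_on U f (Jet j k)" by blast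
  note top = top_order_greatest[OF assms]
  have "jet_ord U f j \<le> ereal (of_int m) \<longleftrightarrow> int (top_order U f j) \<le> m"
    using True by (simp add: jet_ord_def) (metis of_int_le_iff of_int_of_nat_eq)
  then show ?thesis using top(1)[OF k] top(2) by force
qed (simp add: jet_ord_def)

lemma not_depends_on_partial_zero:
  assumes \<eta>: "\<eta> \<in> U" and "\<not> depends_on U f c" "c \<in> jet_coords n"
  shows "jet_partial c f \<eta> = 0"
proof -
  have ev: "eventually (\<lambda>v. f (\<eta>(c := v)) = f \<eta>) (nhds (\<eta> c))"
    using jet_open_update[OF U \<eta> assms(3)] assms(2) \<eta> by (auto simp: depends_on_def elim!: eventually_mono)
  have "((\<lambda>v. f (\<eta>(c := v))) has_real_derivative 0) (at (\<eta> c))"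
    using DERIV_cong_ev[OF refl ev, of 0 0] by simp
  then show ?thesis unfolding jet_partial_def by (rule DERIV_imp_deriv)
qed

end

lemma order_matrix_cases:
  obtains "order_matrix U P i j = -\<infinity>" | k where "order_matrix U P i j = ereal (real k)"
  by (cases "\<exists>k. depends_on U (P i) (Jet j k)") (auto simp: order_matrix_def jet_ord_def)

lemma order_matrix_not_PInf: "order_matrix U P i j \<noteq> \<infinity>"
  by (rule order_matrix_cases[of U P i j]) auto

lemma admissible_matching:
  assumes "jacobi_number s (order_matrix U P) Y \<noteq> -\<infinity>"
  obtains \<sigma> where "bij_betw \<sigma> {..<s} Y" "\<And>i. i < s \<Longrightarrow> order_matrix U P i (\<sigma> i) \<ge> 0"
proof -
  let ?a = "order_matrix U P"
  have "\<exists>\<sigma>. bij_betw \<sigma> {..<s} Y \<and> (\<Sum>i<s. ?a i (\<sigma> i)) \<noteq> -\<infinity>"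
  proof (rule ccontr)
    assume "\<not> ?thesis"
    then have "jacobi_number s ?a Y \<le> -\<infinity>" unfolding jacobi_number_def by (intro SUP_least) auto
    with assms show False by simp
  qed
  then obtain \<sigma> where \<sigma>: "bij_betw \<sigma> {..<s} Y" "(\<Sum>i<s. ?a i (\<sigma> i)) \<noteq> -\<infinity>" by blast
  have "?a i (\<sigma> i) \<ge> 0" if i: "i < s" for i
  proof (rule order_matrix_cases[of U P i "\<sigma> i"])
    assume m: "?a i (\<sigma> i) = -\<infinity>"
    have "(\<Sum>i<s. ?a i (\<sigma> i)) = ?a i (\<sigma> i) + (\<Sum>k\<in>{..<s} - {i}. ?a k (\<sigma> k))"
      using i by (simp add: sum.remove)
    moreover have "(\<Sum>k\<in>{..<s} - {i}. ?a k (\<sigma> k)) \<noteq> \<infinity>"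
      using order_matrix_not_PInf by (auto simp: sum_Pinfty)
    ultimately show ?thesis using \<sigma>(2) m by simp
  qed auto
  with \<sigma>(1) show thesis by (rule that)
qed

lemma jacobi_number_nonneg:
  assumes "jacobi_number s (order_matrix U P) Y \<noteq> -\<infinity>"
  shows "jacobi_number s (order_matrix U P) Y \<ge> 0"
proof -
  obtain \<sigma> where \<sigma>: "bij_betw \<sigma> {..<s} Y" "\<And>i. i < s \<Longrightarrow> order_matrix U P i (\<sigma> i) \<ge> 0"
    by (rule admissible_matching[OF assms]) blast
  have "0 \<le> (\<Sum>i<s. order_matrix U P i (\<sigma> i))" using \<sigma>(2) by (intro sum_nonneg) auto
  also have "\<dots> \<le> jacobi_number s (order_matrix U P) Y"
    unfolding jacobi_number_def by (rule SUP_upper) (use \<sigma>(1) in simp)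
  finally show ?thesis .
qed

text \<open>
  \<open>\<beta>\<close> is a column maximum, so \<open>\<alpha> i + \<beta> j\<close> bounds the order of \<open>P i\<close> in \<open>x_j\<close>. An entry of the
  truncated determinant can then be written as the derivative of \<open>P i\<close> by the jet coordinate
  of order \<open>\<alpha> i + \<beta> j\<close>: where this order is not attained, the derivative is zero.
\<close>

lemma truncated_det_cover:
  assumes U: "jet_open n U" and P: "\<forall>i<s. differential_function n U (P i)" and \<eta>: "\<eta> \<in> U"
    and nz: "truncated_det_nonzero_at n s U P Y \<eta>"
  obtains \<alpha> :: "nat \<Rightarrow> nat" and \<beta> :: "nat \<Rightarrow> int" where
    "\<And>i j k. i < s \<Longrightarrow> j \<in> Y \<Longrightarrow> depends_on U (P i) (Jet j k) \<Longrightarrow> int k \<le> int (\<alpha> i) + \<beta> j"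
    "det (mat s s (\<lambda>(i, k). let j = sorted_list_of_set Y ! k in
       if 0 \<le> int (\<alpha> i) + \<beta> j then jet_partial (Jet j (nat (int (\<alpha> i) + \<beta> j))) (P i) \<eta> else 0)) \<noteq> 0"
proof -
  let ?a = "order_matrix U P"
  define \<alpha> where "\<alpha> = canon_alpha s ?a Y"
  from nz have Y: "Y \<subseteq> {..<n}" "card Y = s" "jacobi_number s ?a Y \<noteq> -\<infinity>"
    and det: "truncated_det s U P Y \<eta> \<noteq> 0"
    by (auto simp: truncated_det_nonzero_at_def admissible_vars_def)
  have finY: "finite Y" using Y(1) finite_subset by blast
  obtain \<sigma> where \<sigma>: "bij_betw \<sigma> {..<s} Y" "\<And>i. i < s \<Longrightarrow> ?a i (\<sigma> i) \<ge> 0"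
    by (rule admissible_matching[OF Y(3)]) blast
  have "\<exists>b. canon_beta s ?a Y j = ereal (of_int b)" if j: "j \<in> Y" for j
  proof -
    obtain i0 where i0: "i0 < s" "\<sigma> i0 = j" using \<sigma>(1) j unfolding bij_betw_def by auto
    let ?f = "\<lambda>i. ?a i j - ereal (real (\<alpha> i))"
    have \<beta>: "canon_beta s ?a Y j = Max (?f ` {..<s})" by (simp add: canon_beta_def \<alpha>_def)
    have "Max (?f ` {..<s}) \<in> ?f ` {..<s}" by (rule Max_in) (use i0 in auto)
    then obtain i where i: "i < s" "canon_beta s ?a Y j = ?f i" unfolding \<beta> by auto
    have "?f i0 \<le> canon_beta s ?a Y j" unfolding \<beta> by (rule Max_ge) (use i0 in auto)
    then have "?a i j \<noteq> -\<infinity>" using i(2) \<sigma>(2)[OF i0(1)] i0(2) by (cases "?a i0 j") auto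
    then obtain k where "?a i j = ereal (real k)" by - (rule order_matrix_cases[of U P i j], auto)
    then have "canon_beta s ?a Y j = ereal (of_int (int k - int (\<alpha> i)))" using i(2) by simp
    then show ?thesis by blast
  qed
  then obtain \<beta> where \<beta>: "\<And>j. j \<in> Y \<Longrightarrow> canon_beta s ?a Y j = ereal (of_int (\<beta> j))" by metis
  have cover: "?a i j \<le> ereal (of_int (int (\<alpha> i) + \<beta> j))" if "i < s" "j \<in> Y" for i j
  proof -
    have "?a i j - ereal (real (\<alpha> i)) \<le> canon_beta s ?a Y j"
      unfolding canon_beta_def \<alpha>_def by (rule Max_ge) (use that in auto)
    then show ?thesis unfolding \<beta>[OF that(2)] by (cases "?a i j") auto
  qed
  have dep: "int k \<le> int (\<alpha> i) + \<beta> j" if "i < s" "j \<in> Y" "depends_on U (P i) (Jet j k)" for i j k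
    using cover[OF that(1,2), unfolded order_matrix_def jet_ord_le_iff[OF U P[rule_format, OF that(1)]]] that(3) by blast
  show thesis
  proof (rule that[OF dep])
    have entry: "(if ?a i j = ereal (real (canon_alpha s ?a Y i)) + canon_beta s ?a Y j
        then jet_partial (Jet j (top_order U (P i) j)) (P i) \<eta> else 0) =
        (if 0 \<le> int (\<alpha> i) + \<beta> j then jet_partial (Jet j (nat (int (\<alpha> i) + \<beta> j))) (P i) \<eta> else 0)"
      if i: "i < s" and j: "j \<in> Y" for i j
    proof -
      have jn: "Jet j k \<in> jet_coords n" for k using j Y(1) by (auto simp: jet_coords_def)
      show ?thesis
      proof (cases "?a i j = ereal (of_int (int (\<alpha> i) + \<beta> j))")
        case True
        then obtain k where "depends_on U (P i) (Jet j k)"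
          unfolding order_matrix_def jet_ord_def by (auto split: if_splits)
        then have "?a i j = ereal (real (top_order U (P i) j))" by (auto simp: order_matrix_def jet_ord_def)
        with True have "real (top_order U (P i) j) = of_int (int (\<alpha> i) + \<beta> j)" by simp
        then have t: "int (\<alpha> i) + \<beta> j = int (top_order U (P i) j)" by linarith
        have "?a i j = ereal (real (canon_alpha s ?a Y i)) + canon_beta s ?a Y j"
          using True \<beta>[OF j] by (simp add: \<alpha>_def[symmetric])
        then show ?thesis by (simp add: t)
      next
        case False
        have "\<not> depends_on U (P i) (Jet j (nat (int (\<alpha> i) + \<beta> j)))" if pos: "0 \<le> int (\<alpha> i) + \<beta> j"
        proof
          assume d: "depends_on U (P i) (Jet j (nat (int (\<alpha> i) + \<beta> j)))"
          have "?a i j = ereal (real (top_order U (P i) j))" using d by (auto simp: order_matrix_def jet_ord_def)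
          moreover have "int (top_order U (P i) j) \<le> int (\<alpha> i) + \<beta> j"
            using dep[OF i j top_order_greatest(1)[OF U P[rule_format, OF i] d]] .
          moreover have "nat (int (\<alpha> i) + \<beta> j) \<le> top_order U (P i) j"
            by (rule top_order_greatest(2)[OF U P[rule_format, OF i] d])
          ultimately have "?a i j = ereal (of_int (int (\<alpha> i) + \<beta> j))" using pos by auto
          with False show False by simp
        qed
        then have "0 \<le> int (\<alpha> i) + \<beta> j \<Longrightarrow> jet_partial (Jet j (nat (int (\<alpha> i) + \<beta> j))) (P i) \<eta> = 0"
          using not_depends_on_partial_zero[OF U \<eta>] jn by blast
        then show ?thesis using False \<beta>[OF j] by (auto simp: \<alpha>_def[symmetric])
      qed
    qed
    have "sorted_list_of_set Y ! k \<in> Y" if "k < s" for k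
      using that finY Y(2) by (metis length_sorted_list_of_set nth_mem set_sorted_list_of_set)
    then have "mat s s (\<lambda>(i, k). let j = sorted_list_of_set Y ! k in
       if 0 \<le> int (\<alpha> i) + \<beta> j then jet_partial (Jet j (nat (int (\<alpha> i) + \<beta> j))) (P i) \<eta> else 0) =
      mat s s (\<lambda>(i, k). let j = sorted_list_of_set Y ! k in
        if ?a i j = ereal (real (canon_alpha s ?a Y i)) + canon_beta s ?a Y j
        then jet_partial (Jet j (top_order U (P i) j)) (P i) \<eta> else 0)"
      by (intro eq_matI) (simp_all add: Let_def entry)
    then show "det (mat s s (\<lambda>(i, k). let j = sorted_list_of_set Y ! k in
       if 0 \<le> int (\<alpha> i) + \<beta> j then jet_partial (Jet j (nat (int (\<alpha> i) + \<beta> j))) (P i) \<eta> else 0)) \<noteq> 0"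
      using det by (simp add: truncated_det_def Let_def)
  qed
qed

text \<open>
  The cover bounds the sum over every matching, and a nonzero term of the determinant is a
  matching \<open>\<sigma>\<close> that attains the bound. This is the weak duality between matchings and covers.
\<close>

lemma jacobi_number_cover:
  fixes \<alpha> :: "nat \<Rightarrow> nat" and \<beta> :: "nat \<Rightarrow> int"
  assumes U: "jet_open n U" and P: "\<forall>i<s. differential_function n U (P i)" and \<eta>: "\<eta> \<in> U"
    and Y: "Y \<subseteq> {..<n}" "card Y = s"
    and dep: "\<And>i j k. i < s \<Longrightarrow> j \<in> Y \<Longrightarrow> depends_on U (P i) (Jet j k) \<Longrightarrow> int k \<le> int (\<alpha> i) + \<beta> j"
    and det: "det (mat s s (\<lambda>(i, k). let j = sorted_list_of_set Y ! k in
       if 0 \<le> int (\<alpha> i) + \<beta> j then jet_partial (Jet j (nat (int (\<alpha> i) + \<beta> j))) (P i) \<eta> else 0)) \<noteq> 0"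
  obtains \<sigma> where "bij_betw \<sigma> {..<s} Y" "\<And>i. i < s \<Longrightarrow> 0 \<le> int (\<alpha> i) + \<beta> (\<sigma> i)"
    "jacobi_number s (order_matrix U P) Y = ereal (of_int ((\<Sum>i<s. int (\<alpha> i)) + (\<Sum>j\<in>Y. \<beta> j)))"
proof -
  let ?a = "order_matrix U P" and ?y = "\<lambda>k. sorted_list_of_set Y ! k"
  have finY: "finite Y" using Y(1) finite_subset by blast
  note y = sorted_list_bij[OF finY Y(2)]
  obtain \<pi> where \<pi>: "\<pi> permutes {0..<s}" and nz: "\<And>i. i < s \<Longrightarrow>
     mat s s (\<lambda>(i, k). let j = ?y k in
       if 0 \<le> int (\<alpha> i) + \<beta> j then jet_partial (Jet j (nat (int (\<alpha> i) + \<beta> j))) (P i) \<eta> else 0) $$ (i, \<pi> i) \<noteq> 0"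
    by (rule det_nonzero_imp_permutation[OF mat_carrier det]) blast
  have in_s: "\<pi> i < s" if "i < s" for i using permutes_in_image[OF \<pi>, of i] that by simp
  define \<sigma> where "\<sigma> = ?y \<circ> \<pi>"
  have "bij_betw \<pi> {..<s} {..<s}" using permutes_imp_bij[OF \<pi>] by (simp add: lessThan_atLeast0)
  then have \<sigma>: "bij_betw \<sigma> {..<s} Y" unfolding \<sigma>_def using y by (rule bij_betw_trans)
  have \<sigma>Y: "\<sigma> i \<in> Y" if "i < s" for i using bij_betwE[OF \<sigma>] that by auto
  have nz': "0 \<le> int (\<alpha> i) + \<beta> (\<sigma> i)"
    "jet_partial (Jet (\<sigma> i) (nat (int (\<alpha> i) + \<beta> (\<sigma> i)))) (P i) \<eta> \<noteq> 0" if "i < s" for i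
    using nz[OF that] that in_s[OF that] by (auto simp: \<sigma>_def Let_def split: if_splits)
  have entry: "?a i (\<sigma> i) = ereal (of_int (int (\<alpha> i) + \<beta> (\<sigma> i)))" if i: "i < s" for i
  proof -
    have "Jet (\<sigma> i) k \<in> jet_coords n" for k using \<sigma>Y[OF i] Y(1) by (auto simp: jet_coords_def)
    then have d: "depends_on U (P i) (Jet (\<sigma> i) (nat (int (\<alpha> i) + \<beta> (\<sigma> i))))"
      using nz'(2)[OF i] not_depends_on_partial_zero[OF U \<eta>] by blast
    have "int (top_order U (P i) (\<sigma> i)) \<le> int (\<alpha> i) + \<beta> (\<sigma> i)"
      by (rule dep[OF i \<sigma>Y[OF i] top_order_greatest(1)[OF U P[rule_format, OF i] d]])
    moreover note top_order_greatest(2)[OF U P[rule_format, OF i] d]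
    ultimately have "int (top_order U (P i) (\<sigma> i)) = int (\<alpha> i) + \<beta> (\<sigma> i)" using nz'(1)[OF i] by linarith
    then have "real (top_order U (P i) (\<sigma> i)) = of_int (int (\<alpha> i) + \<beta> (\<sigma> i))" by linarith
    then show ?thesis using d by (auto simp: order_matrix_def jet_ord_def)
  qed
  have total: "(\<Sum>i<s. ereal (of_int (int (\<alpha> i) + \<beta> (\<tau> i)))) =
      ereal (of_int ((\<Sum>i<s. int (\<alpha> i)) + (\<Sum>j\<in>Y. \<beta> j)))" if "bij_betw \<tau> {..<s} Y" for \<tau>
    using sum.reindex_bij_betw[OF that, of "\<lambda>j. real_of_int (\<beta> j)"] by (simp add: sum.distrib)
  have "jacobi_number s ?a Y = ereal (of_int ((\<Sum>i<s. int (\<alpha> i)) + (\<Sum>j\<in>Y. \<beta> j)))"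
  proof (rule antisym)
    show "jacobi_number s ?a Y \<le> ereal (of_int ((\<Sum>i<s. int (\<alpha> i)) + (\<Sum>j\<in>Y. \<beta> j)))"
      unfolding jacobi_number_def
    proof (rule SUP_least)
      fix \<tau> assume "\<tau> \<in> {\<sigma>. bij_betw \<sigma> {..<s} Y}"
      then have \<tau>: "bij_betw \<tau> {..<s} Y" by simp
      have "(\<Sum>i<s. ?a i (\<tau> i)) \<le> (\<Sum>i<s. ereal (of_int (int (\<alpha> i) + \<beta> (\<tau> i))))"
      proof (rule sum_mono)
        fix i assume i: "i \<in> {..<s}"
        have "\<tau> i \<in> Y" using bij_betwE[OF \<tau>] i by auto
        then show "?a i (\<tau> i) \<le> ereal (of_int (int (\<alpha> i) + \<beta> (\<tau> i)))"
          using jet_ord_le_iff[OF U P[rule_format], of i "\<tau> i"] dep[of i "\<tau> i"] i by (auto simp: order_matrix_def simp del: of_int_add)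
      qed
      then show "(\<Sum>i<s. ?a i (\<tau> i)) \<le> ereal (of_int ((\<Sum>i<s. int (\<alpha> i)) + (\<Sum>j\<in>Y. \<beta> j)))"
        unfolding total[OF \<tau>] .
    qed
    have "ereal (of_int ((\<Sum>i<s. int (\<alpha> i)) + (\<Sum>j\<in>Y. \<beta> j))) = (\<Sum>i<s. ?a i (\<sigma> i))"
      unfolding total[OF \<sigma>, symmetric] using entry by (intro sum.cong) auto
    also have "\<dots> \<le> jacobi_number s ?a Y"
      unfolding jacobi_number_def by (rule SUP_upper) (use \<sigma> in simp)
    finally show "ereal (of_int ((\<Sum>i<s. int (\<alpha> i)) + (\<Sum>j\<in>Y. \<beta> j))) \<le> jacobi_number s ?a Y" .
  qed
  with \<sigma> nz'(1) show thesis by (intro that) auto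
qed

text \<open>
  An admissible set of variables has a matching with entries in the natural numbers, so zero
  is the least value that the Jacobi number can take there.
\<close>

lemma saddle_jacobi_number_zero:
  assumes "Y \<in> admissible_vars n s (order_matrix U P)" "jacobi_number s (order_matrix U P) Y = 0"
  shows "saddle_jacobi_number n s (order_matrix U P) = 0"
proof -
  let ?A = "admissible_vars n s (order_matrix U P)" and ?O = "jacobi_number s (order_matrix U P)"
  have "?A \<subseteq> Pow {..<n}" by (auto simp: admissible_vars_def)
  then have fin: "finite ?A" using finite_subset by blast
  have "Min (?O ` ?A) = 0"
  proof (rule Min_eqI)
    show "0 \<le> y" if "y \<in> ?O ` ?A" for y
      using that jacobi_number_nonneg by (auto simp: admissible_vars_def)
    show "0 \<in> ?O ` ?A" using assms by (metis image_eqI)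
  qed (use fin in simp)
  then show ?thesis using assms(1) by (auto simp: saddle_jacobi_number_def)
qed

section \<open>Linearization and levels\<close>

lemma differential_function_partial:
  assumes "jet_open n V" "differential_function n V f" "q \<in> V" "c \<in> jet_coords n"
  shows "((\<lambda>v. f (q(c := v))) has_real_derivative jet_partial c f q) (at (q c))"
proof -
  obtain C where C: "finite C" "C \<subseteq> jet_coords n" "\<And>p. p \<in> V \<Longrightarrow> analytic_at V p C f"
    by (rule differential_functionE[OF assms(2,1)]) blast
  show ?thesis by (rule analytic_at_partial[OF C(1) C(3)[OF assms(3)] assms(3) jet_open_update_at[OF assms(1,3,4)]])
qed

text \<open>
  At a common zero of the \<open>P i\<close> the derivatives of the coefficients drop out of the product
  rule.
\<close>

lemma jet_partial_ideal_combination: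
  assumes V: "jet_open n V" and Q: "\<And>i. i \<in> I \<Longrightarrow> differential_function n V (Q i)"
    and P: "\<And>i. i \<in> I \<Longrightarrow> differential_function n V (P i)"
    and q: "q \<in> V" and c: "c \<in> jet_coords n" and P0: "\<And>i. i \<in> I \<Longrightarrow> P i q = 0"
    and eq: "\<And>x. x \<in> V \<Longrightarrow> f x = (\<Sum>i\<in>I. Q i x * P i x)"
  shows "jet_partial c f q = (\<Sum>i\<in>I. Q i q * jet_partial c (P i) q)"
proof -
  have "((\<lambda>v. \<Sum>i\<in>I. Q i (q(c := v)) * P i (q(c := v))) has_real_derivative
      (\<Sum>i\<in>I. Q i q * jet_partial c (P i) q)) (at (q c))"
  proof (rule DERIV_sum)
    fix i assume i: "i \<in> I"
    show "((\<lambda>v. Q i (q(c := v)) * P i (q(c := v))) has_real_derivative Q i q * jet_partial c (P i) q) (at (q c))"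
      using DERIV_mult[OF differential_function_partial[OF V Q[OF i] q c] differential_function_partial[OF V P[OF i] q c]]
        P0[OF i] by (simp add: mult.commute)
  qed
  moreover have ev: "eventually (\<lambda>v. (\<Sum>i\<in>I. Q i (q(c := v)) * P i (q(c := v))) = f (q(c := v))) (nhds (q c))"
    using jet_open_update[OF V q c] by eventually_elim (simp add: eq)
  ultimately have "((\<lambda>v. f (q(c := v))) has_real_derivative (\<Sum>i\<in>I. Q i q * jet_partial c (P i) q)) (at (q c))"
    using DERIV_cong_ev[OF refl ev refl] by blast
  then show ?thesis unfolding jet_partial_def by (rule DERIV_imp_deriv)
qed

context
  fixes n s :: nat and U :: "jet set" and P :: "nat \<Rightarrow> jet \<Rightarrow> real" and \<eta> :: jet
  assumes U: "jet_open n U" and P: "\<And>i. i < s \<Longrightarrow> differential_function n U (P i)" and \<eta>: "\<eta> \<in> U"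
    and P0: "\<And>i. i < s \<Longrightarrow> P i \<eta> = 0"
begin

text \<open>
  Linearizing the identities \<open>x_j - H j = \<Sum> Q j i * P i\<close> at \<open>\<eta>\<close> gives a matrix identity over
  the polynomials in the derivation: \<open>M * A\<close> is unitriangular with respect to the blocks of
  the parametrization, where \<open>A\<close> is the linearized system and \<open>M\<close> is constant. Hence \<open>det A\<close>
  is a constant. On the other hand its coefficient in degree \<open>Ob\<close>, the Jacobi number, is the
  truncated determinant, which is not zero; so the Jacobi number is zero.
\<close>

theorem lazy_flat_imp_regular_obar:
  assumes lazy: "lazy_flat_parametrization n s U P \<eta> Z"
    and nz: "truncated_det_nonzero_at n s U P ({..<n} - Z) \<eta>"
  shows "regular_obar_system_at n s U P \<eta>"
proof -
  have P_all: "\<forall>i<s. differential_function n U (P i)" using P by blast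
  define Y where "Y = {..<n} - Z"
  note nz' = nz[folded Y_def]
  have Y: "Y \<subseteq> {..<n}" "card Y = s" and adm: "Y \<in> admissible_vars n s (order_matrix U P)"
    using nz' by (auto simp: truncated_det_nonzero_at_def admissible_vars_def)
  have finY: "finite Y" using Y(1) finite_subset by blast
  obtain \<alpha> :: "nat \<Rightarrow> nat" and \<beta> where
    dep: "\<And>i j k. i < s \<Longrightarrow> j \<in> Y \<Longrightarrow> depends_on U (P i) (Jet j k) \<Longrightarrow> int k \<le> int (\<alpha> i) + \<beta> j"
    and det: "det (mat s s (\<lambda>(i, k). let j = sorted_list_of_set Y ! k in
       if 0 \<le> int (\<alpha> i) + \<beta> j then jet_partial (Jet j (nat (int (\<alpha> i) + \<beta> j))) (P i) \<eta> else 0)) \<noteq> 0"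
    by (rule truncated_det_cover[OF U P_all \<eta> nz']) blast+
  define Ob where "Ob = (\<Sum>i<s. int (\<alpha> i)) + (\<Sum>j\<in>Y. \<beta> j)"
  have jac: "jacobi_number s (order_matrix U P) Y = ereal (of_int Ob)"
    unfolding Ob_def by (rule jacobi_number_cover[OF U P_all \<eta> Y dep det])
  then have "Ob \<ge> 0" using jacobi_number_nonneg[of s U P Y] by simp
  define y where "y k = sorted_list_of_set Y ! k" for k
  have y: "bij_betw y {..<s} Y" unfolding y_def using sorted_list_bij[OF finY Y(2)] .
  have yY: "y k \<in> Y" if "k < s" for k using bij_betwE[OF y] that by auto
  have yn: "Jet (y k) l \<in> jet_coords n" if "k < s" for k l
    using yY[OF that] Y(1) by (auto simp: jet_coords_def)
  from lazy obtain r :: nat and \<Xi> V where \<Xi>: "(\<Union>h\<le>r. \<Xi> h) = {..<n}" "disjoint_family_on \<Xi> {..r}" "\<Xi> 0 = Z"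
    and V: "jet_open n V" "V \<subseteq> U" "\<eta> \<in> V"
    and H: "\<forall>h. 0 < h \<and> h \<le> r \<longrightarrow> (\<forall>i0\<in>\<Xi> h. \<exists>H. differential_function n V H \<and>
              depends_only_on V H (insert Time {Jet j k | j k. j \<in> (\<Union>h'<h. \<Xi> h')}) \<and>
              (\<lambda>p. p (Jet i0 0) - H p) \<in> algebraic_ideal n s V P)"
    unfolding lazy_flat_parametrization_def by (elim exE conjE) (rule that)
  have "\<forall>j\<in>Y. \<exists>h. 0 < h \<and> h \<le> r \<and> j \<in> \<Xi> h"
  proof
    fix j assume j: "j \<in> Y"
    then have "j \<in> (\<Union>h\<le>r. \<Xi> h)" using \<Xi>(1) by (simp add: Y_def)
    then obtain h where h: "h \<le> r" "j \<in> \<Xi> h" by auto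
    have "h \<noteq> 0"
    proof
      assume "h = 0"
      with h(2) j \<Xi>(3) show False by (simp add: Y_def)
    qed
    with h show "\<exists>h. 0 < h \<and> h \<le> r \<and> j \<in> \<Xi> h" by blast
  qed
  from bchoice[OF this] obtain lv where "\<forall>j\<in>Y. 0 < lv j \<and> lv j \<le> r \<and> j \<in> \<Xi> (lv j)" by blast
  then have lv: "\<And>j. j \<in> Y \<Longrightarrow> 0 < lv j" "\<And>j. j \<in> Y \<Longrightarrow> lv j \<le> r" "\<And>j. j \<in> Y \<Longrightarrow> j \<in> \<Xi> (lv j)"
    by blast+
  have lvI: "lv j = h" if "j \<in> Y" "h \<le> r" "j \<in> \<Xi> h" for j h
    using disjoint_family_onD[OF \<Xi>(2), of "lv j" h] lv[OF that(1)] that by auto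
  have "\<forall>j\<in>Y. \<exists>q. (\<forall>i<s. differential_function n V (q i)) \<and>
      (\<exists>H. depends_only_on V H (insert Time {Jet j' k | j' k. j' \<in> (\<Union>h'<lv j. \<Xi> h')}) \<and> differential_function n V H \<and>
        (\<forall>p\<in>V. p (Jet j 0) - H p = (\<Sum>i<s. q i p * P i p)))"
  proof
    fix j assume j: "j \<in> Y"
    obtain H where "differential_function n V H"
      "depends_only_on V H (insert Time {Jet j' k | j' k. j' \<in> (\<Union>h'<lv j. \<Xi> h')})"
      "(\<lambda>p. p (Jet j 0) - H p) \<in> algebraic_ideal n s V P"
      using H[rule_format, of "lv j" j] lv[OF j] by blast
    then show "\<exists>q. (\<forall>i<s. differential_function n V (q i)) \<and>
      (\<exists>H. depends_only_on V H (insert Time {Jet j' k | j' k. j' \<in> (\<Union>h'<lv j. \<Xi> h')}) \<and> differential_function n V H \<and>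
        (\<forall>p\<in>V. p (Jet j 0) - H p = (\<Sum>i<s. q i p * P i p)))"
      unfolding algebraic_ideal_def by blast
  qed
  from bchoice[OF this] obtain Q where "\<forall>j\<in>Y. (\<forall>i<s. differential_function n V (Q j i)) \<and>
      (\<exists>H. depends_only_on V H (insert Time {Jet j' k | j' k. j' \<in> (\<Union>h'<lv j. \<Xi> h')}) \<and> differential_function n V H \<and>
        (\<forall>p\<in>V. p (Jet j 0) - H p = (\<Sum>i<s. Q j i p * P i p)))" by blast
  then have Q: "\<And>j i. j \<in> Y \<Longrightarrow> i < s \<Longrightarrow> differential_function n V (Q j i)"
    and QH: "\<And>j. j \<in> Y \<Longrightarrow> \<exists>H. depends_only_on V H (insert Time {Jet j' k | j' k. j' \<in> (\<Union>h'<lv j. \<Xi> h')}) \<and> differential_function n V H \<and>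
        (\<forall>p\<in>V. p (Jet j 0) - H p = (\<Sum>i<s. Q j i p * P i p))"
    by blast+
  let ?d = "\<lambda>i j l. jet_partial (Jet j l) (P i) \<eta>"
  have PV: "differential_function n V (P i)" if "i < s" for i
    by (rule differential_function_subset[OF P[OF that] V(2)])
  \<comment> \<open>Unless \<open>y k\<close> lies in a lower block than \<open>y m\<close>, the function \<open>H\<close> belonging to \<open>y m\<close> is free of its jets.\<close>
  have lin: "(\<Sum>i<s. Q (y m) i \<eta> * ?d i (y k) l) = (if m = k \<and> l = 0 then 1 else 0)"
    if mk: "m < s" "k < s" "\<not> lv (y k) < lv (y m)" for m k l
  proof -
    let ?S = "insert Time {Jet j' k | j' k. j' \<in> (\<Union>h'<lv (y m). \<Xi> h')}" and ?c = "Jet (y k) l"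
    obtain H where H: "depends_only_on V H ?S" "differential_function n V H"
      "\<And>p. p \<in> V \<Longrightarrow> p (Jet (y m) 0) - H p = (\<Sum>i<s. Q (y m) i p * P i p)"
      using QH[OF yY[OF mk(1)]] by blast
    have "(\<Sum>i<s. Q (y m) i \<eta> * ?d i (y k) l) = jet_partial ?c (\<lambda>p. p (Jet (y m) 0) - H p) \<eta>"
      by (rule jet_partial_ideal_combination[OF V(1) _ _ V(3) yn[OF mk(2)] _ H(3), symmetric])
        (use Q PV P0 yY[OF mk(1)] in auto)
    also have "\<dots> = (if m = k \<and> l = 0 then 1 else 0)"
    proof -
      have "y k \<notin> (\<Union>h'<lv (y m). \<Xi> h')"
      proof
        assume "y k \<in> (\<Union>h'<lv (y m). \<Xi> h')"
        then obtain h' where h': "h' < lv (y m)" "y k \<in> \<Xi> h'" by auto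
        then have "lv (y k) = h'" using lvI[OF yY[OF mk(2)]] lv(2)[OF yY[OF mk(1)]] by auto
        with h'(1) mk(3) show False by simp
      qed
      then have "jet_partial ?c H \<eta> = 0"
        using yn[OF mk(2)] by (intro depends_only_partial_zero[OF V(1) H(1) V(3)]) auto
      then have 1: "((\<lambda>v. H (\<eta>(?c := v))) has_real_derivative 0) (at (\<eta> ?c))"
        using differential_function_partial[OF V(1) H(2) V(3) yn[OF mk(2)], of l] by simp
      have inj: "y m = y k \<longleftrightarrow> m = k" using bij_betw_imp_inj_on[OF y] mk by (auto simp: inj_on_def)
      have 2: "((\<lambda>v. (\<eta>(?c := v)) (Jet (y m) 0)) has_real_derivative (if m = k \<and> l = 0 then 1 else 0)) (at (\<eta> ?c))"
        by (cases "m = k \<and> l = 0") (auto simp: inj)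
      show ?thesis unfolding jet_partial_def
        by (rule DERIV_imp_deriv) (use DERIV_diff[OF 2 1] in simp)
    qed
    finally show ?thesis .
  qed
  define L where "L = nat ((\<Sum>i<s. int (\<alpha> i)) + (\<Sum>j\<in>Y. \<bar>\<beta> j\<bar>))"
  have bound: "?d i (y k) l = 0" if "i < s" "k < s" "\<not> int l \<le> int (\<alpha> i) + \<beta> (y k)" for i k l
  proof -
    have "\<not> depends_on U (P i) (Jet (y k) l)" using dep[OF that(1) yY[OF that(2)]] that(3) by blast
    then show ?thesis by (intro not_depends_on_partial_zero[OF U \<eta>]) (use yn that in auto)
  qed
  have boundL: "?d i (y k) l = 0" if "i < s" "k < s" "l > L" for i k l
  proof (rule bound[OF that(1,2)])
    have "int (\<alpha> i) \<le> (\<Sum>i<s. int (\<alpha> i))" using that(1) by (intro member_le_sum) auto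
    moreover have "\<bar>\<beta> (y k)\<bar> \<le> (\<Sum>j\<in>Y. \<bar>\<beta> j\<bar>)" using yY[OF that(2)] finY by (intro member_le_sum) auto
    ultimately show "\<not> int l \<le> int (\<alpha> i) + \<beta> (y k)" using that(3) unfolding L_def by linarith
  qed
  define A where "A = mat s s (\<lambda>(i, k). \<Sum>l\<le>L. monom (?d i (y k) l) l)"
  define M where "M = mat s s (\<lambda>(m, i). [:Q (y m) i \<eta>:])"
  have A: "A \<in> carrier_mat s s" and M: "M \<in> carrier_mat s s" by (auto simp: A_def M_def)
  have coeffA: "coeff (A $$ (i, k)) l = ?d i (y k) l" if "i < s" "k < s" for i k l
    using that boundL[OF that, of l] by (auto simp: A_def coeff_sum coeff_monom)
  have coeffMA: "coeff ((M * A) $$ (m, k)) l = (\<Sum>i<s. Q (y m) i \<eta> * ?d i (y k) l)" if "m < s" "k < s" for m k l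
  proof -
    have "(M * A) $$ (m, k) = (\<Sum>i<s. [:Q (y m) i \<eta>:] * A $$ (i, k))"
      using that A M by (simp add: scalar_prod_def lessThan_atLeast0 M_def)
    then show ?thesis using that(2) by (auto simp: coeff_sum coeffA intro!: sum.cong)
  qed
  have MA: "M * A \<in> carrier_mat s s" using A M by simp
  have "det (M * A) = det (mat s s (\<lambda>(m, k). if lv (y k) = lv (y m) then (M * A) $$ (m, k) else 0))"
  proof (rule det_level_diagonal[OF MA])
    show "lv (y k) \<le> lv (y m)" if "m < s" "k < s" "(M * A) $$ (m, k) \<noteq> 0" for m k
    proof (rule ccontr)
      assume *: "\<not> lv (y k) \<le> lv (y m)"
      then have "m \<noteq> k" by auto
      then have "(M * A) $$ (m, k) = 0"
        by (intro poly_eqI) (use * lin[of m k] that in \<open>simp add: coeffMA\<close>)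
      with that(3) show False by simp
    qed
  qed simp
  also have "mat s s (\<lambda>(m, k). if lv (y k) = lv (y m) then (M * A) $$ (m, k) else 0) = 1\<^sub>m s"
  proof (rule eq_matI)
    fix m k assume "m < dim_row (1\<^sub>m s :: real poly mat)" "k < dim_col (1\<^sub>m s :: real poly mat)"
    then have mk: "m < s" "k < s" by auto
    have "(M * A) $$ (m, k) = (if m = k then 1 else 0)" if "lv (y k) = lv (y m)"
      by (rule poly_eqI) (use lin[OF mk] that in \<open>auto simp: coeffMA[OF mk] coeff_1\<close>)
    then show "mat s s (\<lambda>(m, k). if lv (y k) = lv (y m) then (M * A) $$ (m, k) else 0) $$ (m, k) = 1\<^sub>m s $$ (m, k)"
      using mk by auto
  qed auto
  finally have unit: "det M * det A = 1" using det_mult[OF M A] by simp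
  then have "degree (det M * det A) = 0" "det M \<noteq> 0" "det A \<noteq> 0" by auto
  then have deg0: "degree (det A) = 0" by (simp add: degree_mult_eq)
  have sum\<beta>: "(\<Sum>k<s. \<beta> (y k)) = (\<Sum>j\<in>Y. \<beta> j)" by (rule sum.reindex_bij_betw[OF y])
  have "coeff (det A) (nat ((\<Sum>i<s. int (\<alpha> i)) + (\<Sum>k<s. \<beta> (y k)))) =
    det (mat s s (\<lambda>(i, k). if 0 \<le> int (\<alpha> i) + \<beta> (y k) then coeff (A $$ (i, k)) (nat (int (\<alpha> i) + \<beta> (y k))) else 0))"
  proof (rule coeff_det_weighted[OF A])
    show "int l \<le> int (\<alpha> i) + \<beta> (y k)" if "i < s" "k < s" "coeff (A $$ (i, k)) l \<noteq> 0" for i k l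
      using bound[OF that(1,2)] that(3) coeffA[OF that(1,2)] by metis
    show "0 \<le> (\<Sum>i<s. int (\<alpha> i)) + (\<Sum>k<s. \<beta> (y k))" using \<open>Ob \<ge> 0\<close> sum\<beta> by (simp add: Ob_def)
  qed
  also have "mat s s (\<lambda>(i, k). if 0 \<le> int (\<alpha> i) + \<beta> (y k) then coeff (A $$ (i, k)) (nat (int (\<alpha> i) + \<beta> (y k))) else 0) =
    mat s s (\<lambda>(i, k). let j = sorted_list_of_set Y ! k in
       if 0 \<le> int (\<alpha> i) + \<beta> j then jet_partial (Jet j (nat (int (\<alpha> i) + \<beta> j))) (P i) \<eta> else 0)"
    by (intro eq_matI) (auto simp: coeffA Let_def y_def[symmetric])
  finally have "coeff (det A) (nat Ob) \<noteq> 0" using det sum\<beta> by (simp add: Ob_def)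
  then have "nat Ob = 0" using le_degree deg0 by fastforce
  then have "Ob = 0" using \<open>Ob \<ge> 0\<close> by simp
  then have jac0: "jacobi_number s (order_matrix U P) Y = 0" using jac by simp
  have "obar_system n s U P"
    unfolding obar_system_def by (rule saddle_jacobi_number_zero[OF adm jac0])
  with jac0 nz' Y show ?thesis unfolding regular_obar_system_at_def by blast
qed

text \<open>
  A matching with nonnegative entries and sum zero has all entries zero, so \<open>\<beta> = - \<alpha>\<close> along
  it. Thus \<open>\<alpha>\<close> assigns levels to the equations and \<open>\<gamma> = - \<beta>\<close> to the variables in \<open>Y\<close>, with the
  same number of both on each level. The covering inequality now says that, among the
  variables in \<open>Y\<close>, an equation involves those of its own level without derivatives and all
  others only if their level is lower. The truncated determinant is block triangular for the
  levels; its diagonal blocks are the Jacobian matrices of the equations of one level by the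
  variables of that level.
\<close>

lemma regular_obar_levels:
  assumes "regular_obar_system_at n s U P \<eta>"
  obtains Y and \<alpha> \<gamma> :: "nat \<Rightarrow> nat" where "Y \<subseteq> {..<n}" "card Y = s"
    "\<And>i j k. i < s \<Longrightarrow> j \<in> Y \<Longrightarrow> depends_on U (P i) (Jet j k) \<Longrightarrow> \<gamma> j + k \<le> \<alpha> i"
    "\<And>h. card {j\<in>Y. \<gamma> j = h} = card {i. i < s \<and> \<alpha> i = h}"
    "\<And>h v i. (\<And>j. j \<in> Y \<Longrightarrow> \<gamma> j = h \<Longrightarrow> (\<Sum>i\<in>{i. i < s \<and> \<alpha> i = h}. v i * jet_partial (Jet j 0) (P i) \<eta>) = 0) \<Longrightarrow>
       i < s \<Longrightarrow> \<alpha> i = h \<Longrightarrow> v i = 0"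
proof -
  have P_all: "\<forall>i<s. differential_function n U (P i)" using P by blast
  from assms obtain Y where Y: "Y \<subseteq> {..<n}" "card Y = s" and jac0: "jacobi_number s (order_matrix U P) Y = 0"
    and nz: "truncated_det_nonzero_at n s U P Y \<eta>"
    unfolding regular_obar_system_at_def by blast
  have finY: "finite Y" using Y(1) finite_subset by blast
  obtain \<alpha> :: "nat \<Rightarrow> nat" and \<beta> where
    dep: "\<And>i j k. i < s \<Longrightarrow> j \<in> Y \<Longrightarrow> depends_on U (P i) (Jet j k) \<Longrightarrow> int k \<le> int (\<alpha> i) + \<beta> j"
    and det: "det (mat s s (\<lambda>(i, k). let j = sorted_list_of_set Y ! k in
       if 0 \<le> int (\<alpha> i) + \<beta> j then jet_partial (Jet j (nat (int (\<alpha> i) + \<beta> j))) (P i) \<eta> else 0)) \<noteq> 0"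
    by (rule truncated_det_cover[OF U P_all \<eta> nz]) blast+
  obtain \<sigma> where \<sigma>: "bij_betw \<sigma> {..<s} Y" and \<sigma>0: "\<And>i. i < s \<Longrightarrow> 0 \<le> int (\<alpha> i) + \<beta> (\<sigma> i)"
    and jac: "jacobi_number s (order_matrix U P) Y = ereal (of_int ((\<Sum>i<s. int (\<alpha> i)) + (\<Sum>j\<in>Y. \<beta> j)))"
    by (rule jacobi_number_cover[OF U P_all \<eta> Y dep det]) blast+
  have "real_of_int ((\<Sum>i<s. int (\<alpha> i)) + (\<Sum>j\<in>Y. \<beta> j)) = 0" using jac jac0 by (metis ereal_eq_0(2))
  then have "(\<Sum>i<s. int (\<alpha> i)) + (\<Sum>j\<in>Y. \<beta> j) = 0" by (simp only: of_int_eq_0_iff)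
  then have "(\<Sum>i<s. int (\<alpha> i) + \<beta> (\<sigma> i)) = 0"
    using sum.reindex_bij_betw[OF \<sigma>, of \<beta>] by (simp add: sum.distrib)
  then have \<beta>\<sigma>: "\<beta> (\<sigma> i) = - int (\<alpha> i)" if "i < s" for i
    using sum_nonneg_eq_0_iff[of "{..<s}" "\<lambda>i. int (\<alpha> i) + \<beta> (\<sigma> i)"] \<sigma>0 that by force
  define \<gamma> where "\<gamma> j = nat (- \<beta> j)" for j
  have \<gamma>\<sigma>: "\<gamma> (\<sigma> i) = \<alpha> i" if "i < s" for i using \<beta>\<sigma>[OF that] by (simp add: \<gamma>_def)
  have \<beta>\<gamma>: "\<beta> j = - int (\<gamma> j)" if j: "j \<in> Y" for j
  proof -
    obtain i where "i < s" "\<sigma> i = j" using \<sigma> j unfolding bij_betw_def by auto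
    then show ?thesis using \<beta>\<sigma>[of i] by (auto simp: \<gamma>_def)
  qed
  define y where "y k = sorted_list_of_set Y ! k" for k
  have y: "bij_betw y {..<s} Y" unfolding y_def using sorted_list_bij[OF finY Y(2)] .
  have yY: "y k \<in> Y" if "k < s" for k using bij_betwE[OF y] that by auto
  let ?N = "mat s s (\<lambda>(i, k). let j = sorted_list_of_set Y ! k in
       if 0 \<le> int (\<alpha> i) + \<beta> j then jet_partial (Jet j (nat (int (\<alpha> i) + \<beta> j))) (P i) \<eta> else 0)"
  let ?B = "mat s s (\<lambda>(i, k). if \<gamma> (y k) = \<alpha> i then ?N $$ (i, k) else 0)"
  have "det ?N = det ?B"
  proof (rule det_level_diagonal)
    show "\<gamma> (y k) \<le> \<alpha> i" if "i < s" "k < s" "?N $$ (i, k) \<noteq> 0" for i k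
      using that \<beta>\<gamma>[OF yY[OF that(2)]] by (auto simp: Let_def y_def[symmetric] split: if_splits)
    have "(\<Sum>k<s. \<gamma> (y k)) = (\<Sum>j\<in>Y. \<gamma> j)" by (rule sum.reindex_bij_betw[OF y])
    also have "\<dots> = (\<Sum>i<s. \<gamma> (\<sigma> i))" by (rule sum.reindex_bij_betw[OF \<sigma>, symmetric])
    also have "\<dots> = (\<Sum>i<s. \<alpha> i)" by (intro sum.cong) (auto simp: \<gamma>\<sigma>)
    finally show "(\<Sum>i<s. \<alpha> i) = (\<Sum>k<s. \<gamma> (y k))" by simp
  qed simp
  then have detB: "det ?B \<noteq> 0" using det by simp
  have Bentry: "?B $$ (i, k) = (if \<gamma> (y k) = \<alpha> i then jet_partial (Jet (y k) 0) (P i) \<eta> else 0)"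
    if "i < s" "k < s" for i k
    using that \<beta>\<gamma>[OF yY[OF that(2)]] by (auto simp: Let_def y_def[symmetric])
  have detBt: "det (transpose_mat ?B) \<noteq> 0" using detB det_transpose[of ?B s] by simp
  show thesis
  proof (rule that[OF Y])
    show "\<gamma> j + k \<le> \<alpha> i" if "i < s" "j \<in> Y" "depends_on U (P i) (Jet j k)" for i j k
      using dep[OF that] \<beta>\<gamma>[OF that(2)] by linarith
    show "card {j\<in>Y. \<gamma> j = h} = card {i. i < s \<and> \<alpha> i = h}" for h
    proof -
      have "{j\<in>Y. \<gamma> j = h} = \<sigma> ` {i. i < s \<and> \<alpha> i = h}"
        using \<sigma> \<gamma>\<sigma> unfolding bij_betw_def by (auto simp: image_iff)
      moreover have "inj_on \<sigma> {i. i < s \<and> \<alpha> i = h}"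
        using bij_betw_imp_inj_on[OF \<sigma>] by (rule inj_on_subset) auto
      ultimately show ?thesis by (simp add: card_image)
    qed
  next
    fix h i and v :: "nat \<Rightarrow> real"
    assume v: "\<And>j. j \<in> Y \<Longrightarrow> \<gamma> j = h \<Longrightarrow> (\<Sum>i\<in>{i. i < s \<and> \<alpha> i = h}. v i * jet_partial (Jet j 0) (P i) \<eta>) = 0"
      and i: "i < s" "\<alpha> i = h"
    define w where "w = vec s (\<lambda>i. if \<alpha> i = h then v i else 0)"
    have w: "w \<in> carrier_vec s" by (simp add: w_def)
    have "transpose_mat ?B *\<^sub>v w = 0\<^sub>v s"
    proof (rule eq_vecI)
      fix k assume "k < dim_vec (0\<^sub>v s :: real vec)"
      then have k: "k < s" by simp
      have "(transpose_mat ?B *\<^sub>v w) $ k = (\<Sum>i<s. ?B $$ (i, k) * (if \<alpha> i = h then v i else 0))"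
        using k by (simp add: scalar_prod_def lessThan_atLeast0 w_def)
      also have "\<dots> = 0"
      proof (cases "\<gamma> (y k) = h")
        case True
        have "(\<Sum>i<s. ?B $$ (i, k) * (if \<alpha> i = h then v i else 0)) =
            (\<Sum>i\<in>{i. i < s \<and> \<alpha> i = h}. v i * jet_partial (Jet (y k) 0) (P i) \<eta>)"
          by (rule sum.mono_neutral_cong_right) (use True k in \<open>auto simp: Bentry simp del: index_mat\<close>)
        then show ?thesis using v[OF yY[OF k] True] by simp
      next
        case False
        then show ?thesis by (intro sum.neutral) (use k in \<open>auto simp: Bentry simp del: index_mat\<close>)
      qed
      finally show "(transpose_mat ?B *\<^sub>v w) $ k = 0\<^sub>v s $ k" using k by simp
    qed simp
    then have "w = 0\<^sub>v s"
      using detBt det_0_iff_vec_prod_zero[of "transpose_mat ?B" s] w by auto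
    then have "w $ i = 0" using i by simp
    then show "v i = 0" using i by (simp add: w_def)
  qed
qed

end

section \<open>Solving a regular system level by level\<close>

text \<open>
  The coordinates that serve as parameters when the equations of level \<open>h\<close> are solved.
\<close>

definition level_coords :: "nat \<Rightarrow> nat set \<Rightarrow> (nat \<Rightarrow> nat) \<Rightarrow> nat \<Rightarrow> jet_coord set" where
  "level_coords n Y \<gamma> h = insert Time {Jet j k | j k. j < n \<and> (j \<in> Y \<longrightarrow> \<gamma> j < h)}"

lemma jet_box_override:
  assumes "q \<in> jet_box n C p \<epsilon>" "p \<in> jet_space n" "\<epsilon> > 0"
  shows "(\<lambda>c. if c \<in> F then p c else q c) \<in> jet_box n C p \<epsilon>"
  using assms by (auto simp: jet_box_def jet_space_def)

lemma not_depends_on_override: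
  assumes "finite F" and sub: "jet_box n C p \<epsilon> \<subseteq> U" and p: "p \<in> jet_space n" and \<epsilon>: "\<epsilon> > 0"
    and nd: "\<And>c. c \<in> F \<Longrightarrow> \<not> depends_on U f c" and q: "q \<in> jet_box n C p \<epsilon>"
  shows "f (\<lambda>c. if c \<in> F then p c else q c) = f q"
  using assms(1) nd
proof (induction F)
  case (insert d F)
  let ?q = "\<lambda>c. if c \<in> F then p c else q c"
  have eq: "(\<lambda>c. if c \<in> insert d F then p c else q c) = ?q(d := p d)" by auto
  have "?q \<in> U" using jet_box_override[OF q p \<epsilon>] sub by blast
  moreover have "?q(d := p d) \<in> U" unfolding eq[symmetric] using jet_box_override[OF q p \<epsilon>] sub by blast
  ultimately have "f (?q(d := p d)) = f ?q" using insert.prems[of d] unfolding depends_on_def by blast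
  then show ?case unfolding eq using insert by simp
qed simp

text \<open>
  Coordinates without influence on \<open>f\<close> can be frozen at their values at \<open>p\<close>, since a box
  contains the resulting points.
\<close>

lemma analytic_at_drop_coords:
  assumes C: "finite C" and f: "analytic_at (jet_box n K p \<epsilon>) p C f" and sub: "jet_box n K p \<epsilon> \<subseteq> U"
    and p: "p \<in> jet_space n" and \<epsilon>: "\<epsilon> > 0" and nd: "\<And>c. c \<in> C - C' \<Longrightarrow> \<not> depends_on U f c"
  shows "analytic_at (jet_box n K p \<epsilon>) p (C \<inter> C') f"
proof -
  let ?D = "jet_box n K p \<epsilon>" and ?\<psi> = "\<lambda>q c. if c \<in> C - C' then p c else q c"
  have pD: "p \<in> ?D" using p \<epsilon> by (simp add: jet_box_def)
  have fin: "finite (C \<inter> C')" using C by simp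
  have \<psi>p: "?\<psi> p = p" by auto
  have an: "analytic_at ?D p (C \<inter> C') (\<lambda>q. f (?\<psi> q))"
  proof (rule analytic_at_comp[where V = ?D and C = C and \<psi> = ?\<psi>, OF C _ fin pD])
    show "analytic_at ?D (?\<psi> p) C f" unfolding \<psi>p by (rule f)
    show "analytic_at ?D p (C \<inter> C') (\<lambda>q. ?\<psi> q c)" if "c \<in> C" for c
      using that fin by (cases "c \<in> C'") (auto intro: analytic_at_const analytic_at_coord)
    show "?\<psi> q \<in> ?D" if "q \<in> ?D" for q using jet_box_override[OF that p \<epsilon>] .
  qed
  have "eq_near ?D p (C \<inter> C') (\<lambda>q. f (?\<psi> q)) f"
    unfolding eq_near_def using not_depends_on_override[OF _ sub p \<epsilon> nd, of "C - C'"] C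
    by (intro exI[of _ 1]) auto
  then show ?thesis by (rule analytic_at_cong[OF an _ fin])
qed

text \<open>
  Recentre the expansion at points in the inner half of the box.
\<close>

lemma analytic_at_nearby:
  assumes "finite C" "analytic_at D p C f"
  shows "eventually (\<lambda>q. analytic_at D q C f) (near D p C)"
proof -
  obtain \<rho> M where \<rho>: "\<rho> > 0" and ps: "power_series_on D C p (\<lambda>_. \<rho>) f M"
    using assms(2) by (auto simp: analytic_at_def)
  have "analytic_at D q C f" if "in_box C p (\<lambda>_. \<rho> / 2) q" for q
  proof (rule analytic_atI[OF power_series_on_recenter[OF ps assms(1)] assms(1)])
    fix c assume c: "c \<in> C"
    show "\<rho> / 2 > 0" using \<rho> by simp
    have "\<bar>q c - p c\<bar> \<le> \<rho> / 2" using that c by (simp add: in_box_def)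
    then show "\<bar>q c - p c\<bar> + \<rho> / 2 \<le> \<rho>" by simp
  qed (use \<rho> in simp)
  then show ?thesis unfolding eventually_near using \<rho> by (intro exI[of _ "\<rho> / 2"]) auto
qed

text \<open>
  On each level the implicit function theorem for ideals applies to the equations and the
  variables of that level, with the coordinates of lower levels as parameters. Only finitely
  many germs are involved, so a single box carries all of them, and on it the algebraic ideal
  of the system is generated by the functions \<open>x_j - H j\<close>.
\<close>

theorem regular_obar_solved_form:
  assumes U: "jet_open n U" and P: "\<And>i. i < s \<Longrightarrow> differential_function n U (P i)" and \<eta>: "\<eta> \<in> U"
    and P0: "\<And>i. i < s \<Longrightarrow> P i \<eta> = 0"
    and reg: "regular_obar_system_at n s U P \<eta>"
  obtains Y \<gamma> K \<epsilon> H Q R where "Y \<subseteq> {..<n}" "card Y = s" "finite K" "\<epsilon> > 0" "jet_box n K \<eta> \<epsilon> \<subseteq> U"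
    "\<forall>j\<in>Y. differential_function n (jet_box n K \<eta> \<epsilon>) (H j)"
    "\<forall>j\<in>Y. depends_only_on (jet_box n K \<eta> \<epsilon>) (H j) (level_coords n Y \<gamma> (\<gamma> j))"
    "\<forall>j\<in>Y. \<forall>i<s. differential_function n (jet_box n K \<eta> \<epsilon>) (Q j i)"
    "\<forall>j\<in>Y. \<forall>i<s. differential_function n (jet_box n K \<eta> \<epsilon>) (R i j)"
    "\<forall>q\<in>jet_box n K \<eta> \<epsilon>. \<forall>j\<in>Y. q (Jet j 0) - H j q = (\<Sum>i<s. Q j i q * P i q)"
    "\<forall>q\<in>jet_box n K \<eta> \<epsilon>. \<forall>i<s. P i q = (\<Sum>j\<in>Y. R i j q * (q (Jet j 0) - H j q))"
proof -
  obtain Y and \<alpha> \<gamma> :: "nat \<Rightarrow> nat" where Y: "Y \<subseteq> {..<n}" "card Y = s"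
    and dep: "\<And>i j k. i < s \<Longrightarrow> j \<in> Y \<Longrightarrow> depends_on U (P i) (Jet j k) \<Longrightarrow> \<gamma> j + k \<le> \<alpha> i"
    and card: "\<And>h. card {j\<in>Y. \<gamma> j = h} = card {i. i < s \<and> \<alpha> i = h}"
    and nondeg: "\<And>h v i. (\<And>j. j \<in> Y \<Longrightarrow> \<gamma> j = h \<Longrightarrow>
        (\<Sum>i\<in>{i. i < s \<and> \<alpha> i = h}. v i * jet_partial (Jet j 0) (P i) \<eta>) = 0) \<Longrightarrow> i < s \<Longrightarrow> \<alpha> i = h \<Longrightarrow> v i = 0"
    by (rule regular_obar_levels[OF U P \<eta> P0 reg]) blast+
  have finY: "finite Y" using Y(1) finite_subset by blast
  have \<eta>n: "\<eta> \<in> jet_space n" using jet_open_subset[OF U] \<eta> by blast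
  obtain K0 \<epsilon>0 where K0: "finite K0" "\<epsilon>0 > 0" and V0U: "jet_box n K0 \<eta> \<epsilon>0 \<subseteq> U"
    by (rule jet_open_contains_box[OF U \<eta>]) blast
  let ?D = "jet_box n K0 \<eta> \<epsilon>0" and ?J = "jet_coords n"
  have V0: "jet_open n ?D" by (rule jet_open_jet_box[OF K0(1)])
  have \<eta>0: "\<eta> \<in> ?D" using \<eta>n K0 by (simp add: jet_box_def)
  note nb = jet_open_update_at[OF V0 \<eta>0]
  have "\<forall>i\<in>{..<s}. \<exists>C. finite C \<and> C \<subseteq> ?J \<and> (\<forall>c. depends_on U (P i) c \<longrightarrow> c \<in> C) \<and> analytic_at U \<eta> C (P i)"
  proof
    fix i assume "i \<in> {..<s}"
    then have "differential_function n U (P i)" using P by simp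
    then show "\<exists>C. finite C \<and> C \<subseteq> ?J \<and> (\<forall>c. depends_on U (P i) c \<longrightarrow> c \<in> C) \<and> analytic_at U \<eta> C (P i)"
      by (rule depends_on_finite[OF U]) (use \<eta> in blast)
  qed
  from bchoice[OF this] obtain Ci where Ci: "\<And>i. i < s \<Longrightarrow> finite (Ci i)" "\<And>i. i < s \<Longrightarrow> Ci i \<subseteq> ?J"
    "\<And>i c. i < s \<Longrightarrow> depends_on U (P i) c \<Longrightarrow> c \<in> Ci i" "\<And>i. i < s \<Longrightarrow> analytic_at U \<eta> (Ci i) (P i)"
    by auto
  let ?X = "\<lambda>h. (\<lambda>j. Jet j 0) ` {j\<in>Y. \<gamma> j = h}" and ?I = "\<lambda>h. {i. i < s \<and> \<alpha> i = h}"
  \<comment> \<open>\<open>K\<close> contains all coordinates that occur; \<open>C h\<close> those that belong to the equations of level \<open>h\<close>.\<close>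
  define K where "K = (\<Union>i<s. Ci i) \<union> (\<lambda>j. Jet j 0) ` Y"
  define C where "C h = K \<inter> (level_coords n Y \<gamma> h \<union> ?X h)" for h
  have "(\<Union>i<s. Ci i) \<subseteq> ?J" using Ci(2) by blast
  moreover have "(\<lambda>j. Jet j 0) ` Y \<subseteq> ?J" using Y(1) by (auto simp: jet_coords_def)
  ultimately have K: "finite K" "K \<subseteq> ?J" using Ci(1) finY by (auto simp: K_def)
  have C: "finite (C h)" "C h \<subseteq> ?J" "C h \<subseteq> K" "?X h \<subseteq> C h" "C h - ?X h \<subseteq> level_coords n Y \<gamma> h" for h
    using K by (auto simp: C_def K_def)
  have PC: "analytic_at ?D \<eta> (C (\<alpha> i)) (P i)" if i: "i < s" for i
  proof -
    \<comment> \<open>Coordinates that occur in the expansion of an equation without influencing it are removed.\<close>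
    have mem: "c \<in> level_coords n Y \<gamma> (\<alpha> i) \<union> ?X (\<alpha> i)" if d: "depends_on U (P i) c" for c
    proof (cases c)
      case Time
      then show ?thesis by (simp add: level_coords_def)
    next
      case (Jet j k)
      have "j < n" using Ci(2,3)[OF i] d Jet by (auto simp: jet_coords_def)
      moreover have "\<gamma> j + k \<le> \<alpha> i" if "j \<in> Y" using dep[OF i that] d Jet by simp
      ultimately show ?thesis using Jet by (cases "\<gamma> j < \<alpha> i") (auto simp: level_coords_def)
    qed
    have "analytic_at ?D \<eta> (Ci i \<inter> (level_coords n Y \<gamma> (\<alpha> i) \<union> ?X (\<alpha> i))) (P i)"
      by (rule analytic_at_drop_coords[OF Ci(1)[OF i] analytic_at_restrict[OF Ci(4)[OF i] V0U] V0U \<eta>n K0(2)])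
        (use mem in blast)
    then show ?thesis
      by (rule analytic_at_superset) (use i C(1) in \<open>auto simp: C_def K_def\<close>)
  qed
  have ex: "\<exists>G. (\<forall>c\<in>?X h. analytic_at ?D \<eta> (C h - ?X h) (G c) \<and> (\<lambda>q. q c - G c q) \<in> germ_ideal ?D \<eta> (C h) (?I h) P) \<and>
    (\<forall>i\<in>?I h. P i \<in> germ_ideal ?D \<eta> (C h) (?X h) (\<lambda>c q. q c - G c q))" for h
  proof (rule implicit_functions_germ_ideal[OF \<eta>0 nb _ C(1) C(4) C(2)])
    have "inj_on (\<lambda>j. Jet j 0) {j\<in>Y. \<gamma> j = h}" by (auto simp: inj_on_def)
    then show "card (?X h) = card (?I h)" using card[of h] by (simp add: card_image)
    fix v i assume v: "\<And>c. c \<in> ?X h \<Longrightarrow> (\<Sum>i\<in>?I h. v i * jet_partial c (P i) \<eta>) = 0" and i: "i \<in> ?I h"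
    show "v i = 0" by (rule nondeg[of h v i]) (use v i in auto)
  qed (use PC P0 in auto)
  have "\<exists>G. \<forall>h. (\<forall>c\<in>?X h. analytic_at ?D \<eta> (C h - ?X h) (G h c) \<and>
      (\<lambda>q. q c - G h c q) \<in> germ_ideal ?D \<eta> (C h) (?I h) P) \<and>
    (\<forall>i\<in>?I h. P i \<in> germ_ideal ?D \<eta> (C h) (?X h) (\<lambda>c q. q c - G h c q))"
    by (rule choice, rule allI, rule ex)
  then obtain G where Gall: "\<forall>h. (\<forall>c\<in>?X h. analytic_at ?D \<eta> (C h - ?X h) (G h c) \<and>
      (\<lambda>q. q c - G h c q) \<in> germ_ideal ?D \<eta> (C h) (?I h) P) \<and>
    (\<forall>i\<in>?I h. P i \<in> germ_ideal ?D \<eta> (C h) (?X h) (\<lambda>c q. q c - G h c q))" ..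
  note G1 = bspec[OF conjunct1[OF spec[OF Gall]]] and G2 = bspec[OF conjunct2[OF spec[OF Gall]]]
  note G = conjunct1[OF G1] conjunct2[OF G1] G2
  define H where "H j = G (\<gamma> j) (Jet j 0)" for j
  have H: "analytic_at ?D \<eta> (C (\<gamma> j) - ?X (\<gamma> j)) (H j)" if "j \<in> Y" for j
    unfolding H_def by (rule G(1)) (use that in simp)
  have "\<forall>j\<in>Y. \<exists>Q. (\<forall>i<s. analytic_at ?D \<eta> K (Q i)) \<and>
      eventually (\<lambda>q. q (Jet j 0) - H j q = (\<Sum>i<s. Q i q * P i q)) (near ?D \<eta> K)"
  proof
    fix j assume j: "j \<in> Y"
    have "(\<lambda>q. q (Jet j 0) - H j q) \<in> germ_ideal ?D \<eta> (C (\<gamma> j)) (?I (\<gamma> j)) P"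
      unfolding H_def by (rule G(2)) (use j in simp)
    then have "(\<lambda>q. q (Jet j 0) - H j q) \<in> germ_ideal ?D \<eta> K (?I (\<gamma> j)) P"
      by (rule germ_ideal_superset) (use C K in auto)
    then have "(\<lambda>q. q (Jet j 0) - H j q) \<in> germ_ideal ?D \<eta> K {..<s} P"
      by (rule germ_ideal_trans) (use K in \<open>auto intro!: germ_ideal_mem\<close>)
    then show "\<exists>Q. (\<forall>i<s. analytic_at ?D \<eta> K (Q i)) \<and>
      eventually (\<lambda>q. q (Jet j 0) - H j q = (\<Sum>i<s. Q i q * P i q)) (near ?D \<eta> K)"
      by (rule germ_idealE) auto
  qed
  from bchoice[OF this] obtain Q where Q: "\<And>j i. j \<in> Y \<Longrightarrow> i < s \<Longrightarrow> analytic_at ?D \<eta> K (Q j i)"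
    "\<And>j. j \<in> Y \<Longrightarrow> eventually (\<lambda>q. q (Jet j 0) - H j q = (\<Sum>i<s. Q j i q * P i q)) (near ?D \<eta> K)"
    by auto
  have "\<forall>i\<in>{..<s}. \<exists>R. (\<forall>j\<in>Y. analytic_at ?D \<eta> K (R j)) \<and>
      eventually (\<lambda>q. P i q = (\<Sum>j\<in>Y. R j q * (q (Jet j 0) - H j q))) (near ?D \<eta> K)"
  proof
    fix i assume i: "i \<in> {..<s}"
    have "P i \<in> germ_ideal ?D \<eta> (C (\<alpha> i)) (?X (\<alpha> i)) (\<lambda>c q. q c - G (\<alpha> i) c q)"
      by (rule G(3)) (use i in simp)
    then have "P i \<in> germ_ideal ?D \<eta> K (?X (\<alpha> i)) (\<lambda>c q. q c - G (\<alpha> i) c q)"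
      by (rule germ_ideal_superset) (use C K in auto)
    then have "P i \<in> germ_ideal ?D \<eta> K Y (\<lambda>j q. q (Jet j 0) - H j q)"
    proof (rule germ_ideal_trans)
      fix c assume "c \<in> ?X (\<alpha> i)"
      then obtain j where j: "j \<in> Y" "\<gamma> j = \<alpha> i" "c = Jet j 0" by auto
      then have "(\<lambda>q. q c - G (\<alpha> i) c q) = (\<lambda>q. q (Jet j 0) - H j q)" by (simp add: H_def)
      then show "(\<lambda>q. q c - G (\<alpha> i) c q) \<in> germ_ideal ?D \<eta> K Y (\<lambda>j q. q (Jet j 0) - H j q)"
        using germ_ideal_mem[OF finY j(1), of "\<lambda>j q. q (Jet j 0) - H j q"] by simp
    qed (use K in simp)
    then show "\<exists>R. (\<forall>j\<in>Y. analytic_at ?D \<eta> K (R j)) \<and>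
      eventually (\<lambda>q. P i q = (\<Sum>j\<in>Y. R j q * (q (Jet j 0) - H j q))) (near ?D \<eta> K)"
      by (rule germ_idealE) auto
  qed
  from bchoice[OF this] obtain R where R: "\<And>i j. i < s \<Longrightarrow> j \<in> Y \<Longrightarrow> analytic_at ?D \<eta> K (R i j)"
    "\<And>i. i < s \<Longrightarrow> eventually (\<lambda>q. P i q = (\<Sum>j\<in>Y. R i j q * (q (Jet j 0) - H j q))) (near ?D \<eta> K)"
    by auto
  have "\<forall>j\<in>Y. \<exists>\<rho>. \<rho> > 0 \<and> (\<exists>M. power_series_on ?D (C (\<gamma> j) - ?X (\<gamma> j)) \<eta> (\<lambda>_. \<rho>) (H j) M)"
    using H unfolding analytic_at_def by blast
  from bchoice[OF this] obtain \<rho> where \<rho>: "\<And>j. j \<in> Y \<Longrightarrow> \<rho> j > 0"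
    "\<And>j. j \<in> Y \<Longrightarrow> \<exists>M. power_series_on ?D (C (\<gamma> j) - ?X (\<gamma> j)) \<eta> (\<lambda>_. \<rho> j) (H j) M"
    by blast
  have HK: "analytic_at ?D \<eta> K (H j)" if "j \<in> Y" for j
    by (rule analytic_at_superset[OF H[OF that]]) (use C(3)[of "\<gamma> j"] K in blast)+
  have box: "eventually (\<lambda>q. in_box K \<eta> (\<lambda>_. \<rho> j) q) (near ?D \<eta> K)" if "j \<in> Y" for j
    unfolding eventually_near using \<rho>(1)[OF that] by blast
  have "eventually (\<lambda>q. (\<forall>j\<in>Y. analytic_at ?D q K (H j)) \<and> (\<forall>j\<in>Y. \<forall>i\<in>{..<s}. analytic_at ?D q K (Q j i)) \<and>
      (\<forall>j\<in>Y. \<forall>i\<in>{..<s}. analytic_at ?D q K (R i j)) \<and>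
      (\<forall>j\<in>Y. q (Jet j 0) - H j q = (\<Sum>i<s. Q j i q * P i q)) \<and>
      (\<forall>i\<in>{..<s}. P i q = (\<Sum>j\<in>Y. R i j q * (q (Jet j 0) - H j q))) \<and>
      (\<forall>j\<in>Y. in_box K \<eta> (\<lambda>_. \<rho> j) q)) (near ?D \<eta> K)"
    by (intro eventually_conj eventually_ball_finite finY ballI finite_lessThan analytic_at_nearby K(1) HK Q R box) auto
  then obtain \<epsilon>1 where \<epsilon>1: "\<epsilon>1 > 0" and near: "\<And>q. q \<in> ?D \<Longrightarrow> in_box K \<eta> (\<lambda>_. \<epsilon>1) q \<Longrightarrow>
      (\<forall>j\<in>Y. analytic_at ?D q K (H j)) \<and> (\<forall>j\<in>Y. \<forall>i\<in>{..<s}. analytic_at ?D q K (Q j i)) \<and>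
      (\<forall>j\<in>Y. \<forall>i\<in>{..<s}. analytic_at ?D q K (R i j)) \<and>
      (\<forall>j\<in>Y. q (Jet j 0) - H j q = (\<Sum>i<s. Q j i q * P i q)) \<and>
      (\<forall>i\<in>{..<s}. P i q = (\<Sum>j\<in>Y. R i j q * (q (Jet j 0) - H j q))) \<and>
      (\<forall>j\<in>Y. in_box K \<eta> (\<lambda>_. \<rho> j) q)"
    unfolding eventually_near by (elim exE conjE) (rule that, assumption, blast)
  define \<epsilon> where "\<epsilon> = min \<epsilon>0 \<epsilon>1"
  let ?K = "K0 \<union> K"
  let ?B = "jet_box n ?K \<eta> \<epsilon>"
  have \<epsilon>: "\<epsilon> > 0" using K0 \<epsilon>1 by (simp add: \<epsilon>_def)
  have finK: "finite ?K" using K0 K by simp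
  have V: "jet_open n ?B" by (rule jet_open_jet_box[OF finK])
  have VV0: "?B \<subseteq> ?D" by (auto simp: jet_box_def \<epsilon>_def)
  have nearV: "in_box K \<eta> (\<lambda>_. \<epsilon>1) q" if "q \<in> ?B" for q
    using that by (auto simp: jet_box_def in_box_def \<epsilon>_def less_imp_le)
  note near' = near[OF subsetD[OF VV0] nearV]
  have diff: "differential_function n ?B f" if "\<And>q. q \<in> ?B \<Longrightarrow> analytic_at ?D q K f" for f
    by (rule differential_functionI[OF V K]) (rule analytic_at_restrict[OF that VV0])
  have t1: "\<forall>j\<in>Y. differential_function n ?B (H j)" using near' by (auto intro!: diff)
  have t2: "\<forall>j\<in>Y. \<forall>i<s. differential_function n ?B (Q j i)" using near' by (auto intro!: diff)
  have t3: "\<forall>j\<in>Y. \<forall>i<s. differential_function n ?B (R i j)" using near' by (auto intro!: diff)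
  have t4: "\<forall>q\<in>?B. \<forall>j\<in>Y. q (Jet j 0) - H j q = (\<Sum>i<s. Q j i q * P i q)" using near' by blast
  have t5: "\<forall>q\<in>?B. \<forall>i<s. P i q = (\<Sum>j\<in>Y. R i j q * (q (Jet j 0) - H j q))" using near' by blast
  have t6: "\<forall>j\<in>Y. depends_only_on ?B (H j) (level_coords n Y \<gamma> (\<gamma> j))"
    unfolding depends_only_on_def
  proof (intro ballI impI)
    fix j q q' assume j: "j \<in> Y" and q: "q \<in> ?B" "q' \<in> ?B" and eq: "\<forall>c\<in>level_coords n Y \<gamma> (\<gamma> j). q c = q' c"
    obtain M where M: "power_series_on ?D (C (\<gamma> j) - ?X (\<gamma> j)) \<eta> (\<lambda>_. \<rho> j) (H j) M" using \<rho>(2)[OF j] by blast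
    have "in_box K \<eta> (\<lambda>_. \<rho> j) q" using near'[OF q(1) q(1)] j by blast
    then show "H j q = H j q'"
      by (intro power_series_on_depends[OF M]) (use q VV0 C(3,5)[of "\<gamma> j"] eq in \<open>auto simp: in_box_def\<close>)
  qed
  show thesis by (rule that[OF Y finK \<epsilon> subset_trans[OF VV0 V0U] t1 t6 t2 t3 t4 t5])
qed

text \<open>
  The blocks of the parametrization are the levels, shifted by one to make room for the flat
  output.
\<close>

theorem regular_obar_imp_lazy_flat:
  assumes U: "jet_open n U" and P: "\<And>i. i < s \<Longrightarrow> differential_function n U (P i)" and \<eta>: "\<eta> \<in> U"
    and P0: "\<And>i. i < s \<Longrightarrow> P i \<eta> = 0"
    and reg: "regular_obar_system_at n s U P \<eta>"
  shows "\<exists>Z. lazy_flat_parametrization n s U P \<eta> Z"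
proof -
  obtain Y \<gamma> K \<epsilon> H Q where Y: "Y \<subseteq> {..<n}" and K: "finite K" "\<epsilon> > 0" "jet_box n K \<eta> \<epsilon> \<subseteq> U"
    and H: "\<forall>j\<in>Y. differential_function n (jet_box n K \<eta> \<epsilon>) (H j)"
      "\<forall>j\<in>Y. depends_only_on (jet_box n K \<eta> \<epsilon>) (H j) (level_coords n Y \<gamma> (\<gamma> j))"
    and Q: "\<forall>j\<in>Y. \<forall>i<s. differential_function n (jet_box n K \<eta> \<epsilon>) (Q j i)"
      "\<forall>q\<in>jet_box n K \<eta> \<epsilon>. \<forall>j\<in>Y. q (Jet j 0) - H j q = (\<Sum>i<s. Q j i q * P i q)"
    by (rule regular_obar_solved_form[OF U P \<eta> P0 reg]) blast+
  have finY: "finite Y" using Y finite_subset by blast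
  define \<Xi> where "\<Xi> h = (case h of 0 \<Rightarrow> {..<n} - Y | Suc g \<Rightarrow> {j\<in>Y. \<gamma> j = g})" for h
  let ?r = "Suc (\<Sum>j\<in>Y. \<gamma> j)"
  have le: "\<gamma> j \<le> (\<Sum>j\<in>Y. \<gamma> j)" if "j \<in> Y" for j using that finY by (intro member_le_sum) auto
  have below: "(\<Union>h'<Suc g. \<Xi> h') = {j. j < n \<and> (j \<in> Y \<longrightarrow> \<gamma> j < g)}" for g
    using Y by (auto simp: \<Xi>_def lessThan_Suc_eq_insert_0)
  have "lazy_flat_parametrization n s U P \<eta> ({..<n} - Y)"
    unfolding lazy_flat_parametrization_def
  proof (intro exI[of _ ?r] exI[of _ \<Xi>] exI[of _ "jet_box n K \<eta> \<epsilon>"] conjI allI impI ballI)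
    show "(\<Union>h\<le>?r. \<Xi> h) = {..<n}"
    proof (rule subset_antisym)
      show "(\<Union>h\<le>?r. \<Xi> h) \<subseteq> {..<n}" using Y by (auto simp: \<Xi>_def split: nat.splits)
      show "{..<n} \<subseteq> (\<Union>h\<le>?r. \<Xi> h)"
      proof
        fix j assume j: "j \<in> {..<n}"
        show "j \<in> (\<Union>h\<le>?r. \<Xi> h)"
        proof (cases "j \<in> Y")
          case True
          then show ?thesis using le[OF True] by (intro UN_I[of "Suc (\<gamma> j)"]) (auto simp: \<Xi>_def)
        next
          case False
          then show ?thesis using j by (intro UN_I[of 0]) (auto simp: \<Xi>_def)
        qed
      qed
    qed
    show "disjoint_family_on \<Xi> {..?r}"
      unfolding disjoint_family_on_def \<Xi>_def by (auto split: nat.splits)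
    show "jet_open n (jet_box n K \<eta> \<epsilon>)" by (rule jet_open_jet_box[OF K(1)])
    show "\<eta> \<in> jet_box n K \<eta> \<epsilon>" using jet_open_subset[OF U] \<eta> K(2) by (auto simp: jet_box_def)
  next
    fix h j assume h: "0 < h \<and> h \<le> ?r" and j: "j \<in> \<Xi> h"
    then obtain g where g: "h = Suc g" by (cases h) auto
    with j have j: "j \<in> Y" "\<gamma> j = g" by (auto simp: \<Xi>_def)
    have S: "insert Time {Jet j k | j k. j \<in> (\<Union>h'<h. \<Xi> h')} = level_coords n Y \<gamma> g"
      unfolding g below level_coords_def by auto
    show "\<exists>H. differential_function n (jet_box n K \<eta> \<epsilon>) H \<and>
        depends_only_on (jet_box n K \<eta> \<epsilon>) H (insert Time {Jet j k | j k. j \<in> (\<Union>h'<h. \<Xi> h')}) \<and>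
        (\<lambda>p. p (Jet j 0) - H p) \<in> algebraic_ideal n s (jet_box n K \<eta> \<epsilon>) P"
      unfolding S
    proof (intro exI[of _ "H j"] conjI)
      show "(\<lambda>p. p (Jet j 0) - H j p) \<in> algebraic_ideal n s (jet_box n K \<eta> \<epsilon>) P"
        unfolding algebraic_ideal_def using Q j(1) by (intro CollectI exI[of _ "Q j"]) blast
    qed (use H j in auto)
  qed (use K in \<open>auto simp: \<Xi>_def\<close>)
  then show ?thesis by blast
qed

section \<open>Flatness\<close>

text \<open>
  The lift of a jet \<open>w\<close> of the flat output to a point of the diffiety, level by level: stage 0
  fills in the free variables, and stage \<open>l + 1\<close> fills in the variables of level \<open>l\<close> and their
  derivatives, by evaluation of \<open>d_t^k (H j)\<close> at the preceding stage. Coordinates that are not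
  yet known have their values at \<open>\<eta>\<close>, to give the functions \<open>H j\<close> a full point of their domain
  as argument. The index map \<open>\<iota>\<close> renumbers the free variables.
\<close>

primrec lift_stage ::
    "nat \<Rightarrow> nat set \<Rightarrow> (nat \<Rightarrow> nat) \<Rightarrow> (nat \<Rightarrow> jet \<Rightarrow> real) \<Rightarrow> (nat \<Rightarrow> nat) \<Rightarrow> jet \<Rightarrow> nat \<Rightarrow> jet \<Rightarrow> jet" where
  "lift_stage n Y \<gamma> H \<iota> \<eta> 0 w = (\<lambda>c. case c of
     Time \<Rightarrow> w Time
   | Jet j k \<Rightarrow> if j < n \<and> j \<notin> Y then w (Jet (\<iota> j) k) else \<eta> c)"
| "lift_stage n Y \<gamma> H \<iota> \<eta> (Suc l) w = (\<lambda>c. case c of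
     Time \<Rightarrow> w Time
   | Jet j k \<Rightarrow> if j \<in> Y \<and> \<gamma> j = l then (total_deriv n ^^ k) (H j) (lift_stage n Y \<gamma> H \<iota> \<eta> l w)
                else lift_stage n Y \<gamma> H \<iota> \<eta> l w c)"

definition jet_projection :: "nat \<Rightarrow> (nat \<Rightarrow> nat) \<Rightarrow> jet \<Rightarrow> jet" where
  "jet_projection m \<zeta> p = (\<lambda>c. case c of Time \<Rightarrow> p Time | Jet i k \<Rightarrow> if i < m then p (Jet (\<zeta> i) k) else 0)"

lemma lift_stage_Time [simp]: "lift_stage n Y \<gamma> H \<iota> \<eta> l w Time = w Time"
  by (cases l) auto

lemma total_deriv_coord:
  assumes "jet_open n V" "q \<in> V" "c \<in> jet_coords n"
  shows "total_deriv n (\<lambda>q. q c) q = jet_velocity q c"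
  by (rule total_deriv_unique[OF assms(1) differential_function_coord[OF assms(1)] assms(2)])
    (use assms(3) in \<open>auto simp: jet_line_def intro!: derivative_eq_intros\<close>)

lemma depends_only_iterated:
  assumes V: "jet_open n V" and f: "differential_function n V f" and S: "depends_only_on V f S"
    and closed: "\<And>j k. Jet j k \<in> S \<Longrightarrow> Jet j (Suc k) \<in> S"
  shows "depends_only_on V ((total_deriv n ^^ k) f) S"
  by (induction k) (auto intro: S depends_only_total_deriv[OF V _ _ closed] differential_function_iterated[OF V f])

lemma jet_space_open: "jet_open n (jet_space n)"
  by simp

text \<open>
  Near \<open>\<eta>\<close> the diffiety is the graph \<open>x_j^(k) = d_t^k (H j)\<close>, and the isomorphism is its
  projection \<open>\<phi>\<close> to the free variables, with the last stage of the lift as inverse. The lift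
  is defined where all of its stages stay inside the box \<open>V\<close>. This is an open condition,
  because \<open>V\<close> restricts finitely many coordinates. The chain rule gives compatibility of the
  lift with the derivations. Compatibility of \<open>\<phi>\<close> follows from it: a function on the diffiety
  is pulled back by the lift, where all functions live on open sets of a jet space.
\<close>

theorem solved_form_imp_flat:
  assumes V_def: "V = jet_box n K \<eta> \<epsilon>" and \<eta>: "\<eta> \<in> diffiety n s U P" and U: "jet_open n U"
    and Y: "Y \<subseteq> {..<n}" and K: "finite K" and \<epsilon>: "\<epsilon> > 0" and VU: "V \<subseteq> U"
    and H: "\<And>j. j \<in> Y \<Longrightarrow> differential_function n V (H j)"
      "\<And>j. j \<in> Y \<Longrightarrow> depends_only_on V (H j) (level_coords n Y \<gamma> (\<gamma> j))"
    and char: "\<And>p. p \<in> V \<Longrightarrow> p \<in> diffiety n s U P \<longleftrightarrow> (\<forall>j\<in>Y. \<forall>k. p (Jet j k) = (total_deriv n ^^ k) (H j) p)"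
  shows "flat_at n s U P \<eta>"
proof -
  have finY: "finite Y" using Y finite_subset by blast
  have V: "jet_open n V" unfolding V_def by (rule jet_open_jet_box[OF K])
  have \<eta>n: "\<eta> \<in> jet_space n" using \<eta> jet_open_subset[OF U] by (auto simp: diffiety_def)
  have \<eta>V: "\<eta> \<in> V" using \<eta>n \<epsilon> by (simp add: V_def jet_box_def)
  have Vn: "V \<subseteq> jet_space n" by (rule jet_open_subset[OF V])
  define m where "m = card ({..<n} - Y)"
  obtain \<zeta> where \<zeta>: "bij_betw \<zeta> {..<m} ({..<n} - Y)"
    using ex_bij_betw_nat_finite[of "{..<n} - Y"] by (auto simp: m_def lessThan_atLeast0)
  define \<iota> where "\<iota> = inv_into {..<m} \<zeta>"
  have \<iota>: "\<iota> j < m" "\<zeta> (\<iota> j) = j" if "j < n" "j \<notin> Y" for j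
    using \<zeta> that inv_into_into[of j \<zeta> "{..<m}"] f_inv_into_f[of j \<zeta> "{..<m}"]
    by (auto simp: \<iota>_def bij_betw_def)
  have \<zeta>m: "\<zeta> i < n" "\<zeta> i \<notin> Y" "\<iota> (\<zeta> i) = i" if "i < m" for i
    using bij_betwE[OF \<zeta>] that inv_into_f_f[OF bij_betw_imp_inj_on[OF \<zeta>], of i] by (auto simp: \<iota>_def)
  let ?F = "\<lambda>j k. (total_deriv n ^^ k) (H j)" and ?S = "level_coords n Y \<gamma>"
  define \<psi> where "\<psi> = lift_stage n Y \<gamma> H \<iota> \<eta>"
  let ?\<phi> = "jet_projection m \<zeta>"
  have \<psi>0: "\<psi> 0 w (Jet j k) = (if j < n \<and> j \<notin> Y then w (Jet (\<iota> j) k) else \<eta> (Jet j k))" for w j k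
    by (simp add: \<psi>_def)
  have \<psi>S: "\<psi> (Suc l) w (Jet j k) = (if j \<in> Y \<and> \<gamma> j = l then ?F j k (\<psi> l w) else \<psi> l w (Jet j k))" for l w j k
    by (simp add: \<psi>_def)
  have \<psi>T: "\<psi> l w Time = w Time" for l w by (simp add: \<psi>_def)
  have closed: "Jet j (Suc k) \<in> ?S l" if "Jet j k \<in> ?S l" for j k l
    using that by (auto simp: level_coords_def)
  have F: "differential_function n V (?F j k)" "depends_only_on V (?F j k) (?S (\<gamma> j))" if "j \<in> Y" for j k
    using differential_function_iterated[OF V H(1)[OF that]] depends_only_iterated[OF V H[OF that] closed] by auto
  have \<psi>n: "\<psi> l w \<in> jet_space n" if "w \<in> jet_space m" for l w
  proof (induction l)
    case 0
    show ?case unfolding jet_space_def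
    proof (intro CollectI allI impI)
      fix c assume "c \<notin> jet_coords n"
      then show "\<psi> 0 w c = 0" using \<eta>n by (cases c) (auto simp: \<psi>0 jet_coords_def jet_space_def)
    qed
  next
    case (Suc l)
    show ?case unfolding jet_space_def
    proof (intro CollectI allI impI)
      fix c assume "c \<notin> jet_coords n"
      then show "\<psi> (Suc l) w c = 0" using Suc Y by (cases c) (auto simp: \<psi>S jet_coords_def jet_space_def)
    qed
  qed
  \<comment> \<open>Openness of \<open>B l\<close> makes stage \<open>l + 1\<close> a differential function there, and this makes \<open>B (l + 1)\<close> open.\<close>
  define B where "B l = {w\<in>jet_space m. \<forall>l'\<le>l. \<psi> l' w \<in> V}" for l
  have B_Suc: "B (Suc l) = {w\<in>B l. \<psi> (Suc l) w \<in> V}" for l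
    by (auto simp: B_def le_Suc_eq)
  have Bmono: "B l' \<subseteq> B l" if "l \<le> l'" for l l' using that by (auto simp: B_def)
  have Bm: "w \<in> jet_space m" if "w \<in> B l" for l w using that by (simp add: B_def)
  have BV: "\<psi> l w \<in> V" if "w \<in> B l" for l w using that by (simp add: B_def)
  have B: "jet_open m (B l) \<and> (\<forall>c. differential_function m (B l) (\<lambda>w. \<psi> l w c))" for l
  proof (induction l)
    case 0
    have d: "differential_function m (jet_space m) (\<lambda>w. \<psi> 0 w c)" for c
    proof (cases c)
      case Time
      then show ?thesis by (simp add: \<psi>T differential_function_coord[OF jet_space_open])
    next
      case (Jet j k)
      then show ?thesis
        by (cases "j < n \<and> j \<notin> Y") (auto simp: \<psi>0 intro: differential_function_coord[OF jet_space_open] differential_function_const[OF jet_space_open])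
    qed
    have "B 0 = {w\<in>jet_space m. \<psi> 0 w \<in> V}" by (simp add: B_def)
    moreover have "jet_open m {w\<in>jet_space m. \<psi> 0 w \<in> V}"
      by (rule jet_open_vimage[OF jet_space_open V d \<psi>n])
    ultimately show ?case using d by (auto intro: differential_function_subset)
  next
    case (Suc l)
    then have o: "jet_open m (B l)" and d: "\<And>c. differential_function m (B l) (\<lambda>w. \<psi> l w c)" by auto
    have d': "differential_function m (B l) (\<lambda>w. \<psi> (Suc l) w c)" for c
    proof (cases c)
      case Time
      then show ?thesis by (simp add: \<psi>T differential_function_coord[OF o])
    next
      case (Jet j k)
      show ?thesis
      proof (cases "j \<in> Y \<and> \<gamma> j = l")
        case True
        then have "differential_function m (B l) (\<lambda>w. ?F j k (\<psi> l w))"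
          by (intro differential_function_comp[OF o V F(1) d BV]) auto
        then show ?thesis using Jet True by (simp add: \<psi>S)
      next
        case False
        then show ?thesis using Jet d by (auto simp: \<psi>S)
      qed
    qed
    have "jet_open m (B (Suc l))" unfolding B_Suc
      by (rule jet_open_vimage[OF o V d' \<psi>n[OF Bm]])
    then show ?case using d' by (auto simp: B_Suc intro: differential_function_subset)
  qed
  then have Bo: "\<And>l. jet_open m (B l)" and Bd: "\<And>l c. differential_function m (B l) (\<lambda>w. \<psi> l w c)" by auto
  have vel: "\<forall>w\<in>B l. \<forall>c\<in>?S l. total_deriv m (\<lambda>w. \<psi> l w c) w = jet_velocity (\<psi> l w) c" for l
  proof (induction l)
    case 0
    show ?case
    proof (intro ballI)
      fix w c assume w: "w \<in> B 0" and c: "c \<in> ?S 0"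
      show "total_deriv m (\<lambda>w. \<psi> 0 w c) w = jet_velocity (\<psi> 0 w) c"
      proof (cases c)
        case Time
        then show ?thesis
          using total_deriv_coord[OF jet_space_open Bm[OF w], of Time]
          by (simp add: \<psi>T jet_coords_def jet_velocity_def)
      next
        case (Jet j k)
        then have j: "j < n" "j \<notin> Y" using c by (auto simp: level_coords_def)
        then show ?thesis
          using total_deriv_coord[OF jet_space_open Bm[OF w], of "Jet (\<iota> j) k"] \<iota>(1)[OF j] Jet
          by (simp add: \<psi>0 jet_coords_def jet_velocity_def)
      qed
    qed
  next
    case (Suc l)
    show ?case
    proof (intro ballI)
      fix w c assume w: "w \<in> B (Suc l)" and c: "c \<in> ?S (Suc l)"
      then have wl: "w \<in> B l" using Bmono[of l "Suc l"] by auto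
      show "total_deriv m (\<lambda>w. \<psi> (Suc l) w c) w = jet_velocity (\<psi> (Suc l) w) c"
      proof (cases c)
        case Time
        then show ?thesis
          using total_deriv_coord[OF jet_space_open Bm[OF w], of Time]
          by (simp add: \<psi>T jet_coords_def jet_velocity_def)
      next
        case (Jet j k)
        show ?thesis
        proof (cases "j \<in> Y \<and> \<gamma> j = l")
          case True
          then have j: "j \<in> Y" "\<gamma> j = l" by auto
          have "total_deriv m (\<lambda>w. ?F j k (\<psi> l w)) w = total_deriv n (?F j k) (\<psi> l w)"
            using Suc.IH wl
            by (intro total_deriv_chain[OF Bo V F[OF j(1)] Bd BV wl]) (auto simp: j)
          then show ?thesis using Jet j by (simp add: \<psi>S jet_velocity_def)
        next
          case False
          then have "c \<in> ?S l" using c Jet by (auto simp: level_coords_def less_Suc_eq)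
          then have "total_deriv m (\<lambda>w. \<psi> l w c) w = jet_velocity (\<psi> l w) c" using Suc.IH wl by blast
          then show ?thesis using Jet False by (auto simp: \<psi>S jet_velocity_def)
        qed
      qed
    qed
  qed
  have stable: "\<psi> l' w c = \<psi> l w c" if "l \<le> l'" "c \<in> ?S l" for l l' w c
    using that(1)
  proof (induction l' rule: dec_induct)
    case (step l')
    then show ?case using that(2) by (cases c) (auto simp: \<psi>T \<psi>S level_coords_def)
  qed simp
  \<comment> \<open>All levels are below \<open>L\<close>, so stage \<open>L\<close> fills in all coordinates.\<close>
  define L where "L = Suc (\<Sum>j\<in>Y. \<gamma> j)"
  have L: "\<gamma> j < L" if "j \<in> Y" for j
    using that finY member_le_sum[of j Y \<gamma>] by (auto simp: L_def less_Suc_eq_le)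
  have SL: "?S L = jet_coords n" using L by (auto simp: level_coords_def jet_coords_def)
  have \<psi>F: "\<psi> L w (Jet j k) = ?F j k (\<psi> L w)" if w: "w \<in> B L" and j: "j \<in> Y" for w j k
  proof -
    have jn: "j < n" using j Y by auto
    have "\<psi> L w (Jet j k) = \<psi> (Suc (\<gamma> j)) w (Jet j k)"
      by (rule stable) (use L[OF j] jn in \<open>auto simp: level_coords_def\<close>)
    also have "\<dots> = ?F j k (\<psi> (\<gamma> j) w)" using j by (simp add: \<psi>S)
    also have "\<dots> = ?F j k (\<psi> L w)"
    proof (rule F(2)[OF j, unfolded depends_only_on_def, rule_format])
      show "\<psi> (\<gamma> j) w \<in> V" using w L[OF j] by (auto simp: B_def)
      show "\<psi> L w \<in> V" by (rule BV[OF w])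
      show "\<psi> (\<gamma> j) w c = \<psi> L w c" if "c \<in> ?S (\<gamma> j)" for c
        using stable[OF _ that, of L w] L[OF j] by simp
    qed
    finally show ?thesis .
  qed
  have \<phi>m: "?\<phi> p \<in> jet_space m" for p
    unfolding jet_space_def by (auto simp: jet_projection_def jet_coords_def split: jet_coord.splits)
  have \<phi>\<psi>: "?\<phi> (\<psi> L w) = w" if w: "w \<in> jet_space m" for w
  proof
    fix c
    show "?\<phi> (\<psi> L w) c = w c"
    proof (cases c)
      case Time
      then show ?thesis by (simp add: jet_projection_def \<psi>T)
    next
      case (Jet i k)
      show ?thesis
      proof (cases "i < m")
        case True
        have "\<psi> L w (Jet (\<zeta> i) k) = \<psi> 0 w (Jet (\<zeta> i) k)"
          by (rule stable) (use \<zeta>m[OF True] in \<open>auto simp: level_coords_def\<close>)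
        then show ?thesis using Jet True \<zeta>m[OF True] by (simp add: jet_projection_def \<psi>0)
      next
        case False
        then show ?thesis using Jet w by (auto simp: jet_projection_def jet_space_def jet_coords_def)
      qed
    qed
  qed
  \<comment> \<open>Started from a point of the graph, every stage recovers the coordinates it has reached.\<close>
  have \<psi>\<phi>: "\<psi> l (?\<phi> p) = (\<lambda>c. if c \<in> ?S l then p c else \<eta> c)"
    if p: "p \<in> V" "\<And>j k. j \<in> Y \<Longrightarrow> p (Jet j k) = ?F j k p" for p l
  proof (induction l)
    case 0
    show ?case
    proof
      fix c
      show "\<psi> 0 (?\<phi> p) c = (if c \<in> ?S 0 then p c else \<eta> c)"
        using \<iota> by (cases c) (auto simp: \<psi>T \<psi>0 jet_projection_def level_coords_def)
    qed
  next
    case (Suc l)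
    have inV: "\<psi> l (?\<phi> p) \<in> V"
      using p(1) \<eta>n \<epsilon> unfolding Suc V_def by (auto simp: jet_box_def jet_space_def)
    show ?case
    proof
      fix c
      show "\<psi> (Suc l) (?\<phi> p) c = (if c \<in> ?S (Suc l) then p c else \<eta> c)"
      proof (cases c)
        case Time
        then show ?thesis by (simp add: \<psi>T jet_projection_def level_coords_def)
      next
        case (Jet j k)
        show ?thesis
        proof (cases "j \<in> Y \<and> \<gamma> j = l")
          case True
          then have j: "j \<in> Y" "\<gamma> j = l" "j < n" using Y by auto
          have "?F j k (\<psi> l (?\<phi> p)) = ?F j k p"
            by (rule F(2)[OF j(1), unfolded depends_only_on_def, rule_format, OF inV p(1)]) (simp add: Suc j)
          then show ?thesis using Jet j p(2)[OF j(1)] by (simp add: \<psi>S level_coords_def)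
        next
          case False
          then have "c \<in> ?S (Suc l) \<longleftrightarrow> c \<in> ?S l" using Jet by (auto simp: level_coords_def less_Suc_eq)
          moreover have "\<psi> (Suc l) (?\<phi> p) c = \<psi> l (?\<phi> p) c" using False Jet by (auto simp: \<psi>S)
          ultimately show ?thesis by (simp add: Suc)
        qed
      qed
    qed
  qed
  let ?A = "diffiety n s U P \<inter> V"
  have A: "p \<in> ?A \<longleftrightarrow> p \<in> V \<and> (\<forall>j\<in>Y. \<forall>k. p (Jet j k) = ?F j k p)" for p using char[of p] by auto
  have \<psi>A: "\<psi> L w \<in> ?A" if "w \<in> B L" for w unfolding A using BV[OF that] \<psi>F[OF that] by blast
  have \<phi>B: "?\<phi> p \<in> B L" and \<psi>\<phi>L: "\<psi> L (?\<phi> p) = p" if "p \<in> ?A" for p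
  proof -
    from that have p: "p \<in> V" "\<And>j k. j \<in> Y \<Longrightarrow> p (Jet j k) = ?F j k p" unfolding A by auto
    have stage: "\<psi> l (?\<phi> p) = (\<lambda>c. if c \<in> ?S l then p c else \<eta> c)" for l
      by (rule \<psi>\<phi>) (use p in auto)
    have "\<psi> l (?\<phi> p) \<in> V" for l
      unfolding stage using p(1) \<eta>n \<epsilon> unfolding V_def by (auto simp: jet_box_def jet_space_def)
    then show "?\<phi> p \<in> B L" using \<phi>m by (simp add: B_def)
    show "\<psi> L (?\<phi> p) = p"
      unfolding stage SL using subsetD[OF Vn p(1)] \<eta>n by (auto simp: jet_space_def)
  qed
  have bij: "bij_betw ?\<phi> ?A (B L)"
    by (rule bij_betw_byWitness[where f' = "\<psi> L"]) (use \<psi>\<phi>L \<phi>\<psi> Bm \<phi>B \<psi>A in auto)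
  have inv: "inv_into ?A ?\<phi> w = \<psi> L w" if "w \<in> B L" for w
    using inv_into_f_f[OF bij_betw_imp_inj_on[OF bij] \<psi>A[OF that]] \<phi>\<psi>[OF Bm[OF that]] by simp
  \<comment> \<open>Stage \<open>L\<close> respects the derivation on all coordinates, so the chain rule applies to every \<open>g\<close>.\<close>
  have chain: "total_deriv m (\<lambda>w. g (\<psi> L w)) w = total_deriv n g (\<psi> L w)"
    if W: "jet_open n W" and g: "differential_function n W g" and w: "w \<in> B L" "\<psi> L w \<in> W" for W g w
  proof -
    let ?B = "{w\<in>B L. \<psi> L w \<in> W}"
    have o: "jet_open m ?B" by (rule jet_open_vimage[OF Bo W Bd \<psi>n[OF Bm]])
    have d: "differential_function m ?B (\<lambda>w. \<psi> L w c)" for c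
      by (rule differential_function_subset[OF Bd]) auto
    show ?thesis
    proof (rule total_deriv_chain[OF o W g, where S = UNIV and \<psi> = "\<psi> L", OF _ d])
      show "depends_only_on W g UNIV" by (auto simp: depends_only_on_def intro: arg_cong[of _ _ g])
      show "total_deriv m (\<lambda>w. \<psi> L w c) w = jet_velocity (\<psi> L w) c" if "c \<in> UNIV \<inter> jet_coords n" for c
        using vel[of L] w(1) that SL by blast
    qed (use w in auto)
  qed
  have comp: "differential_function m {w\<in>B L. \<psi> L w \<in> W} (\<lambda>w. g (\<psi> L w))" "jet_open m {w\<in>B L. \<psi> L w \<in> W}"
    if W: "jet_open n W" and g: "differential_function n W g" for W g
  proof -
    show o: "jet_open m {w\<in>B L. \<psi> L w \<in> W}" by (rule jet_open_vimage[OF Bo W Bd \<psi>n[OF Bm]])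
    show "differential_function m {w\<in>B L. \<psi> L w \<in> W} (\<lambda>w. g (\<psi> L w))"
      by (rule differential_function_comp[OF o W g]) (auto intro: differential_function_subset[OF Bd])
  qed
  have mor\<phi>: "diffiety_morphism n ?A m (B L) ?\<phi>"
    unfolding diffiety_morphism_def
  proof (intro conjI ballI allI impI)
    show "?\<phi> ` ?A \<subseteq> B L" using \<phi>B by auto
    fix c assume "c \<in> jet_coords m"
    have "differential_function n (jet_space n) (\<lambda>p. ?\<phi> p c)"
    proof (cases c)
      case Time
      then show ?thesis by (simp add: jet_projection_def differential_function_coord[OF jet_space_open])
    next
      case (Jet i k)
      then show ?thesis
        by (cases "i < m") (simp_all add: jet_projection_def differential_function_coord[OF jet_space_open]
            differential_function_const[OF jet_space_open])
    qed
    then show "smooth_on_subset n ?A (\<lambda>p. ?\<phi> p c)"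
      unfolding smooth_on_subset_def using Vn
      by (intro ballI exI[of _ "jet_space n"] exI[of _ "\<lambda>p. ?\<phi> p c"]) auto
  next
    fix W g assume Wg: "jet_open m W \<and> differential_function m W g"
    show "has_induced_deriv n (?A \<inter> ?\<phi> -` W) (g \<circ> ?\<phi>) (total_deriv m g \<circ> ?\<phi>)"
      unfolding has_induced_deriv_def
    proof (intro allI impI ballI)
      fix V' G q
      assume G: "jet_open n V' \<and> differential_function n V' G \<and> (\<forall>q\<in>V' \<inter> (?A \<inter> ?\<phi> -` W). (g \<circ> ?\<phi>) q = G q)"
        and q: "q \<in> V' \<inter> (?A \<inter> ?\<phi> -` W)"
      let ?B = "{w\<in>B L. \<psi> L w \<in> V'} \<inter> W"
      have oB: "jet_open m ?B" using comp(2)[of V' G] G Wg by (intro openin_Int) auto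
      have gB: "differential_function m ?B g" by (rule differential_function_subset[of m W g]) (use Wg in auto)
      let ?w = "?\<phi> q"
      have qA: "q \<in> ?A" "q \<in> V'" "?w \<in> W" using q by blast+
      have w2: "\<psi> L ?w = q" by (rule \<psi>\<phi>L[OF qA(1)])
      have w: "?w \<in> ?B" using \<phi>B[OF qA(1)] w2 qA(2,3) by simp
      have eq: "g w = G (\<psi> L w)" if w: "w \<in> ?B" for w
      proof -
        have wB: "w \<in> B L" "\<psi> L w \<in> V'" "w \<in> W" using w by auto
        have retract: "?\<phi> (\<psi> L w) = w" by (rule \<phi>\<psi>[OF Bm[OF wB(1)]])
        have "\<psi> L w \<in> V' \<inter> (?A \<inter> ?\<phi> -` W)"
          by (intro IntI vimageI2 \<psi>A[OF wB(1)] wB(2)) (use retract wB(3) in simp)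
        then have "(g \<circ> ?\<phi>) (\<psi> L w) = G (\<psi> L w)" using G by blast
        then show ?thesis using retract by simp
      qed
      have "total_deriv m g ?w = total_deriv m (\<lambda>w. G (\<psi> L w)) ?w"
        by (rule total_deriv_cong[OF oB gB eq w, symmetric])
      also have "\<dots> = total_deriv n G (\<psi> L ?w)"
        by (rule chain[of V']) (use G w in auto)
      also have "\<dots> = total_deriv n G q" by (simp only: w2)
      finally show "(total_deriv m g \<circ> ?\<phi>) q = total_deriv n G q" by (simp only: o_apply)
    qed
  qed
  have mor\<psi>: "diffiety_morphism m (B L) n ?A (inv_into ?A ?\<phi>)"
    unfolding diffiety_morphism_def
  proof (intro conjI ballI allI impI)
    show "inv_into ?A ?\<phi> ` B L \<subseteq> ?A" using \<psi>A by (auto simp: inv)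
    show "smooth_on_subset m (B L) (\<lambda>w. inv_into ?A ?\<phi> w c)" for c
      unfolding smooth_on_subset_def using Bo Bd
      by (intro ballI exI[of _ "B L"] exI[of _ "\<lambda>w. \<psi> L w c"]) (auto simp: inv)
  next
    fix W g assume Wg: "jet_open n W \<and> differential_function n W g"
    show "has_induced_deriv m (B L \<inter> inv_into ?A ?\<phi> -` W) (g \<circ> inv_into ?A ?\<phi>) (total_deriv n g \<circ> inv_into ?A ?\<phi>)"
      unfolding has_induced_deriv_def
    proof (intro allI impI ballI)
      fix V' G q
      assume G: "jet_open m V' \<and> differential_function m V' G \<and>
          (\<forall>q\<in>V' \<inter> (B L \<inter> inv_into ?A ?\<phi> -` W). (g \<circ> inv_into ?A ?\<phi>) q = G q)"
        and q: "q \<in> V' \<inter> (B L \<inter> inv_into ?A ?\<phi> -` W)"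
      let ?B = "{w\<in>B L. \<psi> L w \<in> W} \<inter> V'"
      have oB: "jet_open m ?B" using comp(2)[of W g] G Wg by (intro openin_Int) auto
      have GB: "differential_function m ?B G" by (rule differential_function_subset[of m V' G]) (use G in auto)
      have qB: "q \<in> ?B" "q \<in> B L" using q by (auto simp: inv)
      have eq: "G w = g (\<psi> L w)" if "w \<in> ?B" for w using G that by (auto simp: inv)
      have "total_deriv n g (\<psi> L q) = total_deriv m (\<lambda>w. g (\<psi> L w)) q"
        by (rule chain[of W, symmetric]) (use Wg qB in auto)
      also have "\<dots> = total_deriv m G q"
        by (rule total_deriv_cong[OF oB GB eq qB(1)])
      finally show "(total_deriv n g \<circ> inv_into ?A ?\<phi>) q = total_deriv m G q" using qB by (simp add: inv)
    qed
  qed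
  have "openin (top_of_set (diffiety n s U P)) ?A"
  proof -
    obtain T where T: "open T" "V = jet_space n \<inter> T" using V by (auto simp: openin_open)
    have "?A = diffiety n s U P \<inter> T" using T(2) jet_open_subset[OF U] by (auto simp: diffiety_def)
    with T(1) show ?thesis by (auto simp: openin_open)
  qed
  then show ?thesis unfolding flat_at_def
    using \<eta> \<eta>V Bo bij mor\<phi> mor\<psi> by (intro exI[of _ m] exI[of _ ?A] exI[of _ "B L"] exI[of _ ?\<phi>]) auto
qed

lemma diffiety_vanish:
  assumes "\<eta> \<in> diffiety n s U P" "i < s"
  shows "P i \<eta> = 0"
proof -
  have "(total_deriv n ^^ 0) (P i) \<eta> = 0" using assms unfolding diffiety_def by blast
  then show ?thesis by simp
qed

text \<open>
  The system and its solved form generate the same algebraic ideal on the box, hence define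
  the same diffiety there.
\<close>

theorem regular_obar_imp_flat:
  assumes U: "jet_open n U" and P: "\<And>i. i < s \<Longrightarrow> differential_function n U (P i)"
    and \<eta>: "\<eta> \<in> diffiety n s U P" and reg: "regular_obar_system_at n s U P \<eta>"
  shows "flat_at n s U P \<eta>"
proof -
  have \<eta>U: "\<eta> \<in> U" using \<eta> by (simp add: diffiety_def)
  have P0: "P i \<eta> = 0" if "i < s" for i using diffiety_vanish[OF \<eta> that] .
  obtain Y \<gamma> K \<epsilon> H Q R where Y: "Y \<subseteq> {..<n}" and K: "finite K" "\<epsilon> > 0" "jet_box n K \<eta> \<epsilon> \<subseteq> U"
    and H: "\<forall>j\<in>Y. differential_function n (jet_box n K \<eta> \<epsilon>) (H j)"
      "\<forall>j\<in>Y. depends_only_on (jet_box n K \<eta> \<epsilon>) (H j) (level_coords n Y \<gamma> (\<gamma> j))"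
    and Q: "\<forall>j\<in>Y. \<forall>i<s. differential_function n (jet_box n K \<eta> \<epsilon>) (Q j i)"
    and R: "\<forall>j\<in>Y. \<forall>i<s. differential_function n (jet_box n K \<eta> \<epsilon>) (R i j)"
    and Qeq: "\<forall>q\<in>jet_box n K \<eta> \<epsilon>. \<forall>j\<in>Y. q (Jet j 0) - H j q = (\<Sum>i<s. Q j i q * P i q)"
    and Req: "\<forall>q\<in>jet_box n K \<eta> \<epsilon>. \<forall>i<s. P i q = (\<Sum>j\<in>Y. R i j q * (q (Jet j 0) - H j q))"
    by (rule regular_obar_solved_form[OF U P \<eta>U P0 reg]) blast+
  have finY: "finite Y" using Y finite_subset by blast
  let ?V = "jet_box n K \<eta> \<epsilon>"
  have V: "jet_open n ?V" by (rule jet_open_jet_box[OF K(1)])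
  have PV: "differential_function n ?V (P i)" if "i < s" for i
    by (rule differential_function_subset[OF P[OF that] K(3)])
  have xH: "differential_function n ?V (\<lambda>q. q (Jet j 0) - H j q)" if "j \<in> Y" for j
    using H(1) that by (intro differential_function_diff[OF V] differential_function_coord[OF V]) auto
  have it: "(total_deriv n ^^ k) (\<lambda>q. q (Jet j 0) - H j q) p = p (Jet j k) - (total_deriv n ^^ k) (H j) p"
    if "j \<in> Y" "p \<in> ?V" for j k p
    using iterated_diff[OF V differential_function_coord[OF V] H(1)[rule_format, OF that(1)] that(2)]
      iterated_coord[OF V that(2), of j] that(1) Y by auto
  show ?thesis
  proof (rule solved_form_imp_flat[OF refl \<eta> U Y K H(1)[rule_format] H(2)[rule_format]])
    fix p assume p: "p \<in> ?V"
    show "p \<in> diffiety n s U P \<longleftrightarrow> (\<forall>j\<in>Y. \<forall>k. p (Jet j k) = (total_deriv n ^^ k) (H j) p)"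
    proof
      assume "p \<in> diffiety n s U P"
      then have z: "(total_deriv n ^^ k) (P i) p = 0" if "i < s" for i k using that by (simp add: diffiety_def)
      show "\<forall>j\<in>Y. \<forall>k. p (Jet j k) = (total_deriv n ^^ k) (H j) p"
      proof (intro ballI allI)
        fix j k assume j: "j \<in> Y"
        have "(total_deriv n ^^ k) (\<lambda>q. q (Jet j 0) - H j q) p = 0"
          by (rule iterated_ideal_vanish[OF V, where I = "{..<s}" and Q = "Q j" and P = P])
            (use j p z Q PV Qeq in auto)
        then show "p (Jet j k) = (total_deriv n ^^ k) (H j) p" using it[OF j p] by simp
      qed
    next
      assume z: "\<forall>j\<in>Y. \<forall>k. p (Jet j k) = (total_deriv n ^^ k) (H j) p"
      have "(total_deriv n ^^ k) (P i) p = 0" if i: "i < s" for i k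
        by (rule iterated_ideal_vanish[OF V, where I = Y and Q = "R i" and P = "\<lambda>j q. q (Jet j 0) - H j q"])
          (use i p z R xH it Req finY in auto)
      then show "p \<in> diffiety n s U P" using p K(3) by (auto simp: diffiety_def)
    qed
  qed
qed

theorem theorem49:
  fixes n s :: nat
    and U :: "jet set"
    and P :: "nat \<Rightarrow> jet \<Rightarrow> real"
    and \<eta> :: jet
  assumes "s \<le> n"
    and "differential_system n s U P"
    and "\<eta> \<in> diffiety n s U P"
  shows "(regular_obar_system_at n s U P \<eta> \<longrightarrow>
            (\<exists>Z. lazy_flat_parametrization n s U P \<eta> Z)) \<and>
         (\<forall>Z. Z \<subseteq> {..<n} \<longrightarrow>
            lazy_flat_parametrization n s U P \<eta> Z \<longrightarrow>
            truncated_det_nonzero_at n s U P ({..<n} - Z) \<eta> \<longrightarrow>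
            regular_obar_system_at n s U P \<eta>) \<and>
         (regular_obar_system_at n s U P \<eta> \<longrightarrow> flat_at n s U P \<eta>)"
proof -
  have U: "jet_open n U" and P: "\<And>i. i < s \<Longrightarrow> differential_function n U (P i)"
    using assms(2) by (auto simp: differential_system_def)
  have \<eta>: "\<eta> \<in> U" using assms(3) by (simp add: diffiety_def)
  have P0: "\<And>i. i < s \<Longrightarrow> P i \<eta> = 0" using diffiety_vanish[OF assms(3)] .
  show ?thesis
  proof (intro conjI allI impI)
    assume "regular_obar_system_at n s U P \<eta>"
    then show "\<exists>Z. lazy_flat_parametrization n s U P \<eta> Z"
      by (intro regular_obar_imp_lazy_flat U P \<eta> P0)
  next
    fix Z assume "lazy_flat_parametrization n s U P \<eta> Z" "truncated_det_nonzero_at n s U P ({..<n} - Z) \<eta>"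
    then show "regular_obar_system_at n s U P \<eta>"
      by (intro lazy_flat_imp_regular_obar[where Z = Z] U P \<eta> P0)
  next
    assume "regular_obar_system_at n s U P \<eta>"
    then show "flat_at n s U P \<eta>"
      by (intro regular_obar_imp_flat U P assms(3))
  qed
qed

end
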